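(* Let $m,N\ge 2$, let $\Omega\subset\mathbb{R}^N$ be a ball or an annulus centered at the origin, let $F=(f_1,\dots,f_m)\in C^{1,\alpha}([0,+\infty)\times\mathbb{R}^m;\mathbb{R}^m)$, and let $U=(u_1,\dots,u_m)$ be a classical solution of $$-\Delta U=F(|x|,U)\ \text{ in }\Omega,\qquad U=0\ \text{ on }\partial\Omega.$$ If $U$ is stable (i.e. linearized stable) and the system is fully coupled along $U$ in $\Omega$, then $U$ is radial, i.e. $U(x)$ depends only on $|x|$.
   Context: Here $0<\alpha<1$, equations for vector functions are understood componentwise, and a classical solution is a function $U\in C^2(\Omega;\mathbb{R}^m)\cap C^0(\overline\Omega;\mathbb{R}^m)$ satisfying the problem pointwise. $U$ is linearized stable if for every $\Psi=(\psi_1,\dots,\psi_m)\in C_c^1(\Omega;\mathbb{R}^m)$ $$Q_U(\Psi;\Omega)=\int_\Omega\Big[\sum_{i=1}^m|\nabla\psi_i|^2-\sum_{i,j=1}^m\frac{\partial f_i}{\partial u_j}(|x|,U(x))\psi_i\psi_j\Big]dx\ge0.$$ The system is fully coupled along $U$ in $\Omega$ if (a) it is cooperative in $\Omega$: $\frac{\partial f_i}{\partial u_j}(|x|,u_1,\dots,u_m)\ge0$ for all $(x,u_1,\dots,u_m)\in\Omega\times\mathbb{R}^m$ and all $i\ne j$; and (b) for all nonempty $I,J\subset\{1,\dots,m\}$ with $I\cap J=\emptyset$ and $I\cup J=\{1,\dots,m\}$, there exist $i_0\in I$, $j_0\in J$ such that $\{x\in\Omega:\frac{\partial f_{i_0}}{\partial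 u_{j_0}}(|x|,U(x))>0\}$ has positive Lebesgue measure. *)

theory Defs
  imports "HOL-Analysis.Analysis"
begin

definition ball_or_annulus :: "(real^'n) set \<Rightarrow> bool" where
  "ball_or_annulus \<Omega> \<longleftrightarrow>
     (\<exists>R>0. \<Omega> = ball 0 R) \<or>
     (\<exists>a b. 0 < a \<and> a < b \<and> \<Omega> = {x. a < norm x \<and> norm x < b})"

definition partial_deriv :: "'n \<Rightarrow> (real^'n \<Rightarrow> 'b::real_normed_vector) \<Rightarrow> real^'n \<Rightarrow> 'b" where
  "partial_deriv k f x = frechet_derivative f (at x) (axis k 1)"

definition gradient :: "(real^'n \<Rightarrow> real) \<Rightarrow> real^'n \<Rightarrow> real^'n" where
  "gradient f x = (\<chi> k. partial_deriv k f x)"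

definition laplacian :: "(real^'n \<Rightarrow> real) \<Rightarrow> real^'n \<Rightarrow> real" where
  "laplacian f x = (\<Sum>k\<in>UNIV. partial_deriv k (partial_deriv k f) x)"

text \<open>The class \<open>C^k(S)\<close>; only meant for open \<open>S\<close>.\<close>

primrec C_k_on :: "nat \<Rightarrow> (real^'n) set \<Rightarrow> (real^'n \<Rightarrow> 'b::real_normed_vector) \<Rightarrow> bool" where
  "C_k_on 0 S f \<longleftrightarrow> continuous_on S f"
| "C_k_on (Suc k) S f \<longleftrightarrow>
     (\<forall>x\<in>S. f differentiable (at x)) \<and> (\<forall>i. C_k_on k S (partial_deriv i f))"

text \<open>Since \<open>S\<close> is allowed to be unbounded, the Hoelder condition on the derivative is imposed on
  the compact subsets of \<open>S\<close>. The derivative is taken within \<open>S\<close>, hence is one-sided at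
  boundary points of \<open>S\<close>.\<close>

definition C1_holder_on ::
    "real \<Rightarrow> 'a::real_normed_vector set \<Rightarrow> ('a \<Rightarrow> 'b::real_normed_vector) \<Rightarrow> bool" where
  "C1_holder_on \<alpha> S f \<longleftrightarrow>
     (\<exists>f' :: 'a \<Rightarrow> 'a \<Rightarrow>\<^sub>L 'b.
        (\<forall>p\<in>S. (f has_derivative blinfun_apply (f' p)) (at p within S)) \<and>
        (\<forall>K. compact K \<and> K \<subseteq> S \<longrightarrow>
           (\<exists>C. \<forall>p\<in>K. \<forall>q\<in>K. dist (f' p) (f' q) \<le> C * dist p q powr \<alpha>)))"

definition du ::
    "(real \<times> (real^'m) \<Rightarrow> real^'m) \<Rightarrow> 'm \<Rightarrow> 'm \<Rightarrow> real \<Rightarrow> real^'m \<Rightarrow> real" where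
  \<comment> \<open>\<open>du F i j r u\<close> is the derivative of the component \<open>f_i\<close> of \<open>F\<close> with respect to \<open>u_j\<close> at \<open>(r, u)\<close>\<close>
  "du F i j r u = partial_deriv j (\<lambda>v. F (r, v) $ i) u"

definition classical_solution ::
    "(real \<times> (real^'m) \<Rightarrow> real^'m) \<Rightarrow> (real^'n) set \<Rightarrow> (real^'n \<Rightarrow> real^'m) \<Rightarrow> bool" where
  "classical_solution F \<Omega> U \<longleftrightarrow>
     C_k_on 2 \<Omega> U \<and> continuous_on (closure \<Omega>) U \<and>
     (\<forall>x\<in>\<Omega>. \<forall>i. - laplacian (\<lambda>y. U y $ i) x = F (norm x, U x) $ i) \<and>
     (\<forall>x\<in>frontier \<Omega>. U x = 0)"

definition C1c :: "(real^'n) set \<Rightarrow> (real^'n \<Rightarrow> real^'m) \<Rightarrow> bool" where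
  "C1c \<Omega> \<Psi> \<longleftrightarrow>
     C_k_on 1 \<Omega> \<Psi> \<and> compact (closure {x. \<Psi> x \<noteq> 0}) \<and> closure {x. \<Psi> x \<noteq> 0} \<subseteq> \<Omega>"

definition Q_form ::
    "(real \<times> (real^'m) \<Rightarrow> real^'m) \<Rightarrow> (real^'n \<Rightarrow> real^'m) \<Rightarrow> (real^'n) set
      \<Rightarrow> (real^'n \<Rightarrow> real^'m) \<Rightarrow> real" where
  "Q_form F U \<Omega> \<Psi> =
     set_lebesgue_integral lebesgue \<Omega> (\<lambda>x.
       (\<Sum>i\<in>UNIV. (norm (gradient (\<lambda>y. \<Psi> y $ i) x))\<^sup>2) -
       (\<Sum>i\<in>UNIV. \<Sum>j\<in>UNIV. du F i j (norm x) (U x) * \<Psi> x $ i * \<Psi> x $ j))"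

definition linearized_stable ::
    "(real \<times> (real^'m) \<Rightarrow> real^'m) \<Rightarrow> (real^'n) set \<Rightarrow> (real^'n \<Rightarrow> real^'m) \<Rightarrow> bool" where
  "linearized_stable F \<Omega> U \<longleftrightarrow> (\<forall>\<Psi>. C1c \<Omega> \<Psi> \<longrightarrow> Q_form F U \<Omega> \<Psi> \<ge> 0)"

definition cooperative :: "(real \<times> (real^'m) \<Rightarrow> real^'m) \<Rightarrow> (real^'n) set \<Rightarrow> bool" where
  "cooperative F \<Omega> \<longleftrightarrow> (\<forall>x\<in>\<Omega>. \<forall>u. \<forall>i j. i \<noteq> j \<longrightarrow> du F i j (norm x) u \<ge> 0)"

definition fully_coupled ::
    "(real \<times> (real^'m) \<Rightarrow> real^'m) \<Rightarrow> (real^'n) set \<Rightarrow> (real^'n \<Rightarrow> real^'m) \<Rightarrow> bool" where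
  "fully_coupled F \<Omega> U \<longleftrightarrow>
     cooperative F \<Omega> \<and>
     (\<forall>I J :: 'm set. I \<noteq> {} \<and> J \<noteq> {} \<and> I \<inter> J = {} \<and> I \<union> J = UNIV \<longrightarrow>
        (\<exists>i\<in>I. \<exists>j\<in>J. emeasure lebesgue {x\<in>\<Omega>. du F i j (norm x) (U x) > 0} > 0))"

definition radial_on :: "(real^'n) set \<Rightarrow> (real^'n \<Rightarrow> 'b) \<Rightarrow> bool" where
  "radial_on S U \<longleftrightarrow> (\<exists>g :: real \<Rightarrow> 'b. \<forall>x\<in>S. U x = g (norm x))"

end

theory Submission
  imports Defs
begin

text \<open>
  The reason for the symmetry is that the positive part of a nonzero angular derivative of \<open>U\<close>,
  used as a test function, contradicts stability. Fix an orthonormal pair \<open>p\<close>, \<open>q\<close>, let \<open>R\<^sub>t\<close> be the rotation by \<open>t\<close> in the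
  plane of \<open>p\<close> and \<open>q\<close>, and let \<open>V\<^sub>i\<close> be the derivative of \<open>u\<^sub>i\<close> along the orbits of \<open>R\<^sub>t\<close>. The
  Laplacian, the domain and \<open>|x|\<close> are invariant under rotations, so formally \<open>V\<close> solves the
  linearized system \<open>-\<Delta> V\<^sub>i = \<Sum>\<^sub>j a\<^sub>i\<^sub>j V\<^sub>j\<close> with \<open>a\<^sub>i\<^sub>j = \<partial>f\<^sub>i/\<partial>u\<^sub>j (|x|, U)\<close> and zero boundary values.
  Testing the \<open>i\<close>-th equation with the positive part of \<open>V\<^sub>i\<close> and using \<open>a\<^sub>i\<^sub>j \<ge> 0\<close> for \<open>i \<noteq> j\<close> gives
  \<open>Q(V\<^sup>+) \<le> 0\<close>. Since \<open>Q \<ge> 0\<close>, the field \<open>V\<^sup>+\<close> minimizes \<open>Q\<close>, so the first variation of \<open>Q\<close> at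
  \<open>V\<^sup>+\<close> in the direction of a function \<open>\<psi> \<ge> 0\<close> placed in the \<open>i\<close>-th component is nonnegative.
  Dropping the off-diagonal terms, which have a sign, one finds that \<open>V\<^sub>i\<^sup>+\<close> is a weak supersolution of
  the scalar operator \<open>-\<Delta> - a\<^sub>i\<^sub>i\<close> (lemma \<open>V_weak_supersolution\<close>). By a strong minimum principle
  (lemma \<open>weak_supersolution_vanishes_near_zero\<close>) the set \<open>{V\<^sub>i \<le> 0}\<close> is open.

  Along an orbit, \<open>t \<mapsto> u\<^sub>i(R\<^sub>t x)\<close> is periodic with derivative \<open>V\<^sub>i(R\<^sub>t x)\<close>. By Rolle's theorem \<open>V\<^sub>i\<close>
  vanishes somewhere on the orbit, so by connectedness \<open>V\<^sub>i \<le> 0\<close> on the whole orbit; a periodic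
  nonincreasing function is constant (lemma \<open>U_rot\<close>). Any two points of equal norm lie on one such
  orbit.

  Since \<open>U\<close> is only \<open>C\<^sup>2\<close> inside and \<open>C\<^sup>0\<close> up to the boundary, \<open>V\<close> is merely \<open>C\<^sup>1\<close>, and nothing
  is known about it near the boundary. The argument is therefore run for the difference quotients
  \<open>w\<^sub>\<theta> = (U \<circ> R\<^sub>\<theta> - U)/\<theta>\<close>: these are \<open>C\<^sup>2\<close>, vanish on the boundary and solve the linearized system
  up to an error that vanishes as \<open>\<theta> \<rightarrow> 0\<close>. A maximum principle in thin shells
  (lemma \<open>thin_shell_estimate\<close>) bounds them uniformly in \<open>\<theta>\<close> and up to the boundary. Positive parts
  are replaced by a \<open>C\<^sup>1\<close> convex truncation that vanishes for small arguments, so that the test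
  functions have compact support, and dominated convergence yields the inequality for \<open>V\<^sup>+\<close>
  (lemma \<open>limit_is_weak_supersolution\<close>). No elliptic regularity theory enters.
\<close>

section \<open>Partial derivatives and the classes \<open>C^k\<close>\<close>

lemma C_k_on_1_iff:
  "C_k_on 1 S f \<longleftrightarrow>
    (\<forall>x\<in>S. f differentiable (at x)) \<and> (\<forall>k. continuous_on S (partial_deriv k f))"
  by simp

lemma C_k_on_2_iff:
  "C_k_on 2 S f \<longleftrightarrow>
    (\<forall>x\<in>S. f differentiable (at x)) \<and> (\<forall>k. \<forall>x\<in>S. partial_deriv k f differentiable (at x)) \<and>
    (\<forall>k l. continuous_on S (partial_deriv l (partial_deriv k f)))"
  by (auto simp: numeral_2_eq_2)

lemma continuous_on_if_differentiable:
  "(\<And>x. x \<in> S \<Longrightarrow> f differentiable (at x)) \<Longrightarrow> continuous_on S f"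
  by (meson continuous_at_imp_continuous_on differentiable_imp_continuous_within)

lemma C_k_on_2_imp_1: "C_k_on 2 S f \<Longrightarrow> C_k_on 1 S f"
  unfolding C_k_on_2_iff C_k_on_1_iff by (auto intro: continuous_on_if_differentiable)

lemma partial_deriv_eqI:
  "(f has_derivative f') (at x) \<Longrightarrow> partial_deriv k f x = f' (axis k 1)"
  unfolding partial_deriv_def using frechet_derivative_at by metis

lemma partial_deriv_cong:
  assumes "open S" "x \<in> S" "\<And>y. y \<in> S \<Longrightarrow> f y = g y"
  shows "partial_deriv k f x = partial_deriv k g x"
proof -
  have "(f has_derivative f') (at x) \<longleftrightarrow> (g has_derivative f') (at x)" for f'
    using assms has_derivative_transform_within_open[of f f' x UNIV S g]
      has_derivative_transform_within_open[of g f' x UNIV S f] by auto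
  then show ?thesis unfolding partial_deriv_def frechet_derivative_def by simp
qed

lemma differentiable_cong:
  assumes "open S" "x \<in> S" "\<And>y. y \<in> S \<Longrightarrow> f y = g y" "f differentiable (at x)"
  shows "g differentiable (at x)"
  using assms has_derivative_transform_within_open[of f _ x UNIV S g]
  unfolding differentiable_def by blast

lemma C_k_on_cong:
  assumes "open S" "\<And>x. x \<in> S \<Longrightarrow> f x = g x" "C_k_on k S f"
  shows "C_k_on k S g"
  using assms(2,3)
proof (induction k arbitrary: f g)
  case 0
  then show ?case by (simp cong: continuous_on_cong)
next
  case (Suc k)
  have "partial_deriv i f x = partial_deriv i g x" if "x \<in> S" for i x
    using assms(1) that Suc.prems(1) by (rule partial_deriv_cong)
  then have "C_k_on k S (partial_deriv i g)" for i
    using Suc.IH[of "partial_deriv i f" "partial_deriv i g"] Suc.prems(2) by simp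
  moreover have "g differentiable (at x)" if "x \<in> S" for x
    using differentiable_cong[OF assms(1) that Suc.prems(1)] Suc.prems(2) that by simp
  ultimately show ?case by simp
qed

lemma has_derivative_gradient:
  fixes f :: "real^'n \<Rightarrow> real"
  assumes "f differentiable (at x)"
  shows "(f has_derivative (\<lambda>h. gradient f x \<bullet> h)) (at x)"
proof -
  have d: "(f has_derivative frechet_derivative f (at x)) (at x)"
    using assms frechet_derivative_works by blast
  then have lin: "linear (frechet_derivative f (at x))"
    by (simp add: has_derivative_linear)
  have "frechet_derivative f (at x) h = gradient f x \<bullet> h" for h
  proof -
    have "frechet_derivative f (at x) h = frechet_derivative f (at x) (\<Sum>k\<in>UNIV. h $ k *\<^sub>R axis k 1)"
      using basis_expansion[of h] by (simp add: scalar_mult_eq_scaleR)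
    also have "\<dots> = gradient f x \<bullet> h"
      unfolding linear_sum[OF lin]
      by (simp add: linear_cmul[OF lin] inner_vec_def gradient_def partial_deriv_def mult.commute)
    finally show ?thesis .
  qed
  then show ?thesis using d by (metis (no_types, lifting) ext)
qed

lemma gradient_nth [simp]: "gradient f x $ k = partial_deriv k f x"
  by (simp add: gradient_def)

lemma partial_deriv_component:
  assumes "f differentiable (at x)"
  shows "partial_deriv k (\<lambda>y. f y $ i) x = partial_deriv k f x $ i"
    and "(\<lambda>y. f y $ i) differentiable (at x)"
proof -
  obtain f' where f': "(f has_derivative f') (at x)" using assms differentiable_def by blast
  have c: "((\<lambda>y. f y $ i) has_derivative (\<lambda>h. f' h $ i)) (at x)"
    by (rule bounded_linear.has_derivative[OF bounded_linear_vec_nth f'])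
  show "partial_deriv k (\<lambda>y. f y $ i) x = partial_deriv k f x $ i"
    by (simp add: partial_deriv_eqI[OF c] partial_deriv_eqI[OF f'])
  show "(\<lambda>y. f y $ i) differentiable (at x)" using c differentiable_def by blast
qed

lemma C_k_on_component:
  assumes "open S" "C_k_on k S f"
  shows "C_k_on k S (\<lambda>x. f x $ i)"
  using assms(2)
proof (induction k arbitrary: f)
  case 0
  then show ?case by (auto intro: continuous_intros)
next
  case (Suc k)
  have "C_k_on k S (partial_deriv j (\<lambda>x. f x $ i))" for j
    using Suc.prems partial_deriv_component(1)[of f _ j i, symmetric]
    by (intro C_k_on_cong[OF assms(1) _ Suc.IH[of "partial_deriv j f"]]) auto
  then show ?case using Suc.prems partial_deriv_component(2)[of f _ i] by simp
qed

lemma C_k_on_1_vec: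
  fixes f :: "real^'n \<Rightarrow> real^'m"
  assumes "\<And>i. C_k_on 1 S (\<lambda>x. f x $ i)"
  shows "C_k_on 1 S f"
proof -
  have d: "(f has_derivative (\<lambda>h. \<chi> i. gradient (\<lambda>y. f y $ i) x \<bullet> h)) (at x)" if "x \<in> S" for x
  proof -
    have "((\<lambda>y. f y $ i) has_derivative (\<lambda>h. gradient (\<lambda>y. f y $ i) x \<bullet> h)) (at x)" for i
      using assms that by (intro has_derivative_gradient) simp
    then have "((\<lambda>y. f y \<bullet> b) has_derivative (\<lambda>h. (\<chi> i. gradient (\<lambda>y. f y $ i) x \<bullet> h) \<bullet> b)) (at x)"
      if "b \<in> Basis" for b
      using that by (auto simp: Basis_vec_def inner_axis)
    then show ?thesis by (subst has_derivative_componentwise_within) blast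
  qed
  have "partial_deriv k f x = (\<chi> i. partial_deriv k (\<lambda>y. f y $ i) x)" if "x \<in> S" for k x
    by (simp add: partial_deriv_eqI[OF d[OF that]] vec_eq_iff inner_axis)
  moreover have "continuous_on S (\<lambda>x. \<chi> i. partial_deriv k (\<lambda>y. f y $ i) x)" for k
    using assms by (intro continuous_intros) auto
  ultimately have "continuous_on S (partial_deriv k f)" for k
    by (metis (no_types, lifting) continuous_on_eq)
  then show ?thesis using d by (auto simp: differentiable_def)
qed

lemma has_derivative_cmult_sum:
  fixes f :: "'l \<Rightarrow> real^'n \<Rightarrow> real"
  assumes "\<And>l. l \<in> L \<Longrightarrow> f l differentiable (at x)"
  shows "partial_deriv k (\<lambda>x. \<Sum>l\<in>L. c l * f l x) x = (\<Sum>l\<in>L. c l * partial_deriv k (f l) x)"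
    and "(\<lambda>x. \<Sum>l\<in>L. c l * f l x) differentiable (at x)"
proof -
  have d: "((\<lambda>x. \<Sum>l\<in>L. c l * f l x) has_derivative
      (\<lambda>h. \<Sum>l\<in>L. c l * (gradient (f l) x \<bullet> h))) (at x)"
    using assms by (auto intro!: derivative_eq_intros has_derivative_gradient)
  show "partial_deriv k (\<lambda>x. \<Sum>l\<in>L. c l * f l x) x = (\<Sum>l\<in>L. c l * partial_deriv k (f l) x)"
    by (simp add: partial_deriv_eqI[OF d] inner_axis)
  show "(\<lambda>x. \<Sum>l\<in>L. c l * f l x) differentiable (at x)"
    using d differentiable_def by blast
qed

lemma C_k_on_cmult_sum:
  fixes f :: "'l \<Rightarrow> real^'n \<Rightarrow> real"
  assumes "open S" "\<And>l. l \<in> L \<Longrightarrow> C_k_on k S (f l)"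
  shows "C_k_on k S (\<lambda>x. \<Sum>l\<in>L. c l * f l x)"
  using assms(2)
proof (induction k arbitrary: f)
  case 0
  then show ?case by (auto intro!: continuous_intros)
next
  case (Suc k)
  have "C_k_on k S (partial_deriv j (\<lambda>x. \<Sum>l\<in>L. c l * f l x))" for j
  proof (rule C_k_on_cong[OF assms(1)])
    show "C_k_on k S (\<lambda>x. \<Sum>l\<in>L. c l * partial_deriv j (f l) x)"
      using Suc.prems by (intro Suc.IH) simp
  qed (use Suc.prems has_derivative_cmult_sum(1)[of L f _ j c] in simp)
  then show ?case using Suc.prems has_derivative_cmult_sum(2)[of L f _ c] by simp
qed

lemma laplacian_cmult_sum:
  fixes f :: "'l \<Rightarrow> real^'n \<Rightarrow> real"
  assumes "open S" "x \<in> S" "\<And>l. l \<in> L \<Longrightarrow> C_k_on 2 S (f l)"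
  shows "laplacian (\<lambda>x. \<Sum>l\<in>L. c l * f l x) x = (\<Sum>l\<in>L. c l * laplacian (f l) x)"
proof -
  have "partial_deriv k (partial_deriv k (\<lambda>x. \<Sum>l\<in>L. c l * f l x)) x =
      partial_deriv k (\<lambda>x. \<Sum>l\<in>L. c l * partial_deriv k (f l) x) x" for k
    using assms by (intro partial_deriv_cong[OF assms(1,2)] has_derivative_cmult_sum)
      (auto simp: C_k_on_2_iff)
  also have "\<dots> k = (\<Sum>l\<in>L. c l * partial_deriv k (partial_deriv k (f l)) x)" for k
    using assms by (intro has_derivative_cmult_sum) (auto simp: C_k_on_2_iff)
  finally show ?thesis unfolding laplacian_def
    by (simp add: sum_distrib_left sum.swap[of _ L])
qed

lemma partial_deriv_compose_linear:
  fixes f :: "real^'n \<Rightarrow> real"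
  assumes "linear R" "f differentiable (at (R x))"
  shows "partial_deriv k (\<lambda>x. f (R x)) x = (\<Sum>l\<in>UNIV. R (axis k 1) $ l * partial_deriv l f (R x))"
    and "(\<lambda>x. f (R x)) differentiable (at x)"
proof -
  have d: "((\<lambda>x. f (R x)) has_derivative (\<lambda>h. gradient f (R x) \<bullet> R h)) (at x)"
    using has_derivative_compose[OF linear_imp_has_derivative[OF assms(1)]
        has_derivative_gradient[OF assms(2)]] by simp
  show "partial_deriv k (\<lambda>x. f (R x)) x = (\<Sum>l\<in>UNIV. R (axis k 1) $ l * partial_deriv l f (R x))"
    by (simp add: partial_deriv_eqI[OF d] inner_vec_def mult.commute)
  show "(\<lambda>x. f (R x)) differentiable (at x)" using d differentiable_def by blast
qed

lemma C_k_on_compose_linear: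
  fixes f :: "real^'n \<Rightarrow> real"
  assumes "open S" "linear R" "R ` S \<subseteq> S" "C_k_on k S f"
  shows "C_k_on k S (\<lambda>x. f (R x))"
  using assms(4)
proof (induction k arbitrary: f)
  case 0
  have "continuous_on S R" by (simp add: assms(2) linear_continuous_on linear_linear)
  then show ?case using 0 assms(3) by (auto intro: continuous_on_compose2)
next
  case (Suc k)
  have "C_k_on k S (partial_deriv j (\<lambda>x. f (R x)))" for j
  proof (rule C_k_on_cong[OF assms(1)])
    show "C_k_on k S (\<lambda>x. \<Sum>l\<in>UNIV. R (axis j 1) $ l * partial_deriv l f (R x))"
      using Suc.prems by (intro C_k_on_cmult_sum[OF assms(1)] Suc.IH) simp
  qed (use Suc.prems assms(3) partial_deriv_compose_linear(1)[OF assms(2), of f _ j] in auto)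
  then show ?case
    using Suc.prems assms(3) partial_deriv_compose_linear(2)[OF assms(2), of f] by auto
qed

text \<open>
  By the chain rule the Hessian of \<open>f \<circ> R\<close> is \<open>R\<^sup>T H R\<close>, and \<open>R R\<^sup>T = 1\<close> leaves its trace unchanged.
\<close>

lemma laplacian_compose_orthogonal:
  fixes f :: "real^'n \<Rightarrow> real"
  assumes "open S" "orthogonal_transformation R" "R ` S \<subseteq> S" "C_k_on 2 S f" "x \<in> S"
  shows "laplacian (\<lambda>x. f (R x)) x = laplacian f (R x)"
proof -
  have lin: "linear R" using assms(2) by (simp add: orthogonal_transformation_def)
  have C2: "f differentiable (at (R y))" "partial_deriv k f differentiable (at (R y))" if "y \<in> S" for y k
    using assms that by (auto simp: C_k_on_2_iff)
  have "partial_deriv k (partial_deriv k (\<lambda>x. f (R x))) x =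
      partial_deriv k (\<lambda>x. \<Sum>l\<in>UNIV. R (axis k 1) $ l * partial_deriv l f (R x)) x" for k
    by (intro partial_deriv_cong[OF assms(1,5)] partial_deriv_compose_linear[OF lin] C2)
  also have "\<dots> k = (\<Sum>l\<in>UNIV. R (axis k 1) $ l * partial_deriv k (\<lambda>x. partial_deriv l f (R x)) x)" for k
    by (intro has_derivative_cmult_sum partial_deriv_compose_linear[OF lin] C2 assms)
  also have "\<dots> k = (\<Sum>l\<in>UNIV. \<Sum>m\<in>UNIV. R (axis k 1) $ l * R (axis k 1) $ m *
      partial_deriv m (partial_deriv l f) (R x))" for k
    by (simp add: partial_deriv_compose_linear[OF lin C2(2)[OF assms(5)]] sum_distrib_left mult.assoc)
  finally have "laplacian (\<lambda>x. f (R x)) x = (\<Sum>k\<in>UNIV. \<Sum>l\<in>UNIV. \<Sum>m\<in>UNIV.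
      R (axis k 1) $ l * R (axis k 1) $ m * partial_deriv m (partial_deriv l f) (R x))"
    unfolding laplacian_def by (intro sum.cong) auto
  also have "\<dots> = (\<Sum>l\<in>UNIV. \<Sum>m\<in>UNIV. (\<Sum>k\<in>UNIV. R (axis k 1) $ l * R (axis k 1) $ m) *
      partial_deriv m (partial_deriv l f) (R x))"
    unfolding sum_distrib_right
    by (subst sum.swap, rule sum.cong[OF refl], rule sum.swap)
  finally have *: "laplacian (\<lambda>x. f (R x)) x = (\<Sum>l\<in>UNIV. \<Sum>m\<in>UNIV.
      (\<Sum>k\<in>UNIV. R (axis k 1) $ l * R (axis k 1) $ m) * partial_deriv m (partial_deriv l f) (R x))" .
  have orth: "(\<Sum>k\<in>UNIV. R (axis k 1) $ l * R (axis k 1) $ m) = (if m = l then 1 else 0)" for l m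
  proof -
    have "orthogonal_matrix (matrix R)"
      using assms(2) orthogonal_transformation_matrix by blast
    then have "matrix R ** transpose (matrix R) = mat 1" by (simp add: orthogonal_matrix_def)
    then have "(matrix R ** transpose (matrix R)) $ l $ m = mat 1 $ l $ m" by simp
    then show ?thesis by (auto simp: matrix_matrix_mult_def transpose_def matrix_def mat_def)
  qed
  show ?thesis
    unfolding * orth by (simp add: laplacian_def if_distrib[where f = "\<lambda>a. a * _"] cong: if_cong)
qed

lemma partial_deriv_chain:
  fixes f :: "real^'n \<Rightarrow> real"
  assumes "(\<phi> has_real_derivative \<phi>') (at (f x))" "f differentiable (at x)"
  shows "partial_deriv k (\<lambda>x. \<phi> (f x)) x = \<phi>' * partial_deriv k f x"
    and "(\<lambda>x. \<phi> (f x)) differentiable (at x)"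
proof -
  have d: "((\<lambda>x. \<phi> (f x)) has_derivative (\<lambda>h. \<phi>' * (gradient f x \<bullet> h))) (at x)"
    using has_derivative_compose[OF has_derivative_gradient[OF assms(2)],
      OF assms(1)[unfolded has_field_derivative_def]] by simp
  show "partial_deriv k (\<lambda>x. \<phi> (f x)) x = \<phi>' * partial_deriv k f x"
    by (simp add: partial_deriv_eqI[OF d] inner_axis)
  show "(\<lambda>x. \<phi> (f x)) differentiable (at x)" using d differentiable_def by blast
qed

lemma gradient_chain:
  fixes f :: "real^'n \<Rightarrow> real"
  assumes "(\<phi> has_real_derivative \<phi>') (at (f x))" "f differentiable (at x)"
  shows "gradient (\<lambda>x. \<phi> (f x)) x = \<phi>' *\<^sub>R gradient f x"
  by (simp add: vec_eq_iff partial_deriv_chain[OF assms])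

lemma C_k_on_1_chain:
  fixes f :: "real^'n \<Rightarrow> real"
  assumes "\<And>t. (\<phi> has_real_derivative \<phi>' t) (at t)" "continuous_on UNIV \<phi>'" "C_k_on 1 S f"
  shows "C_k_on 1 S (\<lambda>x. \<phi> (f x))"
proof -
  have f: "f differentiable (at x)" if "x \<in> S" for x using assms(3) that by simp
  have "continuous_on S f" using f by (rule continuous_on_if_differentiable)
  then have "continuous_on S (\<lambda>x. \<phi>' (f x) * partial_deriv k f x)" for k
    using assms(3) by (intro continuous_intros continuous_on_compose2[OF assms(2)]) auto
  then have "continuous_on S (partial_deriv k (\<lambda>x. \<phi> (f x)))" for k
    by (rule continuous_on_eq) (use partial_deriv_chain(1)[OF assms(1) f] in auto)
  then show ?thesis unfolding C_k_on_1_iff using partial_deriv_chain(2)[OF assms(1) f] by blast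
qed

lemma C_k_on_subset: "C_k_on k S f \<Longrightarrow> T \<subseteq> S \<Longrightarrow> C_k_on k T f"
  by (induction k arbitrary: f) (auto intro: continuous_on_subset)

lemma continuous_on_gradient:
  fixes f :: "real^'n \<Rightarrow> real"
  assumes "C_k_on 1 S f"
  shows "continuous_on S (gradient f)"
  unfolding gradient_def[abs_def] using assms by (intro continuous_intros) auto

lemma continuous_on_laplacian:
  fixes f :: "real^'n \<Rightarrow> real"
  assumes "C_k_on 2 S f"
  shows "continuous_on S (laplacian f)"
  unfolding laplacian_def[abs_def] using assms
  by (intro continuous_intros) (auto simp: C_k_on_2_iff)

lemma linear_combination:
  fixes f g :: "real^'n \<Rightarrow> real"
  assumes "open S" "x \<in> S"
  shows "C_k_on k S f \<Longrightarrow> C_k_on k S g \<Longrightarrow> C_k_on k S (\<lambda>x. c * f x + d * g x)"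
    and "C_k_on 1 S f \<Longrightarrow> C_k_on 1 S g \<Longrightarrow>
      gradient (\<lambda>x. c * f x + d * g x) x = c *\<^sub>R gradient f x + d *\<^sub>R gradient g x"
    and "C_k_on 2 S f \<Longrightarrow> C_k_on 2 S g \<Longrightarrow>
      laplacian (\<lambda>x. c * f x + d * g x) x = c * laplacian f x + d * laplacian g x"
proof -
  define F where "F = (\<lambda>b. if b then f else g)"
  define C where "C = (\<lambda>b. if b then c else d)"
  have eq: "(\<lambda>x. c * f x + d * g x) = (\<lambda>x. \<Sum>b\<in>UNIV. C b * F b x)"
    by (simp add: UNIV_bool F_def C_def fun_eq_iff)
  show "C_k_on k S f \<Longrightarrow> C_k_on k S g \<Longrightarrow> C_k_on k S (\<lambda>x. c * f x + d * g x)"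
    unfolding eq by (rule C_k_on_cmult_sum[OF assms(1)]) (simp add: F_def)
  show "gradient (\<lambda>x. c * f x + d * g x) x = c *\<^sub>R gradient f x + d *\<^sub>R gradient g x"
    if "C_k_on 1 S f" "C_k_on 1 S g"
  proof -
    have "F b differentiable (at x)" for b
      using that assms(2) by (simp add: F_def)
    then show ?thesis
      unfolding eq by (simp add: vec_eq_iff has_derivative_cmult_sum(1)[of UNIV F x _ C])
        (simp add: UNIV_bool F_def C_def)
  qed
  show "laplacian (\<lambda>x. c * f x + d * g x) x = c * laplacian f x + d * laplacian g x"
    if "C_k_on 2 S f" "C_k_on 2 S g"
  proof -
    have "C_k_on 2 S (F b)" for b using that by (simp add: F_def)
    then show ?thesis
      unfolding eq using laplacian_cmult_sum[OF assms, of UNIV F C]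
      by (simp add: UNIV_bool F_def C_def)
  qed
qed

section \<open>Integration by parts for compactly supported functions\<close>

lemma set_integrable_compact_support:
  fixes h :: "'a::euclidean_space \<Rightarrow> real"
  assumes "compact K" "K \<subseteq> S" "continuous_on S h" "\<And>x. x \<in> S - K \<Longrightarrow> h x = 0"
  shows "set_integrable lborel S h"
proof -
  have "integrable lborel (\<lambda>x. indicator K x *\<^sub>R h x)"
    using assms by (intro borel_integrable_compact) (auto intro: continuous_on_subset)
  moreover have "(\<lambda>x. indicator K x *\<^sub>R h x) = (\<lambda>x. indicator S x *\<^sub>R h x)"
    using assms by (auto simp: indicator_def fun_eq_iff)
  ultimately show ?thesis unfolding set_integrable_def by metis
qed

lemma set_integral_lebesgue_eq_lborel:
  fixes h :: "'a::euclidean_space \<Rightarrow> real"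
  assumes "open S" "continuous_on S h"
  shows "(LINT x:S|lebesgue. h x) = (LINT x:S|lborel. h x)"
proof -
  have "(\<lambda>x. indicator S x *\<^sub>R h x) \<in> borel_measurable borel"
    using assms by (intro borel_measurable_continuous_on_indicator) auto
  then show ?thesis unfolding set_lebesgue_integral_def by (intro integral_completion) simp
qed

lemma continuous_on_extend_zero:
  fixes h :: "'a::t2_space \<Rightarrow> real"
  assumes "open S" "compact K" "K \<subseteq> S" "continuous_on S h" "\<And>x. x \<in> S - K \<Longrightarrow> h x = 0"
  shows "continuous_on UNIV (\<lambda>x. if x \<in> S then h x else 0)"
proof -
  have "continuous_on S (\<lambda>x. if x \<in> S then h x else 0)"
    by (rule continuous_on_eq[OF assms(4)]) simp
  moreover have "continuous_on (- K) (\<lambda>x. if x \<in> S then h x else 0)"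
    by (rule continuous_on_eq[OF continuous_on_const[of _ 0]]) (use assms(5) in auto)
  moreover have "open (- K)" using assms(2) compact_imp_closed by blast
  ultimately have "continuous_on (S \<union> - K) (\<lambda>x. if x \<in> S then h x else 0)"
    using assms(1) continuous_on_open_Un by blast
  moreover have "S \<union> - K = UNIV" using assms(3) by blast
  ultimately show ?thesis by simp
qed

lemma lborel_integral_translate:
  fixes g :: "'a::euclidean_space \<Rightarrow> real"
  assumes "continuous_on UNIV g"
  shows "(\<integral>x. g (x + c) \<partial>lborel) = (\<integral>x. g x \<partial>lborel)"
proof -
  have "(\<integral>x. g x \<partial>lborel) = (\<integral>x. g x \<partial>distr lborel borel ((+) c))"
    by (simp add: lborel_distr_plus)
  also have "\<dots> = (\<integral>x. g (c + x) \<partial>lborel)"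
    using assms by (intro integral_distr) (auto intro: borel_measurable_continuous_onI)
  finally show ?thesis by (simp add: add.commute)
qed

text \<open>
  The divergence theorem for compactly supported functions comes from translation invariance of the
  Lebesgue measure: all difference quotients of \<open>g\<close> in the direction \<open>e\<close> have integral zero, and by
  the mean value theorem they are dominated by \<open>sup |g'|\<close> on a fixed ball.
\<close>

lemma integral_directional_derivative_eq_0:
  fixes g :: "'a::euclidean_space \<Rightarrow> real"
  assumes K: "compact K" "\<And>x. x \<notin> K \<Longrightarrow> g x = 0" "\<And>x. x \<notin> K \<Longrightarrow> g' x = 0"
    and cont: "continuous_on UNIV g" "continuous_on UNIV g'"
    and d: "\<And>x. ((\<lambda>t. g (x + t *\<^sub>R e)) has_real_derivative g' x) (at 0)"
  shows "(\<integral>x. g' x \<partial>lborel) = 0"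
proof -
  have "bounded (g' ` K)"
    using K(1) cont(2) by (intro compact_imp_bounded compact_continuous_image)
      (auto intro: continuous_on_subset)
  then obtain C0 where C0: "\<And>x. x \<in> K \<Longrightarrow> \<bar>g' x\<bar> \<le> C0" by (auto simp: bounded_iff)
  define C where "C = max 0 C0"
  have C: "\<bar>g' x\<bar> \<le> C" for x
    using C0[of x] K(3)[of x] by (cases "x \<in> K") (auto simp: C_def)
  have dt: "((\<lambda>t. g (x + t *\<^sub>R e)) has_real_derivative g' (x + t *\<^sub>R e)) (at t)" for x t
    using d[of "x + t *\<^sub>R e"] DERIV_shift[of "\<lambda>s. g (x + s *\<^sub>R e)" _ 0 t]
    by (simp add: algebra_simps)
  define \<tau> where "\<tau> n = inverse (real (Suc n))" for n
  have \<tau>: "0 < \<tau> n" "\<tau> n \<le> 1" for n by (auto simp: \<tau>_def field_simps)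
  have \<tau>0: "\<tau> \<longlonglongrightarrow> 0" unfolding \<tau>_def by (rule LIMSEQ_inverse_real_of_nat)
  define s where "s n x = (g (x + \<tau> n *\<^sub>R e) - g x) / \<tau> n" for n x
  have sC: "\<bar>s n x\<bar> \<le> C" for n x
  proof -
    obtain z where "g (x + \<tau> n *\<^sub>R e) - g (x + 0 *\<^sub>R e) = (\<tau> n - 0) * g' (x + z *\<^sub>R e)"
      using MVT2[of 0 "\<tau> n" "\<lambda>t. g (x + t *\<^sub>R e)" "\<lambda>t. g' (x + t *\<^sub>R e)"] dt \<tau>(1)[of n] by auto
    then have "s n x = g' (x + z *\<^sub>R e)" using \<tau>(1)[of n] by (simp add: s_def)
    then show ?thesis using C by simp
  qed
  obtain B where B: "\<And>x. x \<in> K \<Longrightarrow> norm x \<le> B"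
    using compact_imp_bounded[OF K(1)] by (auto simp: bounded_iff)
  \<comment> \<open>The steps \<open>\<tau> n\<close> are at most 1, so all quotients are supported in one ball.\<close>
  have s0: "s n x = 0" if "x \<notin> cball 0 (B + norm e)" for n x
  proof -
    have "x \<notin> K" using B[of x] that norm_ge_zero[of e] by (auto simp del: norm_ge_zero)
    moreover have "x + \<tau> n *\<^sub>R e \<notin> K"
    proof
      assume "x + \<tau> n *\<^sub>R e \<in> K"
      then have "norm (x + \<tau> n *\<^sub>R e) \<le> B" by (rule B)
      moreover have "norm x \<le> norm (x + \<tau> n *\<^sub>R e) + norm (\<tau> n *\<^sub>R e)"
        using norm_triangle_ineq4[of "x + \<tau> n *\<^sub>R e" "\<tau> n *\<^sub>R e"] by simp
      moreover have "norm (\<tau> n *\<^sub>R e) \<le> norm e"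
        using \<tau>[of n] mult_right_mono[of "\<tau> n" 1 "norm e"] by simp
      ultimately show False using that by auto
    qed
    ultimately show ?thesis by (simp add: s_def K(2))
  qed
  have gm: "g \<in> borel_measurable borel" "g' \<in> borel_measurable borel"
    using cont by (auto intro: borel_measurable_continuous_onI)
  have lim: "(\<lambda>n. \<integral>x. s n x \<partial>lborel) \<longlonglongrightarrow> (\<integral>x. g' x \<partial>lborel)"
  proof (rule integral_dominated_convergence[where w="\<lambda>x. C * indicator (cball 0 (B + norm e)) x"])
    show "g' \<in> borel_measurable lborel" using gm by simp
    show "s n \<in> borel_measurable lborel" for n unfolding s_def using gm by measurable
    have "emeasure lborel (cball (0::'a) (B + norm e)) < \<infinity>"
      using emeasure_bounded_finite bounded_cball by blast
    then show "integrable lborel (\<lambda>x. C * indicator (cball (0::'a) (B + norm e)) x)"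
      by (intro integrable_mult_right integrable_real_indicator) auto
    show "AE x in lborel. (\<lambda>n. s n x) \<longlonglongrightarrow> g' x"
    proof (rule AE_I2)
      fix x
      have "((\<lambda>h. (g (x + h *\<^sub>R e) - g x) / h) \<longlongrightarrow> g' x) (at 0)"
        using d[of x] by (simp add: DERIV_def)
      moreover have "filterlim \<tau> (at 0) sequentially"
        using \<tau>0 \<tau>(1) by (auto simp: filterlim_at intro!: always_eventually) (metis less_irrefl)
      ultimately show "(\<lambda>n. s n x) \<longlonglongrightarrow> g' x"
        unfolding s_def by (rule filterlim_compose)
    qed
    show "AE x in lborel. norm (s n x) \<le> C * indicator (cball 0 (B + norm e)) x" for n
      using sC s0 by (intro AE_I2) (auto simp: indicator_def)
  qed
  have gint: "integrable lborel g"
    using set_integrable_compact_support[of K UNIV g] K cont by (simp add: set_integrable_def)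
  have "(\<integral>x. s n x \<partial>lborel) = 0" for n
  proof -
    have "integrable lborel (\<lambda>x. g (x + \<tau> n *\<^sub>R e))"
    proof -
      have "compact ((+) (- \<tau> n *\<^sub>R e) ` K)" using K(1) compact_translation by blast
      moreover have "g (x + \<tau> n *\<^sub>R e) = 0" if "x \<notin> (+) (- \<tau> n *\<^sub>R e) ` K" for x
      proof (rule K(2), rule notI)
        assume "x + \<tau> n *\<^sub>R e \<in> K"
        then have "- \<tau> n *\<^sub>R e + (x + \<tau> n *\<^sub>R e) \<in> (+) (- \<tau> n *\<^sub>R e) ` K" by blast
        then show False using that by simp
      qed
      moreover have "continuous_on UNIV (\<lambda>x. g (x + \<tau> n *\<^sub>R e))"
        by (rule continuous_on_compose2[OF cont(1)]) (auto intro: continuous_intros)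
      ultimately show ?thesis
        using set_integrable_compact_support[of _ UNIV "\<lambda>x. g (x + \<tau> n *\<^sub>R e)"]
        by (simp add: set_integrable_def)
    qed
    then show ?thesis unfolding s_def
      using gint lborel_integral_translate[OF cont(1)] by simp
  qed
  then show ?thesis using lim LIMSEQ_unique[OF _ tendsto_const[of 0]] by simp
qed

lemma has_real_derivative_along_axis:
  fixes f :: "real^'n \<Rightarrow> real"
  assumes "f differentiable (at (x + t *\<^sub>R axis k 1))"
  shows "((\<lambda>t. f (x + t *\<^sub>R axis k 1)) has_real_derivative
    partial_deriv k f (x + t *\<^sub>R axis k 1)) (at t)"
proof -
  have "((\<lambda>t. x + t *\<^sub>R axis k 1) has_derivative (\<lambda>s. s *\<^sub>R axis k 1)) (at t)"
    by (auto intro!: derivative_eq_intros)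
  from has_derivative_compose[OF this has_derivative_gradient[OF assms]]
  have "((\<lambda>t. f (x + t *\<^sub>R axis k 1)) has_derivative
      (\<lambda>s. s * partial_deriv k f (x + t *\<^sub>R axis k 1))) (at t)"
    by (simp add: inner_axis)
  then show ?thesis unfolding has_field_derivative_def
    by (rule has_derivative_eq_rhs) (simp add: fun_eq_iff mult.commute)
qed

lemma partial_deriv_eq_0:
  assumes "open S" "x \<in> S" "\<And>y. y \<in> S \<Longrightarrow> f y = 0"
  shows "partial_deriv k f x = 0"
proof -
  have "partial_deriv k f x = partial_deriv k (\<lambda>_. 0) x"
    by (rule partial_deriv_cong[OF assms(1,2)]) (use assms(3) in auto)
  then show ?thesis by (simp add: partial_deriv_def)
qed

text \<open>
  The function \<open>v\<close> need not be defined sensibly outside \<open>S\<close>; the product \<open>f * \<partial>\<^sub>k v\<close>, extended by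
  zero, is differentiable everywhere because \<open>f\<close> vanishes near the boundary of \<open>S\<close>.
\<close>

lemma green_identity:
  fixes f v :: "real^'n \<Rightarrow> real"
  assumes S: "open S" "compact K" "K \<subseteq> S" and f0: "\<And>x. x \<in> S - K \<Longrightarrow> f x = 0"
    and f: "C_k_on 1 S f" and v: "C_k_on 2 S v"
  shows "(LINT x:S|lborel. gradient f x \<bullet> gradient v x) = - (LINT x:S|lborel. f x * laplacian v x)"
proof -
  have oSK: "open (S - K)" using S by (simp add: compact_imp_closed open_Diff)
  have fc: "continuous_on S f" and fk: "continuous_on S (partial_deriv k f)" for k
    using f by (auto intro: continuous_on_if_differentiable)
  have vc: "continuous_on S (partial_deriv k v)" and vk: "continuous_on S (partial_deriv k (partial_deriv k v))" for k
    using v by (auto simp: C_k_on_2_iff intro: continuous_on_if_differentiable)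
  have fk0: "partial_deriv k f x = 0" if "x \<in> S - K" for k x
    using partial_deriv_eq_0[OF oSK that] f0 by blast
  define h where "h k x = partial_deriv k f x * partial_deriv k v x" for k x
  define j where "j k x = f x * partial_deriv k (partial_deriv k v) x" for k x
  have hj: "set_integrable lborel S (h k)" "set_integrable lborel S (j k)" for k
    unfolding h_def j_def
    by (rule set_integrable_compact_support[OF S(2,3)],
        use fk0 f0 in \<open>auto intro!: continuous_intros fc fk vc vk\<close>)+
  have zero: "(LINT x:S|lborel. h k x) + (LINT x:S|lborel. j k x) = 0" for k
  proof -
    define g where "g x = (if x \<in> S then f x * partial_deriv k v x else 0)" for x
    define g' where "g' x = (if x \<in> S then h k x + j k x else 0)" for x
    have "(\<integral>x. g' x \<partial>lborel) = 0"
    proof (rule integral_directional_derivative_eq_0[OF S(2), of g g' "axis k 1"])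
      show "g x = 0" "g' x = 0" if "x \<notin> K" for x
        using that f0[of x] fk0[of x k] by (auto simp: g_def g'_def h_def j_def)
      show "continuous_on UNIV g" unfolding g_def
        using f0 by (intro continuous_on_extend_zero[OF S] continuous_intros fc vc) auto
      show "continuous_on UNIV g'" unfolding g'_def h_def j_def
        using f0 fk0 by (intro continuous_on_extend_zero[OF S] continuous_intros fc vc fk vk) auto
      show "((\<lambda>t. g (x + t *\<^sub>R axis k 1)) has_real_derivative g' x) (at 0)" for x
      proof (cases "x \<in> S")
        case True
        define T where "T = (\<lambda>t. x + t *\<^sub>R axis k (1::real)) -` S"
        have T: "open T" "0 \<in> T"
          unfolding T_def using True by (intro open_vimage S continuous_intros, simp)
        have "((\<lambda>t. f (x + t *\<^sub>R axis k 1) * partial_deriv k v (x + t *\<^sub>R axis k 1))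
            has_real_derivative g' x) (at 0)"
          using has_real_derivative_along_axis[of f x 0 k] f True
            has_real_derivative_along_axis[of "partial_deriv k v" x 0 k] v
          by (auto intro!: derivative_eq_intros simp: C_k_on_2_iff g'_def h_def j_def)
        then show ?thesis
          by (rule has_field_derivative_transform_within_open[OF _ T]) (auto simp: T_def g_def)
      next
        case False
        define T where "T = (\<lambda>t. x + t *\<^sub>R axis k (1::real)) -` (- K)"
        have "open (- K)" using S(2) compact_imp_closed by blast
        then have T: "open T"
          unfolding T_def by (rule open_vimage) (intro continuous_intros)
        have T0: "0 \<in> T" unfolding T_def using False S(3) by auto
        have "((\<lambda>t. 0) has_real_derivative g' x) (at 0)" using False by (simp add: g'_def)
        then show ?thesis
          by (rule has_field_derivative_transform_within_open[OF _ T T0]) (use f0 in \<open>auto simp: T_def g_def\<close>)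
      qed
    qed
    moreover have "(\<integral>x. g' x \<partial>lborel) = (LINT x:S|lborel. h k x + j k x)"
      unfolding set_lebesgue_integral_def g'_def by (intro Bochner_Integration.integral_cong) auto
    ultimately show ?thesis using set_integral_add(2)[OF hj] by simp
  qed
  have "(LINT x:S|lborel. gradient f x \<bullet> gradient v x) = (\<Sum>k\<in>UNIV. LINT x:S|lborel. h k x)"
    using hj(1) unfolding set_lebesgue_integral_def set_integrable_def h_def
    by (subst Bochner_Integration.integral_sum[symmetric]) (auto simp: inner_vec_def sum_distrib_left)
  moreover have "(LINT x:S|lborel. f x * laplacian v x) = (\<Sum>k\<in>UNIV. LINT x:S|lborel. j k x)"
    using hj(2) unfolding set_lebesgue_integral_def set_integrable_def j_def
    by (subst Bochner_Integration.integral_sum[symmetric]) (auto simp: laplacian_def sum_distrib_left)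
  moreover have "(LINT x:S|lborel. h k x) = - (LINT x:S|lborel. j k x)" for k
    using zero[of k] by linarith
  ultimately show ?thesis by (simp add: sum_negf)
qed

section \<open>A convex truncation\<close>

text \<open>
  A profile with \<open>r 0 = r' 0 = 0\<close> flattens the kink of the positive part.
\<close>

lemma DERIV_compose_positive_part:
  fixes r r' :: "real \<Rightarrow> real"
  assumes d: "\<And>t. 0 \<le> t \<Longrightarrow> (r has_real_derivative r' t) (at t)" and r'0: "r' 0 = 0"
  shows "((\<lambda>v. r (max 0 (v - \<epsilon>))) has_real_derivative r' (max 0 (v - \<epsilon>))) (at v)"
proof -
  consider "v > \<epsilon>" | "v < \<epsilon>" | "v = \<epsilon>" by linarith
  then show ?thesis
  proof cases
    case 1
    have "((\<lambda>v. r (v - \<epsilon>)) has_real_derivative r' (v - \<epsilon>) * 1) (at v)"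
      using 1 by (intro DERIV_chain2[OF d]) (auto intro!: derivative_eq_intros)
    then have "((\<lambda>v. r (max 0 (v - \<epsilon>))) has_real_derivative r' (v - \<epsilon>) * 1) (at v)"
      by (rule has_field_derivative_transform_within_open[of _ _ _ "{\<epsilon><..}"]) (use 1 in auto)
    then show ?thesis using 1 by (simp add: max_def)
  next
    case 2
    have "((\<lambda>v. r 0) has_real_derivative 0) (at v)" by simp
    then have "((\<lambda>v. r (max 0 (v - \<epsilon>))) has_real_derivative 0) (at v)"
      by (rule has_field_derivative_transform_within_open[of _ _ _ "{..<\<epsilon>}"]) (use 2 in auto)
    then show ?thesis using 2 r'0 by (simp add: max_def)
  next
    case 3
    have "((\<lambda>h. (r (0 + h) - r 0) / h) \<longlongrightarrow> 0) (at 0)"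
      using d[of 0] r'0 by (simp add: DERIV_def)
    then have "((\<lambda>h. norm ((r (0 + h) - r 0) / h)) \<longlongrightarrow> 0) (at 0)"
      by (rule tendsto_norm_zero)
    then have "((\<lambda>h. (r (max 0 h) - r 0) / h) \<longlongrightarrow> 0) (at 0)"
      by (rule Lim_null_comparison[rotated]) (auto simp: max_def divide_le_0_iff intro!: always_eventually)
    then show ?thesis using 3 r'0 by (simp add: DERIV_def)
  qed
qed

text \<open>
  A substitute for the positive part: for \<open>v > \<epsilon>\<close> it equals \<open>v - 2 * \<epsilon> + \<epsilon>\<^sup>2 / v\<close>, which is convex
  with slope between 0 and 1. It vanishes for \<open>v \<le> \<epsilon>\<close>, so that it turns a continuous function
  with zero boundary values into a compactly supported one, and \<open>trunc * trunc'\<close> is still \<open>C\<^sup>1\<close>.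
  The functions \<open>trunc'\<close> and \<open>trunc''\<close> are its derivatives; \<open>trunc''\<close> is so only for \<open>v > \<epsilon>\<close>.
\<close>

definition trunc :: "real \<Rightarrow> real \<Rightarrow> real" where
  "trunc \<epsilon> v = (let t = max 0 (v - \<epsilon>) in t\<^sup>2 / (t + \<epsilon>))"

definition trunc' :: "real \<Rightarrow> real \<Rightarrow> real" where
  "trunc' \<epsilon> v = (let t = max 0 (v - \<epsilon>) in (t\<^sup>2 + 2 * \<epsilon> * t) / (t + \<epsilon>)\<^sup>2)"

definition trunc'' :: "real \<Rightarrow> real \<Rightarrow> real" where
  "trunc'' \<epsilon> v = (let t = max 0 (v - \<epsilon>) in 2 * \<epsilon>\<^sup>2 / (t + \<epsilon>) ^ 3)"

context
  fixes \<epsilon> :: real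
  assumes \<epsilon>: "0 < \<epsilon>"
begin

lemma trunc_profile_deriv:
  fixes t :: real
  assumes "0 \<le> t"
  shows "((\<lambda>t. t\<^sup>2 / (t + \<epsilon>)) has_real_derivative (t\<^sup>2 + 2 * \<epsilon> * t) / (t + \<epsilon>)\<^sup>2) (at t)"
    and "((\<lambda>t. (t\<^sup>2 + 2 * \<epsilon> * t) / (t + \<epsilon>)\<^sup>2) has_real_derivative 2 * \<epsilon>\<^sup>2 / (t + \<epsilon>) ^ 3) (at t)"
proof -
  have nz: "t + \<epsilon> \<noteq> 0" using assms \<epsilon> by linarith
  show "((\<lambda>t. t\<^sup>2 / (t + \<epsilon>)) has_real_derivative (t\<^sup>2 + 2 * \<epsilon> * t) / (t + \<epsilon>)\<^sup>2) (at t)"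
    using nz by (auto intro!: derivative_eq_intros simp: power2_eq_square algebra_simps)
  have "((t + t + 2 * \<epsilon>) * (t + \<epsilon>)\<^sup>2 - (t\<^sup>2 + 2 * \<epsilon> * t) * (2 * (t + \<epsilon>))) / ((t + \<epsilon>)\<^sup>2 * (t + \<epsilon>)\<^sup>2)
      = 2 * \<epsilon>\<^sup>2 * (t + \<epsilon>) / ((t + \<epsilon>) ^ 3 * (t + \<epsilon>))"
    by (rule arg_cong2[where f="(/)"]) (simp_all add: power2_eq_square power3_eq_cube algebra_simps)
  also have "\<dots> = 2 * \<epsilon>\<^sup>2 / (t + \<epsilon>) ^ 3" using nz by simp
  finally have eq: "((t + t + 2 * \<epsilon>) * (t + \<epsilon>)\<^sup>2 - (t\<^sup>2 + 2 * \<epsilon> * t) * (2 * (t + \<epsilon>))) /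
      ((t + \<epsilon>)\<^sup>2 * (t + \<epsilon>)\<^sup>2) = 2 * \<epsilon>\<^sup>2 / (t + \<epsilon>) ^ 3" .
  have "((\<lambda>t. t\<^sup>2 + 2 * \<epsilon> * t) has_real_derivative t + t + 2 * \<epsilon>) (at t)"
    "((\<lambda>t. (t + \<epsilon>)\<^sup>2) has_real_derivative 2 * (t + \<epsilon>)) (at t)"
    by (auto intro!: derivative_eq_intros)
  from DERIV_divide[OF this] nz
  show "((\<lambda>t. (t\<^sup>2 + 2 * \<epsilon> * t) / (t + \<epsilon>)\<^sup>2) has_real_derivative 2 * \<epsilon>\<^sup>2 / (t + \<epsilon>) ^ 3) (at t)"
    by (simp only: eq) simp
qed

lemma trunc_deriv: "(trunc \<epsilon> has_real_derivative trunc' \<epsilon> v) (at v)"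
  unfolding trunc_def[abs_def] trunc'_def Let_def
  using DERIV_compose_positive_part[OF trunc_profile_deriv(1), of \<epsilon> v] by simp

text \<open>
  At \<open>v = \<epsilon>\<close> the second derivative of the truncation jumps, but it is multiplied by the truncation
  itself, which vanishes there.
\<close>

lemma trunc_mult_deriv:
  "((\<lambda>v. trunc \<epsilon> v * trunc' \<epsilon> v) has_real_derivative
     (trunc' \<epsilon> v)\<^sup>2 + trunc \<epsilon> v * trunc'' \<epsilon> v) (at v)"
proof -
  have "((\<lambda>t. t\<^sup>2 / (t + \<epsilon>) * ((t\<^sup>2 + 2 * \<epsilon> * t) / (t + \<epsilon>)\<^sup>2)) has_real_derivative
      ((t\<^sup>2 + 2 * \<epsilon> * t) / (t + \<epsilon>)\<^sup>2)\<^sup>2 + t\<^sup>2 / (t + \<epsilon>) * (2 * \<epsilon>\<^sup>2 / (t + \<epsilon>) ^ 3)) (at t)"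
    if "0 \<le> t" for t
    using DERIV_mult[OF trunc_profile_deriv[OF that]] by (simp add: power2_eq_square add.commute mult.commute)
  from DERIV_compose_positive_part[OF this, of \<epsilon> v] show ?thesis
    unfolding trunc_def trunc'_def trunc''_def Let_def by simp
qed

lemma continuous_on_trunc [continuous_intros]:
  "continuous_on S f \<Longrightarrow> continuous_on S (\<lambda>x. trunc \<epsilon> (f x))"
  "continuous_on S f \<Longrightarrow> continuous_on S (\<lambda>x. trunc' \<epsilon> (f x))"
  "continuous_on S f \<Longrightarrow> continuous_on S (\<lambda>x. trunc'' \<epsilon> (f x))"
proof -
  have "max 0 a + \<epsilon> \<noteq> 0" for a using \<epsilon> by linarith
  then show "continuous_on S f \<Longrightarrow> continuous_on S (\<lambda>x. trunc \<epsilon> (f x))"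
    "continuous_on S f \<Longrightarrow> continuous_on S (\<lambda>x. trunc' \<epsilon> (f x))"
    "continuous_on S f \<Longrightarrow> continuous_on S (\<lambda>x. trunc'' \<epsilon> (f x))"
    unfolding trunc_def trunc'_def trunc''_def Let_def
    by (intro continuous_intros; simp)+
qed

lemma trunc_eq_0: "v \<le> \<epsilon> \<Longrightarrow> trunc \<epsilon> v = 0"
  by (simp add: trunc_def Let_def)

lemma trunc_bounds:
  "0 \<le> trunc \<epsilon> v" "trunc \<epsilon> v \<le> max 0 v" "max 0 v - 2 * \<epsilon> \<le> trunc \<epsilon> v"
  "0 \<le> trunc' \<epsilon> v" "trunc' \<epsilon> v \<le> 1" "0 \<le> trunc'' \<epsilon> v"
  "trunc \<epsilon> v - \<epsilon> \<le> trunc \<epsilon> v * trunc' \<epsilon> v"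
proof -
  define t where "t = max 0 (v - \<epsilon>)"
  have t: "0 \<le> t" "0 < t + \<epsilon>" "t \<le> max 0 v" "max 0 v \<le> t + \<epsilon>" using \<epsilon> by (auto simp: t_def)
  have T: "trunc \<epsilon> v = t\<^sup>2 / (t + \<epsilon>)" "trunc' \<epsilon> v = (t\<^sup>2 + 2 * \<epsilon> * t) / (t + \<epsilon>)\<^sup>2"
    "trunc'' \<epsilon> v = 2 * \<epsilon>\<^sup>2 / (t + \<epsilon>) ^ 3"
    by (auto simp: trunc_def trunc'_def trunc''_def Let_def t_def)
  show "0 \<le> trunc \<epsilon> v" "0 \<le> trunc' \<epsilon> v" "0 \<le> trunc'' \<epsilon> v" using t \<epsilon> by (auto simp: T)
  have "t\<^sup>2 / (t + \<epsilon>) \<le> t" using t \<epsilon> by (simp add: field_simps power2_eq_square)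
  then show "trunc \<epsilon> v \<le> max 0 v" using t by (simp add: T)
  have "(t - \<epsilon>) * (t + \<epsilon>) \<le> t\<^sup>2" by (simp add: algebra_simps power2_eq_square)
  then have "t - \<epsilon> \<le> t\<^sup>2 / (t + \<epsilon>)" using t(2) by (simp only: pos_le_divide_eq)
  then show "max 0 v - 2 * \<epsilon> \<le> trunc \<epsilon> v" using t by (simp add: T)
  have "t\<^sup>2 + 2 * \<epsilon> * t \<le> (t + \<epsilon>)\<^sup>2" by (simp add: power2_eq_square algebra_simps)
  then show "trunc' \<epsilon> v \<le> 1" using t(2) by (simp add: T)
  have "trunc \<epsilon> v - trunc \<epsilon> v * trunc' \<epsilon> v = trunc \<epsilon> v * (1 - trunc' \<epsilon> v)" by (simp add: algebra_simps)
  also have "1 - trunc' \<epsilon> v = (\<epsilon> / (t + \<epsilon>))\<^sup>2"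
  proof -
    have "t\<^sup>2 + 2 * \<epsilon> * t = (t + \<epsilon>)\<^sup>2 - \<epsilon>\<^sup>2" by (simp add: power2_eq_square algebra_simps)
    then show ?thesis using t by (simp add: T diff_divide_distrib power_divide)
  qed
  also have "trunc \<epsilon> v * (\<epsilon> / (t + \<epsilon>))\<^sup>2 = (t / (t + \<epsilon>))\<^sup>2 * (\<epsilon> / (t + \<epsilon>)) * \<epsilon>"
    using t by (simp add: T field_simps power2_eq_square)
  also have "\<dots> \<le> 1 * 1 * \<epsilon>"
    using t \<epsilon> by (intro mult_mono power_le_one) auto
  finally show "trunc \<epsilon> v - \<epsilon> \<le> trunc \<epsilon> v * trunc' \<epsilon> v" by simp
qed

end

text \<open>
  Both functions differ from the positive part by at most \<open>3 * \<epsilon>\<close>, uniformly in \<open>v\<close>.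
\<close>

lemma tendsto_trunc:
  assumes "\<epsilon> \<longlonglongrightarrow> 0" "\<And>n. 0 < \<epsilon> n" "v \<longlonglongrightarrow> l"
  shows "(\<lambda>n. trunc (\<epsilon> n) (v n)) \<longlonglongrightarrow> max 0 l"
    and "(\<lambda>n. trunc (\<epsilon> n) (v n) * trunc' (\<epsilon> n) (v n)) \<longlonglongrightarrow> max 0 l"
proof -
  have m: "(\<lambda>n. max 0 (v n)) \<longlonglongrightarrow> max 0 l"
    using assms(3) by (intro tendsto_intros)
  have l: "(\<lambda>n. max 0 (v n) - 2 * \<epsilon> n) \<longlonglongrightarrow> max 0 l" "(\<lambda>n. max 0 (v n) - 3 * \<epsilon> n) \<longlonglongrightarrow> max 0 l"
    using tendsto_diff[OF m tendsto_mult_left[OF assms(1), of 2]]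
      tendsto_diff[OF m tendsto_mult_left[OF assms(1), of 3]] by simp_all
  show t: "(\<lambda>n. trunc (\<epsilon> n) (v n)) \<longlonglongrightarrow> max 0 l"
    using trunc_bounds[OF assms(2)] by (intro tendsto_sandwich[OF _ _ l(1) m] always_eventually allI) auto
  have "max 0 (v n) - 3 * \<epsilon> n \<le> trunc (\<epsilon> n) (v n) * trunc' (\<epsilon> n) (v n)" for n
    using trunc_bounds(3,7)[of "\<epsilon> n" "v n", OF assms(2)] by linarith
  moreover have "trunc (\<epsilon> n) (v n) * trunc' (\<epsilon> n) (v n) \<le> max 0 (v n)" for n
    using mult_left_mono[OF trunc_bounds(5)[of "\<epsilon> n" "v n", OF assms(2)] trunc_bounds(1)[of "\<epsilon> n" "v n", OF assms(2)]]
      trunc_bounds(2)[of "\<epsilon> n" "v n", OF assms(2)] by simp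
  ultimately show "(\<lambda>n. trunc (\<epsilon> n) (v n) * trunc' (\<epsilon> n) (v n)) \<longlonglongrightarrow> max 0 l"
    by (intro tendsto_sandwich[OF _ _ l(2) m] always_eventually allI) auto
qed

section \<open>Positive parts of solutions of a stable linear system\<close>

lemma set_integral_sum_UNIV:
  fixes f :: "'m::finite \<Rightarrow> 'a \<Rightarrow> real"
  assumes "\<And>j. set_integrable M S (f j)"
  shows "set_integrable M S (\<lambda>x. \<Sum>j\<in>UNIV. f j x)"
    and "(LINT x:S|M. (\<Sum>j\<in>UNIV. f j x)) = (\<Sum>j\<in>UNIV. LINT x:S|M. f j x)"
proof -
  have eq: "(\<lambda>x. indicator S x *\<^sub>R (\<Sum>j\<in>UNIV. f j x)) = (\<lambda>x. \<Sum>j\<in>UNIV. indicator S x *\<^sub>R f j x)"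
    by (simp only: scaleR_sum_right)
  show "set_integrable M S (\<lambda>x. \<Sum>j\<in>UNIV. f j x)"
    using assms unfolding set_integrable_def eq by (intro Bochner_Integration.integrable_sum)
  show "(LINT x:S|M. (\<Sum>j\<in>UNIV. f j x)) = (\<Sum>j\<in>UNIV. LINT x:S|M. f j x)"
    using assms unfolding set_integrable_def set_lebesgue_integral_def eq
    by (intro Bochner_Integration.integral_sum)
qed

lemma quadratic_form_perturb:
  fixes a :: "'m::finite \<Rightarrow> 'm \<Rightarrow> real"
  shows "(\<Sum>j\<in>UNIV. \<Sum>k\<in>UNIV. a j k * (b j + (if j = i then t else 0)) * (b k + (if k = i then t else 0)))
    = (\<Sum>j\<in>UNIV. \<Sum>k\<in>UNIV. a j k * b j * b k) + t * (\<Sum>k\<in>UNIV. (a i k + a k i) * b k) + t\<^sup>2 * a i i"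
proof -
  have eq: "a j k * (b j + (if j = i then t else 0)) * (b k + (if k = i then t else 0)) =
      a j k * b j * b k + (if j = i then t * a i k * b k else 0) + (if k = i then t * a j i * b j else 0)
      + (if j = i then if k = i then t\<^sup>2 * a i i else 0 else 0)" for j k
    by (cases "j = i"; cases "k = i") (simp_all add: algebra_simps power2_eq_square)
  have 1: "(\<Sum>j\<in>UNIV. \<Sum>k\<in>UNIV. if j = i then t * a i k * b k else 0) = t * (\<Sum>k\<in>UNIV. a i k * b k)"
    by (subst sum.swap) (simp add: sum_distrib_left mult.assoc)
  have 2: "(\<Sum>j\<in>UNIV. \<Sum>k\<in>UNIV. if k = i then t * a j i * b j else 0) = t * (\<Sum>k\<in>UNIV. a k i * b k)"
    by (simp add: sum_distrib_left mult.assoc)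
  have 3: "(\<Sum>j\<in>UNIV. \<Sum>k\<in>UNIV. if j = i then if k = i then t\<^sup>2 * a i i else 0 else 0) = t\<^sup>2 * a i i"
    by (subst sum.swap) simp
  have 4: "t * (\<Sum>k\<in>UNIV. (a i k + a k i) * b k) = t * (\<Sum>k\<in>UNIV. a i k * b k) + t * (\<Sum>k\<in>UNIV. a k i * b k)"
    by (simp add: distrib_right sum.distrib distrib_left)
  show ?thesis unfolding eq sum.distrib 1 2 3 4 by simp
qed

text \<open>
  The linear system \<open>-\<Delta> v\<^sub>j = \<Sum>\<^sub>k a\<^sub>j\<^sub>k v\<^sub>k\<close> with nonnegative off-diagonal coefficients and nonnegative
  quadratic form. The matrix \<open>a\<close> is in general not symmetric.
\<close>

locale stable_coupling =
  fixes \<Omega> :: "(real^'n) set" and a :: "'m::finite \<Rightarrow> 'm \<Rightarrow> real^'n \<Rightarrow> real"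
  assumes open_\<Omega>: "open \<Omega>" and bounded_\<Omega>: "bounded \<Omega>"
    and a_cont: "\<And>j k. continuous_on \<Omega> (a j k)"
    and a_bound: "\<exists>A. \<forall>j k. \<forall>x\<in>\<Omega>. \<bar>a j k x\<bar> \<le> A"
    and a_offdiag: "\<And>j k x. x \<in> \<Omega> \<Longrightarrow> j \<noteq> k \<Longrightarrow> 0 \<le> a j k x"
    and stable: "\<And>\<Psi> :: real^'n \<Rightarrow> real^'m. C1c \<Omega> \<Psi> \<Longrightarrow>
      0 \<le> (LINT x:\<Omega>|lborel. (\<Sum>j\<in>UNIV. (norm (gradient (\<lambda>y. \<Psi> y $ j) x))\<^sup>2) -
        (\<Sum>j\<in>UNIV. \<Sum>k\<in>UNIV. a j k x * \<Psi> x $ j * \<Psi> x $ k))"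
begin

text \<open>
  With \<open>b\<^sub>j = trunc \<epsilon> v\<^sub>j\<close> the quadratic form is evaluated at the field with components \<open>b\<^sub>j\<close>, perturbed
  by \<open>s \<psi>\<close> in the \<open>i\<close>-th component. All gradients disappear from the inequality: convexity gives
  \<open>|\<nabla>b\<^sub>j|\<^sup>2 \<le> \<nabla>(b\<^sub>j trunc' v\<^sub>j) \<cdot> \<nabla>v\<^sub>j\<close>, and Green's identity moves the derivatives to \<open>v\<^sub>j\<close> and
  \<open>\<psi>\<close>. What remains passes to the limit under pointwise bounded convergence. The term with \<open>s\<^sup>2\<close>
  is of no concern because \<open>s\<close> tends to zero in the end.
\<close>

lemma stability_tested_with_truncation:
  fixes v :: "'m \<Rightarrow> real^'n \<Rightarrow> real" and \<psi> :: "real^'n \<Rightarrow> real"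
  assumes \<epsilon>: "0 < \<epsilon>"
    and v2: "\<And>j. C_k_on 2 \<Omega> (v j)" and vc: "\<And>j. continuous_on (closure \<Omega>) (v j)"
    and v0: "\<And>j x. x \<in> frontier \<Omega> \<Longrightarrow> v j x = 0"
    and \<psi>: "C_k_on 2 \<Omega> \<psi>" "compact K" "K \<subseteq> \<Omega>" "\<And>x. x \<in> \<Omega> - K \<Longrightarrow> \<psi> x = 0"
  shows "0 \<le> (LINT x:\<Omega>|lborel.
        (\<Sum>j\<in>UNIV. - (trunc \<epsilon> (v j x) * trunc' \<epsilon> (v j x)) * laplacian (v j) x)
        - 2 * s * (trunc \<epsilon> (v i x) * laplacian \<psi> x)
        - (\<Sum>j\<in>UNIV. \<Sum>k\<in>UNIV. a j k x * trunc \<epsilon> (v j x) * trunc \<epsilon> (v k x))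
        - s * \<psi> x * (\<Sum>k\<in>UNIV. (a i k x + a k i x) * trunc \<epsilon> (v k x)))
      + s\<^sup>2 * (LINT x:\<Omega>|lborel. (norm (gradient \<psi> x))\<^sup>2 - (\<psi> x)\<^sup>2 * a i i x)"
proof -
  define b where "b j x = trunc \<epsilon> (v j x)" for j x
  define w where "w j x = trunc \<epsilon> (v j x) * trunc' \<epsilon> (v j x)" for j x
  define c where "c j = (if j = i then s else 0)" for j
  \<comment> \<open>A compact set carrying all functions below: the truncations vanish where \<open>v j < \<epsilon>\<close>, in particular near the boundary.\<close>
  define L where "L = (\<Union>j. {x\<in>closure \<Omega>. \<epsilon> \<le> v j x}) \<union> K"
  have "compact {x\<in>closure \<Omega>. \<epsilon> \<le> v j x}" for j
  proof -
    have "closed {x\<in>closure \<Omega>. \<epsilon> \<le> v j x}"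
      using continuous_closed_preimage[OF vc[of j] closed_closure closed_atLeast[of \<epsilon>]]
      by (simp add: vimage_def Int_def)
    moreover have "bounded {x\<in>closure \<Omega>. \<epsilon> \<le> v j x}"
      using bounded_\<Omega> by (auto intro: bounded_subset[OF bounded_closure])
    ultimately show ?thesis by (simp add: compact_eq_bounded_closed)
  qed
  then have L: "compact L" unfolding L_def using \<psi>(2) by (intro compact_Un compact_UN) auto
  have L\<Omega>: "L \<subseteq> \<Omega>"
  proof
    fix x assume "x \<in> L"
    then consider j where "x \<in> closure \<Omega>" "\<epsilon> \<le> v j x" | "x \<in> K" unfolding L_def by auto
    then show "x \<in> \<Omega>"
    proof cases
      case 1
      then have "x \<notin> frontier \<Omega>" using v0 \<epsilon> by fastforce
      then show ?thesis using 1 open_\<Omega> by (simp add: frontier_def interior_open)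
    qed (use \<psi>(3) in auto)
  qed
  have b0: "b j x = 0" "w j x = 0" "\<psi> x = 0" if "x \<in> \<Omega> - L" for j x
  proof -
    have "x \<in> closure \<Omega>" using that closure_subset by auto
    then have "v j x \<le> \<epsilon>" using that by (intro leI notI) (auto simp: L_def not_le dest: less_asym)
    then show "b j x = 0" "w j x = 0" using trunc_eq_0[OF \<epsilon>] by (auto simp: b_def w_def)
    show "\<psi> x = 0" using that \<psi>(4) by (auto simp: L_def)
  qed
  have v1: "C_k_on 1 \<Omega> (v j)" for j using v2 C_k_on_2_imp_1 by blast
  have \<psi>1: "C_k_on 1 \<Omega> \<psi>" using \<psi>(1) C_k_on_2_imp_1 by blast
  have b1: "C_k_on 1 \<Omega> (b j)" for j
    unfolding b_def
    by (rule C_k_on_1_chain[OF trunc_deriv[OF \<epsilon>] _ v1]) (intro continuous_on_trunc[OF \<epsilon>] continuous_on_id)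
  have w1: "C_k_on 1 \<Omega> (w j)" for j
    unfolding w_def
    by (rule C_k_on_1_chain[where \<phi> = "\<lambda>t. trunc \<epsilon> t * trunc' \<epsilon> t",
          OF trunc_mult_deriv[OF \<epsilon>] _ v1])
      (intro continuous_intros continuous_on_trunc[OF \<epsilon>])
  have diff: "v j differentiable (at x)" "b j differentiable (at x)" "w j differentiable (at x)"
    if "x \<in> \<Omega>" for j x
    using v1[of j] b1[of j] w1[of j] that by auto
  have cont [continuous_intros]: "continuous_on \<Omega> (v j)" "continuous_on \<Omega> (b j)" "continuous_on \<Omega> (w j)"
    "continuous_on \<Omega> \<psi>" for j
    using v1[of j] b1[of j] w1[of j] \<psi>1 by (auto intro!: continuous_on_if_differentiable)
  note [continuous_intros] = continuous_on_gradient continuous_on_laplacian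
  have oL: "open (\<Omega> - L)" using open_\<Omega> L by (simp add: compact_imp_closed open_Diff)
  have g0: "gradient (b j) x = 0" "gradient (w j) x = 0" "gradient \<psi> x = 0" if "x \<in> \<Omega> - L" for j x
  proof -
    have "gradient f x = 0" if "\<And>y. y \<in> \<Omega> - L \<Longrightarrow> f y = 0" for f
      using partial_deriv_eq_0[OF oL \<open>x \<in> \<Omega> - L\<close> that] by (simp add: vec_eq_iff)
    then show "gradient (b j) x = 0" "gradient (w j) x = 0" "gradient \<psi> x = 0" using b0 by blast+
  qed
  have int: "set_integrable lborel \<Omega> h"
    if "continuous_on \<Omega> h" "\<And>x. x \<in> \<Omega> - L \<Longrightarrow> h x = 0" for h :: "real^'n \<Rightarrow> real"
    using set_integrable_compact_support[OF L L\<Omega> that] .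
  define \<Psi> :: "real^'n \<Rightarrow> real^'m" where
    "\<Psi> x = (\<chi> j. if x \<in> \<Omega> then 1 * b j x + c j * \<psi> x else 0)" for x
  have \<Psi>: "\<Psi> x $ j = 1 * b j x + c j * \<psi> x" if "x \<in> \<Omega>" for x j using that by (simp add: \<Psi>_def)
  have g\<Psi>: "gradient (\<lambda>y. \<Psi> y $ j) x = gradient (b j) x + c j *\<^sub>R gradient \<psi> x" if "x \<in> \<Omega>" for x j
  proof -
    have "gradient (\<lambda>y. \<Psi> y $ j) x = gradient (\<lambda>x. 1 * b j x + c j * \<psi> x) x"
      unfolding gradient_def by (simp only: partial_deriv_cong[OF open_\<Omega> that \<Psi>])
    then show ?thesis using linear_combination(2)[OF open_\<Omega> that b1 \<psi>1, of 1 j "c j"] by simp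
  qed
  have "C1c \<Omega> \<Psi>"
    unfolding C1c_def
  proof (intro conjI)
    show "C_k_on 1 \<Omega> \<Psi>"
    proof (cases "\<Omega> = {}")
      case False
      then obtain x where x: "x \<in> \<Omega>" by auto
      show ?thesis
        by (intro C_k_on_1_vec C_k_on_cong[OF open_\<Omega> \<Psi>[symmetric] linear_combination(1)[OF open_\<Omega> x b1 \<psi>1]])
    qed simp
    have "{x. \<Psi> x \<noteq> 0} \<subseteq> L"
      using b0 by (auto simp: \<Psi>_def vec_eq_iff split: if_splits) force
    then have sub: "closure {x. \<Psi> x \<noteq> 0} \<subseteq> L"
      using L compact_imp_closed closure_minimal by blast
    then show "closure {x. \<Psi> x \<noteq> 0} \<subseteq> \<Omega>" using L\<Omega> by blast
    show "compact (closure {x. \<Psi> x \<noteq> 0})"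
      using sub compact_Int_closed[OF L closed_closure] by (metis inf.absorb2)
  qed
  define q where "q x = (\<Sum>j\<in>UNIV. (norm (gradient (\<lambda>y. \<Psi> y $ j) x))\<^sup>2) -
    (\<Sum>j\<in>UNIV. \<Sum>k\<in>UNIV. a j k x * \<Psi> x $ j * \<Psi> x $ k)" for x
  define E1 where "E1 j x = gradient (w j) x \<bullet> gradient (v j) x" for j x
  define E2 where "E2 x = gradient (b i) x \<bullet> gradient \<psi> x" for x
  define E3 where "E3 x = (norm (gradient \<psi> x))\<^sup>2 - (\<psi> x)\<^sup>2 * a i i x" for x
  define E4 where "E4 x = (\<Sum>j\<in>UNIV. \<Sum>k\<in>UNIV. a j k x * b j x * b k x) +
    s * \<psi> x * (\<Sum>k\<in>UNIV. (a i k x + a k i x) * b k x)" for x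
  have q: "q x = (\<Sum>j\<in>UNIV. (norm (gradient (b j) x))\<^sup>2) + 2 * s * E2 x + s\<^sup>2 * E3 x - E4 x"
    if x: "x \<in> \<Omega>" for x
  proof -
    have "(norm (gradient (b j) x + c j *\<^sub>R gradient \<psi> x))\<^sup>2 = (norm (gradient (b j) x))\<^sup>2 +
        (if j = i then 2 * s * E2 x + s\<^sup>2 * (norm (gradient \<psi> x))\<^sup>2 else 0)" for j
      unfolding power2_norm_eq_inner
      by (simp add: c_def E2_def inner_add_left inner_add_right inner_commute power2_eq_square)
    then have "(\<Sum>j\<in>UNIV. (norm (gradient (\<lambda>y. \<Psi> y $ j) x))\<^sup>2) =
        (\<Sum>j\<in>UNIV. (norm (gradient (b j) x))\<^sup>2) + (2 * s * E2 x + s\<^sup>2 * (norm (gradient \<psi> x))\<^sup>2)"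
      by (simp add: g\<Psi>[OF x] sum.distrib)
    moreover have "(\<Sum>j\<in>UNIV. \<Sum>k\<in>UNIV. a j k x * \<Psi> x $ j * \<Psi> x $ k) =
        E4 x + (s * \<psi> x)\<^sup>2 * a i i x"
    proof -
      have "\<Psi> x $ j = b j x + (if j = i then s * \<psi> x else 0)" for j
        by (simp add: \<Psi>[OF x] c_def)
      then show ?thesis
        using quadratic_form_perturb[of "\<lambda>j k. a j k x" "\<lambda>j. b j x" i "s * \<psi> x"] by (simp add: E4_def)
    qed
    ultimately show ?thesis by (simp add: q_def E3_def power_mult_distrib algebra_simps)
  qed
  \<comment> \<open>Convexity of the truncation enters here, through \<open>trunc * trunc \<ge> 0\<close>.\<close>
  have E1: "(norm (gradient (b j) x))\<^sup>2 \<le> E1 j x" if x: "x \<in> \<Omega>" for j x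
  proof -
    have "gradient (b j) x = trunc' \<epsilon> (v j x) *\<^sub>R gradient (v j) x"
      unfolding b_def using gradient_chain[OF trunc_deriv[OF \<epsilon>] diff(1)[OF x]] .
    then have "(norm (gradient (b j) x))\<^sup>2 = (trunc' \<epsilon> (v j x))\<^sup>2 * (gradient (v j) x \<bullet> gradient (v j) x)"
      by (simp add: power_mult_distrib power2_norm_eq_inner)
    also have "\<dots> \<le> ((trunc' \<epsilon> (v j x))\<^sup>2 + trunc \<epsilon> (v j x) * trunc'' \<epsilon> (v j x)) *
        (gradient (v j) x \<bullet> gradient (v j) x)"
      using trunc_bounds[OF \<epsilon>] by (intro mult_right_mono) auto
    also have "\<dots> = E1 j x"
      unfolding E1_def w_def
      by (simp only: gradient_chain[where \<phi> = "\<lambda>t. trunc \<epsilon> t * trunc' \<epsilon> t",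
            OF trunc_mult_deriv[OF \<epsilon>] diff(1)[OF x]] inner_scaleR_left)
    finally show ?thesis .
  qed
  have iE1: "set_integrable lborel \<Omega> (E1 j)" for j
    unfolding E1_def using g0 by (intro int continuous_intros w1 v1) simp
  have iE2: "set_integrable lborel \<Omega> E2"
    unfolding E2_def using g0 by (intro int continuous_intros b1 \<psi>1) simp
  have iE3: "set_integrable lborel \<Omega> E3"
    unfolding E3_def using g0 b0 by (intro int continuous_intros \<psi>1 a_cont) simp
  have iE4: "set_integrable lborel \<Omega> E4"
    unfolding E4_def using b0 by (intro int continuous_intros a_cont) simp
  have iq: "set_integrable lborel \<Omega> q"
  proof (rule int)
    have "continuous_on \<Omega> (\<lambda>x. (\<Sum>j\<in>UNIV. (norm (gradient (b j) x))\<^sup>2) + 2 * s * E2 x + s\<^sup>2 * E3 x - E4 x)"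
      unfolding E2_def E3_def E4_def by (intro continuous_intros b1 \<psi>1 a_cont)
    then show "continuous_on \<Omega> q" by (rule continuous_on_eq) (simp add: q)
    show "q x = 0" if "x \<in> \<Omega> - L" for x
      using that q[of x] g0[OF that] b0[OF that] by (simp add: E2_def E3_def E4_def)
  qed
  have iS: "set_integrable lborel \<Omega> (\<lambda>x. \<Sum>j\<in>UNIV. E1 j x)"
    by (rule set_integral_sum_UNIV(1)[OF iE1])
  have i2: "set_integrable lborel \<Omega> (\<lambda>x. 2 * s * E2 x)" "set_integrable lborel \<Omega> (\<lambda>x. s\<^sup>2 * E3 x)"
    using iE2 iE3 by (intro set_integrable_mult_right; simp)+
  have "0 \<le> (LINT x:\<Omega>|lborel. q x)"
    using stable[OF \<open>C1c \<Omega> \<Psi>\<close>] by (simp add: q_def)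
  also have "\<dots> \<le> (LINT x:\<Omega>|lborel. ((\<Sum>j\<in>UNIV. E1 j x) + 2 * s * E2 x + s\<^sup>2 * E3 x) - E4 x)"
    using E1 by (intro set_integral_mono iq set_integral_diff(1) set_integral_add(1) iS i2 iE4)
      (auto simp: q intro!: sum_mono)
  also have "\<dots> = (\<Sum>j\<in>UNIV. LINT x:\<Omega>|lborel. E1 j x) + 2 * s * (LINT x:\<Omega>|lborel. E2 x) +
      s\<^sup>2 * (LINT x:\<Omega>|lborel. E3 x) - (LINT x:\<Omega>|lborel. E4 x)"
    by (simp add: set_integral_diff(2) set_integral_add iS i2 iE4 set_integral_sum_UNIV(2)[OF iE1])
  also have "(LINT x:\<Omega>|lborel. E2 x) = - (LINT x:\<Omega>|lborel. b i x * laplacian \<psi> x)"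
    unfolding E2_def using b0 by (intro green_identity[OF open_\<Omega> L L\<Omega>] b1 \<psi>(1)) auto
  also have "(\<Sum>j\<in>UNIV. LINT x:\<Omega>|lborel. E1 j x) = (\<Sum>j\<in>UNIV. - (LINT x:\<Omega>|lborel. w j x * laplacian (v j) x))"
    unfolding E1_def using b0 by (intro sum.cong refl green_identity[OF open_\<Omega> L L\<Omega>] w1 v2) auto
  also have "\<dots> = (LINT x:\<Omega>|lborel. (\<Sum>j\<in>UNIV. - w j x * laplacian (v j) x))"
  proof -
    have "set_integrable lborel \<Omega> (\<lambda>x. - w j x * laplacian (v j) x)" for j
      using b0 by (intro int continuous_intros v2) simp
    from set_integral_sum_UNIV(2)[where f = "\<lambda>j x. - w j x * laplacian (v j) x", OF this]
    show ?thesis by (simp add: set_lebesgue_integral_def)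
  qed
  finally have *: "0 \<le> (LINT x:\<Omega>|lborel. (\<Sum>j\<in>UNIV. - w j x * laplacian (v j) x))
      - 2 * s * (LINT x:\<Omega>|lborel. b i x * laplacian \<psi> x) - (LINT x:\<Omega>|lborel. E4 x)
      + s\<^sup>2 * (LINT x:\<Omega>|lborel. E3 x)" by simp
  have j1: "set_integrable lborel \<Omega> (\<lambda>x. \<Sum>j\<in>UNIV. - w j x * laplacian (v j) x)"
    using b0 by (intro int continuous_intros v2) simp
  have j2: "set_integrable lborel \<Omega> (\<lambda>x. 2 * s * (b i x * laplacian \<psi> x))"
    using b0 by (intro int continuous_intros \<psi>(1)) simp
  have "(LINT x:\<Omega>|lborel. (\<Sum>j\<in>UNIV. - w j x * laplacian (v j) x) - 2 * s * (b i x * laplacian \<psi> x) - E4 x)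
    = (LINT x:\<Omega>|lborel. (\<Sum>j\<in>UNIV. - w j x * laplacian (v j) x))
      - 2 * s * (LINT x:\<Omega>|lborel. b i x * laplacian \<psi> x) - (LINT x:\<Omega>|lborel. E4 x)"
    by (subst set_integral_diff(2)[OF set_integral_diff(1)[OF j1 j2] iE4],
        subst set_integral_diff(2)[OF j1 j2]) simp
  with * have "0 \<le> (LINT x:\<Omega>|lborel. (\<Sum>j\<in>UNIV. - w j x * laplacian (v j) x)
      - 2 * s * (b i x * laplacian \<psi> x) - E4 x) + s\<^sup>2 * (LINT x:\<Omega>|lborel. E3 x)" by (simp only:)
  then show ?thesis by (simp only: E4_def E3_def w_def b_def diff_diff_eq add.assoc)
qed

text \<open>
  The functions \<open>v n\<close> solve the linear system only in the limit, and \<open>V\<close> is only known to be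
  continuous. In the limit \<open>\<epsilon> \<rightarrow> 0\<close>, \<open>n \<rightarrow> \<infinity>\<close> the inequality of
  \<open>stability_tested_with_truncation\<close> has as its term of order \<open>s\<^sup>0\<close> the quantity
  \<open>\<Sum>\<^sub>j\<^sub>k a\<^sub>j\<^sub>k V\<^sub>j\<^sup>+ (V\<^sub>k - V\<^sub>k\<^sup>+)\<close>, which is \<open>\<le> 0\<close>: the diagonal terms vanish and the others have a
  sign. Hence the term of order \<open>s\<close> cannot be negative. It contains the symmetrized coefficients
  \<open>a\<^sub>i\<^sub>k + a\<^sub>k\<^sub>i\<close>; the terms with \<open>k \<noteq> i\<close> are dropped because of their sign.
\<close>

lemma limit_is_weak_supersolution:
  fixes v :: "nat \<Rightarrow> 'm \<Rightarrow> real^'n \<Rightarrow> real" and V :: "'m \<Rightarrow> real^'n \<Rightarrow> real"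
    and \<psi> :: "real^'n \<Rightarrow> real"
  assumes v2: "\<And>n j. C_k_on 2 \<Omega> (v n j)" and vc: "\<And>n j. continuous_on (closure \<Omega>) (v n j)"
    and v0: "\<And>n j x. x \<in> frontier \<Omega> \<Longrightarrow> v n j x = 0"
    and vB: "\<And>n j x. x \<in> \<Omega> \<Longrightarrow> \<bar>v n j x\<bar> \<le> B"
    and lB: "\<And>n j x. x \<in> \<Omega> \<Longrightarrow> \<bar>laplacian (v n j) x\<bar> \<le> B"
    and vV: "\<And>j x. x \<in> \<Omega> \<Longrightarrow> (\<lambda>n. v n j x) \<longlonglongrightarrow> V j x"
    and lV: "\<And>j x. x \<in> \<Omega> \<Longrightarrow>
      (\<lambda>n. laplacian (v n j) x) \<longlonglongrightarrow> - (\<Sum>k\<in>UNIV. a j k x * V k x)"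
    and Vc: "\<And>j. continuous_on \<Omega> (V j)"
    and \<psi>: "C_k_on 2 \<Omega> \<psi>" "compact K" "K \<subseteq> \<Omega>" "\<And>x. x \<in> \<Omega> - K \<Longrightarrow> \<psi> x = 0"
      "\<And>x. x \<in> \<Omega> \<Longrightarrow> 0 \<le> \<psi> x"
  shows "(LINT x:\<Omega>|lborel. max 0 (V i x) * (laplacian \<psi> x + a i i x * \<psi> x)) \<le> 0"
proof -
  define \<epsilon> where "\<epsilon> n = inverse (real (Suc n))" for n
  have \<epsilon>: "0 < \<epsilon> n" for n by (simp add: \<epsilon>_def)
  have \<epsilon>0: "\<epsilon> \<longlonglongrightarrow> 0" unfolding \<epsilon>_def by (rule LIMSEQ_inverse_real_of_nat)
  define b where "b n j x = trunc (\<epsilon> n) (v n j x)" for n j x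
  define w where "w n j x = trunc (\<epsilon> n) (v n j x) * trunc' (\<epsilon> n) (v n j x)" for n j x
  define Vp where "Vp j x = max 0 (V j x)" for j x
  have b_lim: "(\<lambda>n. b n j x) \<longlonglongrightarrow> Vp j x" "(\<lambda>n. w n j x) \<longlonglongrightarrow> Vp j x" if "x \<in> \<Omega>" for j x
    unfolding b_def w_def Vp_def using tendsto_trunc[OF \<epsilon>0 \<epsilon> vV[OF that]] by auto
  have bB: "\<bar>b n j x\<bar> \<le> B" "\<bar>w n j x\<bar> \<le> B" "0 \<le> B" if "x \<in> \<Omega>" for n j x
  proof -
    show B: "0 \<le> B" using vB[OF that, of n j] by linarith
    have "0 \<le> b n j x" "b n j x \<le> B"
      using trunc_bounds(1,2)[OF \<epsilon>, of n "v n j x"] vB[OF that, of n j] B by (auto simp: b_def)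
    moreover have "0 \<le> w n j x" "w n j x \<le> b n j x"
      using trunc_bounds(1,4,5)[OF \<epsilon>, of n "v n j x"] by (auto simp: b_def w_def mult_left_le)
    ultimately show "\<bar>b n j x\<bar> \<le> B" "\<bar>w n j x\<bar> \<le> B" by auto
  qed
  obtain A where A: "\<And>j k x. x \<in> \<Omega> \<Longrightarrow> \<bar>a j k x\<bar> \<le> A" using a_bound by blast
  note lcont = continuous_on_laplacian
  have vc': "continuous_on \<Omega> (v n j)" and \<psi>c: "continuous_on \<Omega> \<psi>" for n j
    using v2[of n j] \<psi>(1) by (auto simp: C_k_on_2_iff intro!: continuous_on_if_differentiable)
  have oK: "open (\<Omega> - K)" using open_\<Omega> \<psi>(2) by (simp add: compact_imp_closed open_Diff)
  have l\<psi>0: "laplacian \<psi> x = 0" if "x \<in> \<Omega> - K" for x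
  proof -
    have "partial_deriv k \<psi> y = 0" if "y \<in> \<Omega> - K" for k y
      using partial_deriv_eq_0[OF oK that \<psi>(4)] .
    then have "partial_deriv k (partial_deriv k \<psi>) x = 0" for k
      by (rule partial_deriv_eq_0[OF oK that])
    then show ?thesis by (simp add: laplacian_def)
  qed
  have "\<exists>P. \<forall>x\<in>\<Omega>. \<bar>f x\<bar> \<le> P" if "continuous_on \<Omega> f" "\<And>x. x \<in> \<Omega> - K \<Longrightarrow> f x = 0" for f :: "real^'n \<Rightarrow> real"
  proof -
    have "bounded (f ` K)"
      using that(1) \<psi>(2,3) by (intro compact_imp_bounded compact_continuous_image)
        (auto intro: continuous_on_subset)
    then obtain P where "\<And>x. x \<in> K \<Longrightarrow> \<bar>f x\<bar> \<le> P" by (auto simp: bounded_iff)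
    then have "\<bar>f x\<bar> \<le> max 0 P" if "x \<in> \<Omega>" for x
      using \<open>x \<in> \<Omega>\<close> \<open>\<And>x. x \<in> \<Omega> - K \<Longrightarrow> f x = 0\<close>[of x] by (cases "x \<in> K") fastforce+
    then show ?thesis by blast
  qed
  from this[OF \<psi>c \<psi>(4)] this[OF lcont[OF \<psi>(1)] l\<psi>0]
  obtain P Q where P: "\<And>x. x \<in> \<Omega> \<Longrightarrow> \<bar>\<psi> x\<bar> \<le> P" and Q: "\<And>x. x \<in> \<Omega> \<Longrightarrow> \<bar>laplacian \<psi> x\<bar> \<le> Q" by blast
  define G where "G x = Vp i x * (laplacian \<psi> x + a i i x * \<psi> x)" for x
  have iG: "set_integrable lborel \<Omega> G"
    unfolding G_def Vp_def
  proof (rule set_integrable_compact_support[OF \<psi>(2,3)])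
    show "continuous_on \<Omega> (\<lambda>x. max 0 (V i x) * (laplacian \<psi> x + a i i x * \<psi> x))"
      by (intro continuous_intros Vc lcont \<psi>(1) a_cont \<psi>c)
  qed (use \<psi>(4) l\<psi>0 in auto)
  define C where "C = (LINT x:\<Omega>|lborel. (norm (gradient \<psi> x))\<^sup>2 - (\<psi> x)\<^sup>2 * a i i x)"
  have main: "2 * s * (LINT x:\<Omega>|lborel. G x) \<le> s\<^sup>2 * C" if s: "0 < s" for s
  proof -
    define h where "h n x = (\<Sum>j\<in>UNIV. - w n j x * laplacian (v n j) x)
        - 2 * s * (b n i x * laplacian \<psi> x)
        - (\<Sum>j\<in>UNIV. \<Sum>k\<in>UNIV. a j k x * b n j x * b n k x)
        - s * \<psi> x * (\<Sum>k\<in>UNIV. (a i k x + a k i x) * b n k x)" for n x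
    define hl where "hl x = (\<Sum>j\<in>UNIV. - Vp j x * - (\<Sum>k\<in>UNIV. a j k x * V k x))
        - 2 * s * (Vp i x * laplacian \<psi> x)
        - (\<Sum>j\<in>UNIV. \<Sum>k\<in>UNIV. a j k x * Vp j x * Vp k x)
        - s * \<psi> x * (\<Sum>k\<in>UNIV. (a i k x + a k i x) * Vp k x)" for x
    define M where "M = (\<Sum>j\<in>(UNIV::'m set). B * B) + 2 * s * (B * Q)
        + (\<Sum>j\<in>(UNIV::'m set). \<Sum>k\<in>(UNIV::'m set). A * B * B)
        + s * P * (\<Sum>k\<in>(UNIV::'m set). (A + A) * B)"
    have hM: "\<bar>h n x\<bar> \<le> M" if x: "x \<in> \<Omega>" for n x
    proof -
      have pos: "0 \<le> B" "0 \<le> A" "0 \<le> P" "0 \<le> Q"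
        using bB(3)[OF x] A[OF x] P[OF x] Q[OF x] abs_ge_zero order_trans by blast+
      have "\<bar>\<Sum>j\<in>UNIV. - w n j x * laplacian (v n j) x\<bar> \<le> (\<Sum>j\<in>(UNIV::'m set). B * B)"
        using bB(2)[OF x] lB[OF x] pos
        by (intro order_trans[OF sum_abs] sum_mono) (simp add: abs_mult mult_mono)
      moreover have "\<bar>2 * s * (b n i x * laplacian \<psi> x)\<bar> \<le> 2 * s * (B * Q)"
        using bB(1)[OF x] Q[OF x] pos s by (simp add: abs_mult mult_mono)
      moreover have "\<bar>\<Sum>j\<in>UNIV. \<Sum>k\<in>UNIV. a j k x * b n j x * b n k x\<bar> \<le>
          (\<Sum>j\<in>(UNIV::'m set). \<Sum>k\<in>(UNIV::'m set). A * B * B)"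
        using bB(1)[OF x] A[OF x] pos
        by (intro order_trans[OF sum_abs] sum_mono) (simp add: abs_mult mult_mono)
      moreover have "\<bar>s * \<psi> x * (\<Sum>k\<in>UNIV. (a i k x + a k i x) * b n k x)\<bar> \<le>
          s * P * (\<Sum>k\<in>(UNIV::'m set). (A + A) * B)"
      proof -
        have "\<bar>\<Sum>k\<in>UNIV. (a i k x + a k i x) * b n k x\<bar> \<le> (\<Sum>k\<in>(UNIV::'m set). (A + A) * B)"
        proof (intro order_trans[OF sum_abs] sum_mono)
          fix k
          have "\<bar>a i k x + a k i x\<bar> \<le> A + A" using A[OF x, of i k] A[OF x, of k i] by linarith
          then show "\<bar>(a i k x + a k i x) * b n k x\<bar> \<le> (A + A) * B"
            using bB(1)[OF x] pos unfolding abs_mult by (intro mult_mono) auto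
        qed
        then show ?thesis
          using P[OF x] pos s unfolding abs_mult by (intro mult_mono) auto
      qed
      ultimately show ?thesis unfolding h_def M_def by linarith
    qed
    have h_lim: "(\<lambda>n. h n x) \<longlonglongrightarrow> hl x" if "x \<in> \<Omega>" for x
      unfolding h_def hl_def by (intro tendsto_intros b_lim[OF that] lV[OF that])
    have h_cont: "continuous_on \<Omega> (h n)" for n
      unfolding h_def b_def w_def
      by (intro continuous_intros continuous_on_trunc[OF \<epsilon>] vc' lcont v2 a_cont \<psi>(1) \<psi>c)
    have hl_cont: "continuous_on \<Omega> hl"
      unfolding hl_def Vp_def by (intro continuous_intros Vc lcont a_cont \<psi>(1) \<psi>c)
    have meas: "(\<lambda>x. indicator \<Omega> x *\<^sub>R f x) \<in> borel_measurable lborel"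
      if "continuous_on \<Omega> f" for f :: "real^'n \<Rightarrow> real"
      using borel_measurable_continuous_on_indicator[OF _ that] open_\<Omega> by simp
    have "emeasure lborel \<Omega> < \<infinity>" using emeasure_bounded_finite[OF bounded_\<Omega>] .
    then have iM: "integrable lborel (\<lambda>x. M * indicator \<Omega> x)"
      using open_\<Omega> by (intro integrable_mult_right integrable_real_indicator) auto
    have lim: "AE x in lborel. (\<lambda>n. indicator \<Omega> x *\<^sub>R h n x) \<longlonglongrightarrow> indicator \<Omega> x *\<^sub>R hl x"
      using h_lim by (intro AE_I2) (auto simp: indicator_def)
    have bd: "AE x in lborel. norm (indicator \<Omega> x *\<^sub>R h n x) \<le> M * indicator \<Omega> x" for n
      using hM by (intro AE_I2) (auto simp: indicator_def)
    have conv: "(\<lambda>n. LINT x:\<Omega>|lborel. h n x) \<longlonglongrightarrow> (LINT x:\<Omega>|lborel. hl x)"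
      unfolding set_lebesgue_integral_def
      by (rule integral_dominated_convergence[OF meas[OF hl_cont] meas[OF h_cont] iM lim bd])
    have ihl: "set_integrable lborel \<Omega> hl"
      unfolding set_integrable_def
      by (rule integrable_dominated_convergence[OF meas[OF hl_cont] meas[OF h_cont] iM lim bd])
    have "0 \<le> (LINT x:\<Omega>|lborel. h n x) + s\<^sup>2 * C" for n
      using stability_tested_with_truncation[where v = "v n" and s = s and i = i, OF \<epsilon> v2 vc v0 \<psi>(1-4)]
      unfolding h_def C_def b_def w_def .
    moreover have "(\<lambda>n. (LINT x:\<Omega>|lborel. h n x) + s\<^sup>2 * C) \<longlonglongrightarrow> (LINT x:\<Omega>|lborel. hl x) + s\<^sup>2 * C"
      by (intro tendsto_intros conv)
    ultimately have "0 \<le> (LINT x:\<Omega>|lborel. hl x) + s\<^sup>2 * C"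
      by (intro LIMSEQ_le_const) auto
    moreover have "(LINT x:\<Omega>|lborel. hl x) \<le> (LINT x:\<Omega>|lborel. (- 2 * s) * G x)"
    proof (rule set_integral_mono[OF ihl])
      show "set_integrable lborel \<Omega> (\<lambda>x. (- 2 * s) * G x)"
        using iG by (intro set_integrable_mult_right) simp
      fix x assume x: "x \<in> \<Omega>"
      have "(\<Sum>j\<in>UNIV. - Vp j x * - (\<Sum>k\<in>UNIV. a j k x * V k x)) \<le>
          (\<Sum>j\<in>UNIV. \<Sum>k\<in>UNIV. a j k x * Vp j x * Vp k x)"
      proof -
        have "Vp j x * (a j k x * V k x) \<le> a j k x * Vp j x * Vp k x" for j k
        proof (cases "j = k")
          case True
          then show ?thesis by (simp add: Vp_def max_def)
        next
          case False
          then have "0 \<le> a j k x * Vp j x" using a_offdiag[OF x] by (simp add: Vp_def)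
          moreover have "V k x \<le> Vp k x" by (simp add: Vp_def)
          ultimately have "a j k x * Vp j x * V k x \<le> a j k x * Vp j x * Vp k x" by (rule mult_left_mono[rotated])
          then show ?thesis by (simp add: mult_ac)
        qed
        then show ?thesis unfolding minus_mult_minus sum_distrib_left by (intro sum_mono)
      qed
      moreover have "2 * a i i x * Vp i x \<le> (\<Sum>k\<in>UNIV. (a i k x + a k i x) * Vp k x)"
      proof -
        have "0 \<le> (\<Sum>k\<in>UNIV - {i}. (a i k x + a k i x) * Vp k x)"
          using a_offdiag[OF x] by (intro sum_nonneg) (auto simp: Vp_def)
        then show ?thesis by (subst sum.remove[of _ i]) auto
      qed
      then have "s * \<psi> x * (2 * a i i x * Vp i x) \<le> s * \<psi> x * (\<Sum>k\<in>UNIV. (a i k x + a k i x) * Vp k x)"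
        using s \<psi>(5)[OF x] by (intro mult_left_mono) auto
      ultimately show "hl x \<le> (- 2 * s) * G x"
        unfolding hl_def G_def by (simp add: algebra_simps)
    qed
    moreover have "(LINT x:\<Omega>|lborel. (- 2 * s) * G x) = (- 2 * s) * (LINT x:\<Omega>|lborel. G x)"
      by (rule set_integral_mult_right)
    ultimately show ?thesis by simp
  qed
  define g where "g = (LINT x:\<Omega>|lborel. G x)"
  have "g \<le> 0"
  proof (rule ccontr)
    assume "\<not> g \<le> 0"
    then have g: "0 < g" by simp
    \<comment> \<open>Small enough for the term of order \<open>s\<close> to beat the one of order \<open>s\<^sup>2\<close>.\<close>
    define s where "s = g / (\<bar>C\<bar> + 1)"
    have s: "0 < s" using g by (simp add: s_def add_nonneg_pos)
    have "s * C \<le> s * (\<bar>C\<bar> + 1)" using s by (intro mult_left_mono) auto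
    also have "\<dots> = g" by (simp add: s_def)
    finally have "s * C \<le> g" .
    then have "s * (s * C) \<le> s * g" using s by simp
    moreover have "2 * s * g \<le> s * (s * C)"
      using main[OF s] by (simp add: g_def power2_eq_square mult.assoc)
    moreover have "0 < s * g" using s g by simp
    ultimately show False by linarith
  qed
  then show ?thesis by (simp add: g_def G_def Vp_def)
qed

end

section \<open>A strong minimum principle for weak supersolutions\<close>

text \<open>
  Powers of this function are the radial bumps for which weighted averages of a supersolution satisfy
  a differential inequality in the radius \<open>r\<close>.
\<close>

definition paraboloid :: "real^'n \<Rightarrow> real \<Rightarrow> real^'n \<Rightarrow> real" where
  "paraboloid x0 r x = max 0 (r\<^sup>2 - (norm (x - x0))\<^sup>2)"

lemma DERIV_positive_part_power:
  assumes "1 \<le> k"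
  shows "((\<lambda>t. (max 0 t) ^ Suc k) has_real_derivative real (Suc k) * (max 0 t) ^ k) (at t)"
proof -
  consider "t > 0" | "t < 0" | "t = 0" by linarith
  then show ?thesis
  proof cases
    case 1
    have "((\<lambda>t. t ^ Suc k) has_real_derivative real (Suc k) * t ^ k) (at t)"
      using DERIV_pow[of "Suc k" t] by simp
    then have "((\<lambda>t. (max 0 t) ^ Suc k) has_real_derivative real (Suc k) * t ^ k) (at t)"
      by (rule has_field_derivative_transform_within_open[of _ _ _ "{0<..}"]) (use 1 in auto)
    moreover have "max 0 t = t" using 1 by simp
    ultimately show ?thesis by (simp only:)
  next
    case 2
    have "((\<lambda>t. 0) has_real_derivative 0) (at t)" by simp
    then have "((\<lambda>t. (max 0 t) ^ Suc k) has_real_derivative 0) (at t)"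
      by (rule has_field_derivative_transform_within_open[of _ _ _ "{..<0}"]) (use 2 in auto)
    moreover have "real (Suc k) * (max 0 t) ^ k = 0" using 2 assms by (simp add: max_def)
    ultimately show ?thesis by (simp only:)
  next
    case 3
    have "((\<lambda>h. \<bar>h\<bar> ^ k) \<longlongrightarrow> \<bar>0::real\<bar> ^ k) (at 0)" by (intro tendsto_intros)
    moreover have "\<bar>0::real\<bar> ^ k = 0" using assms by (simp add: zero_power)
    ultimately have "((\<lambda>h::real. \<bar>h\<bar> ^ k) \<longlongrightarrow> 0) (at 0)" by (simp only:)
    then have "((\<lambda>h::real. (max 0 h) ^ Suc k / h) \<longlongrightarrow> 0) (at 0)"
      by (rule Lim_null_comparison[rotated])
        (auto simp: max_def abs_mult power_abs intro!: always_eventually)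
    moreover have eq0: "real (Suc k) * (max 0 (0::real)) ^ k = 0" using assms by (simp add: zero_power)
    ultimately show ?thesis unfolding 3 DERIV_def eq0 by simp
  qed
qed

lemma DERIV_paraboloid_power:
  assumes "1 \<le> k"
  shows "((\<lambda>r. (paraboloid x0 r x) ^ Suc k) has_real_derivative
    2 * r * real (Suc k) * (paraboloid x0 r x) ^ k) (at r)"
proof -
  have "((\<lambda>r. r\<^sup>2 - (norm (x - x0))\<^sup>2) has_real_derivative 2 * r) (at r)"
    by (auto intro!: derivative_eq_intros)
  from DERIV_chain2[OF DERIV_positive_part_power[OF assms] this]
  show ?thesis unfolding paraboloid_def by (simp only: mult_ac)
qed

lemma continuous_on_paraboloid:
  "continuous_on S f \<Longrightarrow> continuous_on S g \<Longrightarrow> continuous_on S (\<lambda>x. paraboloid x0 (f x) (g x))"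
  unfolding paraboloid_def by (intro continuous_intros)

lemma paraboloid_nonneg: "0 \<le> paraboloid x0 r x"
  and paraboloid_le: "paraboloid x0 r x \<le> r\<^sup>2"
  and paraboloid_eq_0: "0 \<le> r \<Longrightarrow> r \<le> norm (x - x0) \<Longrightarrow> paraboloid x0 r x = 0"
  and paraboloid_pos: "norm (x - x0) < r \<Longrightarrow> 0 < paraboloid x0 r x"
  and norm_le_paraboloid: "(norm (x - x0))\<^sup>2 * paraboloid x0 r x = (r\<^sup>2 - paraboloid x0 r x) * paraboloid x0 r x"
  by (auto simp: paraboloid_def max_def power_mono power_strict_mono)

lemma partial_deriv_paraboloid_power:
  fixes x0 :: "real^'n"
  assumes "1 \<le> k"
  shows "partial_deriv l (\<lambda>x. (paraboloid x0 r x) ^ Suc k) x =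
      - 2 * real (Suc k) * (paraboloid x0 r x) ^ k * (x - x0) $ l" (is ?A)
    and "(\<lambda>x. (paraboloid x0 r x) ^ Suc k) differentiable (at x)" (is ?B)
proof -
  define q where "q x = r\<^sup>2 - (x - x0) \<bullet> (x - x0)" for x :: "real^'n"
  have q: "(q has_derivative (\<lambda>h. - 2 * ((x - x0) \<bullet> h))) (at x)"
    unfolding q_def[abs_def]
    by (auto intro!: derivative_eq_intros simp: inner_commute)
  have eq: "paraboloid x0 r x = max 0 (q x)" for x
    by (simp add: paraboloid_def q_def power2_norm_eq_inner)
  have qd: "q differentiable (at x)" using q differentiable_def by blast
  have "partial_deriv l q x = - 2 * (x - x0) $ l"
    by (simp add: partial_deriv_eqI[OF q] inner_axis)
  then show ?A unfolding eq
    using partial_deriv_chain(1)[OF DERIV_positive_part_power[OF assms] qd, of l]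
    by (simp only: mult_ac)
  show ?B unfolding eq
    using partial_deriv_chain(2)[OF DERIV_positive_part_power[OF assms] qd] .
qed

text \<open>
  The Laplacian of the cube is a combination of the first and the second power. With \<open>P\<^sub>r\<close> the
  paraboloid and \<open>n\<close> the dimension, it equals \<open>6 * r ^ (n + 5)\<close> times the \<open>r\<close>-derivative of
  \<open>P\<^sub>r\<^sup>2 / r ^ (n + 4)\<close>.
\<close>

lemma paraboloid_cubed:
  fixes x0 :: "real^'n"
  shows "C_k_on 2 UNIV (\<lambda>x. (paraboloid x0 r x) ^ 3)"
    and "laplacian (\<lambda>x. (paraboloid x0 r x) ^ 3) x =
      24 * r\<^sup>2 * paraboloid x0 r x - (24 + 6 * real CARD('n)) * (paraboloid x0 r x)\<^sup>2"
proof -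
  let ?p = "paraboloid x0 r"
  have Suc2: "Suc 2 = 3" and Suc1: "Suc 1 = 2" by simp_all
  have p3: "partial_deriv l (\<lambda>x. (?p x) ^ 3) = (\<lambda>x. - 6 * (?p x)\<^sup>2 * (x - x0) $ l)"
      "(\<lambda>x. (?p x) ^ 3) differentiable (at x)" for l x
    using partial_deriv_paraboloid_power[where k = 2 and ?x0.0 = x0 and r = r, unfolded Suc2]
    by (auto simp: fun_eq_iff)
  have p2: "((\<lambda>x. (?p x)\<^sup>2) has_derivative (\<lambda>h. gradient (\<lambda>x. (?p x)\<^sup>2) x \<bullet> h)) (at x)"
      "partial_deriv l (\<lambda>x. (?p x)\<^sup>2) x = - 4 * ?p x * (x - x0) $ l" for l x
    using partial_deriv_paraboloid_power[where k = 1 and ?x0.0 = x0 and r = r, unfolded Suc1]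
    by (auto intro!: has_derivative_gradient)
  have d: "((\<lambda>x. - 6 * (?p x)\<^sup>2 * (x - x0) $ l) has_derivative
      (\<lambda>h. - 6 * (?p x)\<^sup>2 * h $ l + - 6 * (gradient (\<lambda>x. (?p x)\<^sup>2) x \<bullet> h) * (x - x0) $ l)) (at x)" for l x
    by (rule has_derivative_eq_rhs[OF has_derivative_mult[OF has_derivative_mult[OF has_derivative_const p2(1)]
          bounded_linear.has_derivative[OF bounded_linear_vec_nth
            has_derivative_diff[OF has_derivative_ident has_derivative_const]]]]) (simp add: algebra_simps)
  have dd: "partial_deriv k (\<lambda>x. - 6 * (?p x)\<^sup>2 * (x - x0) $ l) =
      (\<lambda>x. - 6 * (?p x)\<^sup>2 * (if k = l then 1 else 0) + 24 * ?p x * (x - x0) $ k * (x - x0) $ l)" for k l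
  proof
    fix x
    show "partial_deriv k (\<lambda>x. - 6 * (?p x)\<^sup>2 * (x - x0) $ l) x =
      - 6 * (?p x)\<^sup>2 * (if k = l then 1 else 0) + 24 * ?p x * (x - x0) $ k * (x - x0) $ l"
      unfolding partial_deriv_eqI[OF d] by (simp add: inner_axis p2(2)) (simp add: axis_def)
  qed
  show "C_k_on 2 UNIV (\<lambda>x. (?p x) ^ 3)"
    unfolding C_k_on_2_iff p3(1) dd
    by (intro conjI ballI allI p3(2) continuous_intros continuous_on_paraboloid)
      (use d differentiable_def in blast)
  have "laplacian (\<lambda>x. (?p x) ^ 3) x = (\<Sum>k\<in>(UNIV::'n set). - 6 * (?p x)\<^sup>2 + 24 * ?p x * ((x - x0) $ k * (x - x0) $ k))"
    unfolding laplacian_def p3(1) dd by (simp add: mult.assoc)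
  also have "\<dots> = - 6 * real CARD('n) * (?p x)\<^sup>2 + 24 * (?p x * ((x - x0) \<bullet> (x - x0)))"
    by (simp add: sum_subtractf sum_distrib_left inner_vec_def mult.assoc)
  also have "?p x * ((x - x0) \<bullet> (x - x0)) = (r\<^sup>2 - ?p x) * ?p x"
    using norm_le_paraboloid[of x x0 r] by (simp add: power2_norm_eq_inner mult.commute)
  finally show "laplacian (\<lambda>x. (?p x) ^ 3) x = 24 * r\<^sup>2 * ?p x - (24 + 6 * real CARD('n)) * (?p x)\<^sup>2"
    by (simp add: algebra_simps power2_eq_square)
qed

lemma set_integral_eq_integral_cbox:
  fixes h :: "'a::euclidean_space \<Rightarrow> real"
  assumes "cbox a b \<subseteq> S" "continuous_on S h" "\<And>x. x \<in> S - cbox a b \<Longrightarrow> h x = 0"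
  shows "(LINT x:S|lborel. h x) = integral (cbox a b) h"
proof -
  have "indicator S x *\<^sub>R h x = indicator (cbox a b) x *\<^sub>R h x" for x
    using assms(1,3) by (auto simp: indicator_def)
  then have "(LINT x:S|lborel. h x) = (LINT x:cbox a b|lborel. h x)"
    by (simp only: set_lebesgue_integral_def)
  also have "\<dots> = integral (cbox a b) h"
    by (intro set_borel_integral_eq_integral(2), unfold set_integrable_def,
        intro borel_integrable_compact compact_cbox continuous_on_subset[OF assms(2,1)])
  finally show ?thesis .
qed

text \<open>
  Let \<open>I(r)\<close> be the integral of \<open>u P\<^sub>r\<^sup>2\<close>, where \<open>P\<^sub>r\<close> is the paraboloid at \<open>x0\<close>. Testing the
  supersolution property with \<open>P\<^sub>r\<^sup>3\<close> and using \<open>P\<^sub>r \<le> r\<^sup>2\<close> gives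
  \<open>r I'(r) \<le> (n + 4 + C r\<^sup>2 / 6) I(r)\<close>. So the average \<open>I(r) / r ^ (n + 4)\<close>, corrected by the factor
  \<open>exp (- C r\<^sup>2 / 12)\<close>, is nonincreasing in \<open>r\<close>. As \<open>r \<rightarrow> 0\<close> it tends to a multiple of
  \<open>u x0 = 0\<close> by continuity; hence it is \<open>\<le> 0\<close> for all small \<open>r\<close>, and \<open>u \<ge> 0\<close> must vanish on a ball.
  This avoids any differentiability of \<open>u\<close>, which is essential as \<open>u\<close> will be a positive part.
\<close>

lemma weak_supersolution_vanishes_near_zero:
  fixes u c :: "real^'n \<Rightarrow> real"
  assumes \<Omega>: "open \<Omega>" and u: "continuous_on \<Omega> u" "\<And>x. x \<in> \<Omega> \<Longrightarrow> 0 \<le> u x"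
    and c: "continuous_on \<Omega> c" "\<And>x. x \<in> \<Omega> \<Longrightarrow> \<bar>c x\<bar> \<le> C"
    and super: "\<And>\<psi> K. C_k_on 2 \<Omega> \<psi> \<Longrightarrow> compact K \<Longrightarrow> K \<subseteq> \<Omega> \<Longrightarrow>
        (\<And>x. x \<in> \<Omega> - K \<Longrightarrow> \<psi> x = 0) \<Longrightarrow> (\<And>x. x \<in> \<Omega> \<Longrightarrow> 0 \<le> \<psi> x) \<Longrightarrow>
        (LINT x:\<Omega>|lborel. u x * (laplacian \<psi> x + c x * \<psi> x)) \<le> 0"
    and x0: "x0 \<in> \<Omega>" "u x0 = 0"
  shows "\<exists>r>0. \<forall>x\<in>ball x0 r. x \<in> \<Omega> \<and> u x = 0"
proof -
  define N where "N = real CARD('n)"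
  obtain a b where ab: "cbox a b \<subseteq> \<Omega>" "x0 \<in> box a b"
    using open_contains_cbox[OF \<Omega> x0(1)] by metis
  obtain \<rho> where \<rho>: "0 < \<rho>" "cball x0 \<rho> \<subseteq> box a b"
    using ab(2) open_box open_contains_cball by blast
  have cball_sub: "cball x0 r \<subseteq> cbox a b" "cball x0 r \<subseteq> \<Omega>" if "r \<le> \<rho>" for r
    using \<rho>(2) that box_subset_cbox[of a b] ab(1) by force+
  have ucb: "continuous_on (cbox a b) u" using u(1) ab(1) continuous_on_subset by blast
  have u0: "0 \<le> u x" if "x \<in> cbox a b" for x using u(2) ab(1) that by auto
  let ?p = "paraboloid x0"
  define I where "I r = integral (cbox a b) (\<lambda>x. u x * (?p r x)\<^sup>2)" for r
  define I' where "I' r = integral (cbox a b) (\<lambda>x. u x * (2 * r * 2 * ?p r x))" for r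
  have int: "h integrable_on cbox a b" if "continuous_on (cbox a b) h" for h :: "real^'n \<Rightarrow> real"
    using that integrable_continuous by blast
  have pc: "continuous_on S (?p r)" for S r
    using continuous_on_paraboloid[OF continuous_on_const continuous_on_id] .
  have dI: "(I has_real_derivative I' r) (at r)" for r
  proof -
    have "(I has_real_derivative I' r) (at r within UNIV)"
      unfolding I_def[abs_def] I'_def
    proof (rule leibniz_rule_field_derivative)
      show "((\<lambda>r. u x * (?p r x)\<^sup>2) has_real_derivative u x * (2 * r * 2 * ?p r x)) (at r within UNIV)" for r x
        using DERIV_paraboloid_power[of 1 x0 x r] by (auto intro!: DERIV_cmult simp: numeral_2_eq_2)
      show "(\<lambda>x. u x * (?p r x)\<^sup>2) integrable_on cbox a b" for r
        by (intro int continuous_intros ucb pc)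
      have "continuous_on (UNIV \<times> cbox a b) (\<lambda>z. u (snd z) * (2 * fst z * 2 * ?p (fst z) (snd z)))"
        by (intro continuous_intros continuous_on_compose2[OF ucb] continuous_on_paraboloid) auto
      then show "continuous_on (UNIV \<times> cbox a b) (\<lambda>(r, x). u x * (2 * r * 2 * ?p r x))"
        by (simp add: case_prod_unfold)
    qed auto
    then show ?thesis by simp
  qed
  \<comment> \<open>The weak inequality for the cube of the paraboloid, rewritten in terms of \<open>I\<close> and its derivative.\<close>
  have diff_ineq: "r * I' r \<le> (N + 4 + C * r\<^sup>2 / 6) * I r" if r: "0 < r" "r \<le> \<rho>" for r
  proof -
    define \<psi> where "\<psi> x = (?p r x) ^ 3" for x
    have \<psi>2: "C_k_on 2 UNIV \<psi>" unfolding \<psi>_def by (rule paraboloid_cubed)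
    then have \<psi>2\<Omega>: "C_k_on 2 \<Omega> \<psi>" by (rule C_k_on_subset) simp
    have lap: "laplacian \<psi> x = 24 * r\<^sup>2 * ?p r x - (24 + 6 * N) * (?p r x)\<^sup>2" for x
      unfolding \<psi>_def N_def by (rule paraboloid_cubed)
    have off: "?p r x = 0" if "x \<notin> cball x0 r" for x
      using paraboloid_eq_0[of r x x0] r that by (simp add: dist_norm norm_minus_commute)
    have "(LINT x:\<Omega>|lborel. u x * (laplacian \<psi> x + c x * \<psi> x)) \<le> 0"
      using off by (intro super[OF \<psi>2\<Omega> compact_cball cball_sub(2)[OF r(2)]])
        (auto simp: \<psi>_def paraboloid_nonneg)
    also have "(LINT x:\<Omega>|lborel. u x * (laplacian \<psi> x + c x * \<psi> x)) =
        integral (cbox a b) (\<lambda>x. u x * (laplacian \<psi> x + c x * \<psi> x))"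
    proof (rule set_integral_eq_integral_cbox[OF ab(1)])
      show "continuous_on \<Omega> (\<lambda>x. u x * (laplacian \<psi> x + c x * \<psi> x))"
        unfolding lap unfolding \<psi>_def by (intro continuous_intros u(1) c(1) pc)
      show "u x * (laplacian \<psi> x + c x * \<psi> x) = 0" if "x \<in> \<Omega> - cbox a b" for x
      proof -
        have "x \<notin> cball x0 r" using cball_sub(1)[OF r(2)] that by auto
        from off[OF this] show ?thesis by (simp add: lap \<psi>_def)
      qed
    qed
    finally have "integral (cbox a b) (\<lambda>x. u x * (laplacian \<psi> x + c x * \<psi> x)) \<le> 0" .
    moreover have "integral (cbox a b) (\<lambda>x. u x * (6 * r * (2 * r * 2 * ?p r x)) -
        u x * ((24 + 6 * N + C * r\<^sup>2) * (?p r x)\<^sup>2)) \<le>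
        integral (cbox a b) (\<lambda>x. u x * (laplacian \<psi> x + c x * \<psi> x))"
    proof (rule integral_le)
      show "(\<lambda>x. u x * (6 * r * (2 * r * 2 * ?p r x)) - u x * ((24 + 6 * N + C * r\<^sup>2) * (?p r x)\<^sup>2)) integrable_on cbox a b"
        by (intro int continuous_intros ucb pc)
      show "(\<lambda>x. u x * (laplacian \<psi> x + c x * \<psi> x)) integrable_on cbox a b"
        unfolding lap unfolding \<psi>_def
        by (intro int continuous_intros ucb pc continuous_on_subset[OF c(1) ab(1)])
      fix x assume x: "x \<in> cbox a b"
      have 1: "- (c x * \<psi> x) \<le> C * \<psi> x"
        using c(2)[of x] x ab(1) mult_right_mono[of "- c x" C "\<psi> x"]
        by (auto simp: \<psi>_def paraboloid_nonneg abs_le_iff)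
      have 2: "\<psi> x = ?p r x * (?p r x)\<^sup>2" by (simp add: \<psi>_def power3_eq_cube power2_eq_square)
      have 3: "C * (?p r x * (?p r x)\<^sup>2) \<le> C * (r\<^sup>2 * (?p r x)\<^sup>2)"
      proof (rule mult_left_mono)
        show "0 \<le> C" using c(2)[OF x0(1)] by linarith
        show "?p r x * (?p r x)\<^sup>2 \<le> r\<^sup>2 * (?p r x)\<^sup>2" by (intro mult_right_mono paraboloid_le) simp
      qed
      have "- (c x * \<psi> x) \<le> C * (r\<^sup>2 * (?p r x)\<^sup>2)"
        using 1 3 unfolding 2 by (rule order_trans)
      then have "6 * r * (2 * r * 2 * ?p r x) - (24 + 6 * N + C * r\<^sup>2) * (?p r x)\<^sup>2 \<le>
          laplacian \<psi> x + c x * \<psi> x"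
        by (simp add: lap power2_eq_square algebra_simps)
      from mult_left_mono[OF this u0[OF x]]
      show "u x * (6 * r * (2 * r * 2 * ?p r x)) - u x * ((24 + 6 * N + C * r\<^sup>2) * (?p r x)\<^sup>2) \<le>
          u x * (laplacian \<psi> x + c x * \<psi> x)"
        by (simp only: right_diff_distrib)
    qed
    moreover have "integral (cbox a b) (\<lambda>x. u x * (6 * r * (2 * r * 2 * ?p r x)) -
        u x * ((24 + 6 * N + C * r\<^sup>2) * (?p r x)\<^sup>2)) = 6 * r * I' r - (24 + 6 * N + C * r\<^sup>2) * I r"
    proof -
      have "integral (cbox a b) (\<lambda>x. u x * (6 * r * (2 * r * 2 * ?p r x)) -
        u x * ((24 + 6 * N + C * r\<^sup>2) * (?p r x)\<^sup>2)) =
        integral (cbox a b) (\<lambda>x. 6 * r * (u x * (2 * r * 2 * ?p r x))) -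
        integral (cbox a b) (\<lambda>x. (24 + 6 * N + C * r\<^sup>2) * (u x * (?p r x)\<^sup>2))"
        by (subst integral_diff[symmetric]) (intro int continuous_intros ucb pc, simp add: mult_ac)+
      then show ?thesis
        by (simp only: I_def I'_def Henstock_Kurzweil_Integration.integral_mult_right)
    qed
    ultimately have "6 * r * I' r \<le> (24 + 6 * N + C * r\<^sup>2) * I r" by linarith
    then show ?thesis by (simp add: field_simps)
  qed
  \<comment> \<open>The integrating factor of the differential inequality.\<close>
  define \<phi> where "\<phi> r = exp (- C * r\<^sup>2 / 12) / r ^ (CARD('n) + 4)" for r
  have d\<phi>: "(\<phi> has_real_derivative - \<phi> r * (C * r / 6 + (N + 4) / r)) (at r)" if "0 < r" for r
  proof -
    have "((\<lambda>r. exp (- C * r\<^sup>2 / 12)) has_real_derivative exp (- C * r\<^sup>2 / 12) * (- C * r / 6)) (at r)"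
      by (auto intro!: derivative_eq_intros)
    moreover have "((\<lambda>r. r ^ (CARD('n) + 4)) has_real_derivative r ^ (CARD('n) + 4) * ((N + 4) / r)) (at r)"
    proof -
      have "CARD('n) + 4 = Suc (CARD('n) + 3)" by simp
      then have "r ^ (CARD('n) + 4) * ((N + 4) / r) = (N + 4) * r ^ (CARD('n) + 3)"
        using that by (simp only: power_Suc) simp
      then show ?thesis using DERIV_pow[of "CARD('n) + 4" r] by (simp add: N_def add.commute)
    qed
    moreover have "r ^ (CARD('n) + 4) \<noteq> 0" using that by simp
    ultimately have "(\<phi> has_real_derivative (exp (- C * r\<^sup>2 / 12) * (- C * r / 6) * r ^ (CARD('n) + 4) -
        exp (- C * r\<^sup>2 / 12) * (r ^ (CARD('n) + 4) * ((N + 4) / r))) /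
        (r ^ (CARD('n) + 4) * r ^ (CARD('n) + 4))) (at r)"
      unfolding \<phi>_def[abs_def] by (rule DERIV_divide)
    moreover have "(E * (- C * r / 6) * P - E * (P * ((N + 4) / r))) / (P * P) =
        - (E / P) * (C * r / 6 + (N + 4) / r)" if "P \<noteq> 0" for E P :: real
      using that \<open>0 < r\<close> by (simp add: field_simps)
    ultimately show ?thesis using \<open>r ^ (CARD('n) + 4) \<noteq> 0\<close> by (simp only: \<phi>_def) simp
  qed
  have \<phi>: "0 < \<phi> r" if "0 < r" for r using that by (simp add: \<phi>_def)
  have mono: "\<phi> \<rho> * I \<rho> \<le> \<phi> r * I r" if r: "0 < r" "r \<le> \<rho>" for r
  proof (rule DERIV_nonpos_imp_nonincreasing[OF r(2)])
    fix s assume s: "r \<le> s" "s \<le> \<rho>"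
    then have s0: "0 < s" using r by simp
    have "((\<lambda>r. \<phi> r * I r) has_real_derivative - \<phi> s * (C * s / 6 + (N + 4) / s) * I s + I' s * \<phi> s) (at s)"
      by (rule DERIV_mult[OF d\<phi>[OF s0] dI])
    moreover have "- \<phi> s * (C * s / 6 + (N + 4) / s) * I s + I' s * \<phi> s =
        \<phi> s / s * (s * I' s - (N + 4 + C * s\<^sup>2 / 6) * I s)"
      using s0 by (simp add: field_simps power2_eq_square)
    moreover have "\<phi> s / s * (s * I' s - (N + 4 + C * s\<^sup>2 / 6) * I s) \<le> 0"
      using diff_ineq[OF s0 s(2)] \<phi>[OF s0] s0 by (intro mult_nonneg_nonpos) auto
    ultimately show "\<exists>y. ((\<lambda>r. \<phi> r * I r) has_real_derivative y) (at s) \<and> y \<le> 0" by metis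
  qed
  define \<omega> where "\<omega> = unit_ball_vol N"
  have "0 \<le> C" using c(2)[OF x0(1)] by linarith
  have small: "\<phi> \<rho> * I \<rho> \<le> e * \<omega>" if e: "0 < e" for e
  proof -
    obtain d where d: "0 < d" "\<And>x. x \<in> \<Omega> \<Longrightarrow> dist x x0 < d \<Longrightarrow> dist (u x) (u x0) < e"
      using u(1) x0(1) e unfolding continuous_on_iff by blast
    define r where "r = min \<rho> (d / 2)"
    have r: "0 < r" "r \<le> \<rho>" "r < d" using d(1) \<rho>(1) by (auto simp: r_def)
    have "I r \<le> integral (cbox a b) (\<lambda>x. e * r ^ 4 * indicator (cball x0 r) x)"
      unfolding I_def
    proof (rule integral_le)
      show "(\<lambda>x. u x * (?p r x)\<^sup>2) integrable_on cbox a b" by (intro int continuous_intros ucb pc)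
      show "(\<lambda>x. e * r ^ 4 * indicator (cball x0 r) x) integrable_on cbox a b"
        by (intro integrable_on_mult_right) (simp add: integrable_on_indicator lmeasurable_cbox fmeasurable.Int)
      fix x assume x: "x \<in> cbox a b"
      show "u x * (?p r x)\<^sup>2 \<le> e * r ^ 4 * indicator (cball x0 r) x"
      proof (cases "x \<in> cball x0 r")
        case True
        then have "u x \<le> e"
          using d(2)[of x] cball_sub(2)[OF r(2)] r(3) x0(2) by (auto simp: dist_commute dist_real_def)
        moreover have "(?p r x)\<^sup>2 \<le> (r\<^sup>2)\<^sup>2"
          by (intro power_mono paraboloid_le paraboloid_nonneg)
        ultimately have "u x * (?p r x)\<^sup>2 \<le> e * (r\<^sup>2)\<^sup>2"
          using e by (intro mult_mono) auto
        then show ?thesis using True by simp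
      next
        case False
        then show ?thesis
          using paraboloid_eq_0[of r x x0] r by (simp add: dist_norm norm_minus_commute)
      qed
    qed
    also have "\<dots> = e * r ^ 4 * measure lebesgue (cball x0 r)"
      using integral_indicator[of "cball x0 r" "cbox a b"] cball_sub(1)[OF r(2)] by (simp add: inf.absorb1)
    also have "measure lebesgue (cball x0 r) = \<omega> * r ^ CARD('n)"
      using content_cball[of r x0] r(1) by (simp add: \<omega>_def N_def)
    finally have Ir: "I r \<le> e * r ^ 4 * (\<omega> * r ^ CARD('n))" .
    have "\<phi> \<rho> * I \<rho> \<le> \<phi> r * I r" by (rule mono[OF r(1,2)])
    also have "\<dots> \<le> \<phi> r * (e * r ^ 4 * (\<omega> * r ^ CARD('n)))"
      using Ir \<phi>[OF r(1)] by simp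
    also have "\<dots> = exp (- C * r\<^sup>2 / 12) * (e * \<omega>)"
      using r(1) by (simp add: \<phi>_def power_add field_simps)
    also have "\<dots> \<le> 1 * (e * \<omega>)"
      using \<open>0 \<le> C\<close> e by (intro mult_right_mono) (auto simp: \<omega>_def N_def)
    finally show ?thesis by simp
  qed
  have "\<phi> \<rho> * I \<rho> \<le> 0"
  proof (rule ccontr)
    assume "\<not> \<phi> \<rho> * I \<rho> \<le> 0"
    moreover have "0 < \<omega>" by (simp add: \<omega>_def N_def)
    ultimately have "\<phi> \<rho> * I \<rho> \<le> \<phi> \<rho> * I \<rho> / (2 * \<omega>) * \<omega>" by (intro small) simp
    also have "\<dots> = \<phi> \<rho> * I \<rho> / 2" using \<open>0 < \<omega>\<close> by simp
    finally show False using \<open>\<not> \<phi> \<rho> * I \<rho> \<le> 0\<close> by linarith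
  qed
  then have "I \<rho> \<le> 0" using \<phi>[OF \<rho>(1)] by (simp add: mult_le_0_iff)
  moreover have "0 \<le> I \<rho>" unfolding I_def using u0 by (intro integral_nonneg int continuous_intros ucb pc) simp
  moreover have "(\<lambda>x. u x * (?p \<rho> x)\<^sup>2) integrable_on cbox a b"
    by (intro int continuous_intros ucb pc)
  ultimately have "((\<lambda>x. u x * (?p \<rho> x)\<^sup>2) has_integral 0) (cbox a b)"
    by (simp add: I_def has_integral_iff)
  then have "u x * (?p \<rho> x)\<^sup>2 = 0" if "x \<in> cbox a b" for x
  proof (rule has_integral_0_cbox_imp_0[rotated 2])
    show "continuous_on (cbox a b) (\<lambda>x. u x * (?p \<rho> x)\<^sup>2)" by (intro continuous_intros ucb pc)
    show "0 \<le> u y * (?p \<rho> y)\<^sup>2" if "y \<in> box a b" for y using u0 that box_subset_cbox by fastforce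
    show "box a b \<noteq> {}" using ab(2) by blast
  qed (fact that)
  then have "x \<in> \<Omega> \<and> u x = 0" if "x \<in> ball x0 \<rho>" for x
    using that cball_sub[of \<rho>] paraboloid_pos[of x x0 \<rho>] by (force simp: dist_norm norm_minus_commute)
  then show ?thesis using \<rho>(1) by blast
qed

section \<open>A maximum principle in thin shells\<close>

lemma laplacian_nonpos_at_max:
  fixes f :: "real^'n \<Rightarrow> real"
  assumes D: "open D" "x \<in> D" and f: "C_k_on 2 D f" and max: "\<And>y. y \<in> D \<Longrightarrow> f y \<le> f x"
  shows "laplacian f x \<le> 0"
  unfolding laplacian_def
proof (rule sum_nonpos)
  fix k :: 'n
  obtain d where d: "0 < d" "ball x d \<subseteq> D" using D open_contains_ball by blast
  have inD: "x + t *\<^sub>R axis k 1 \<in> D" if "\<bar>t\<bar> < d" for t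
    using d(2) that by (auto simp: dist_norm norm_axis_1)
  have d1: "((\<lambda>t. f (x + t *\<^sub>R axis k 1)) has_real_derivative
      partial_deriv k f (x + t *\<^sub>R axis k 1)) (at t)" if "\<bar>t\<bar> < d" for t
    using f inD[OF that] by (intro has_real_derivative_along_axis) (simp add: C_k_on_2_iff)
  have d2: "((\<lambda>t. partial_deriv k f (x + t *\<^sub>R axis k 1)) has_real_derivative
      partial_deriv k (partial_deriv k f) x) (at 0)"
    using has_real_derivative_along_axis[of "partial_deriv k f" x 0 k] f D(2) by (simp add: C_k_on_2_iff)
  have zero: "partial_deriv k f x = 0"
    using DERIV_local_max[OF d1[of 0] d(1)] max inD d(1) by simp
  show "partial_deriv k (partial_deriv k f) x \<le> 0"
  proof (rule ccontr)
    assume "\<not> partial_deriv k (partial_deriv k f) x \<le> 0"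
    then obtain e where e: "0 < e"
      "\<And>h. 0 < h \<Longrightarrow> h < e \<Longrightarrow> 0 < partial_deriv k f (x + h *\<^sub>R axis k 1)"
      using DERIV_pos_inc_right[OF d2] zero by auto
    define h where "h = min d e / 2"
    have h: "0 < h" "h < d" "h < e" using d(1) e(1) by (auto simp: h_def)
    obtain z where z: "0 < z" "z < h" "f (x + h *\<^sub>R axis k 1) - f (x + 0 *\<^sub>R axis k 1) =
        (h - 0) * partial_deriv k f (x + z *\<^sub>R axis k 1)"
      using MVT2[of 0 h "\<lambda>t. f (x + t *\<^sub>R axis k 1)" "\<lambda>t. partial_deriv k f (x + t *\<^sub>R axis k 1)"] d1 h
      by force
    have "0 < (h - 0) * partial_deriv k f (x + z *\<^sub>R axis k 1)"
      using e(2)[of z] z h by (intro mult_pos_pos) auto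
    then show False using z(3) max[OF inD[of h]] h by simp
  qed
qed

text \<open>
  At an interior maximum of \<open>|w\<^sub>i| / h\<close> over all points and all components \<open>i\<close>, with maximal value
  \<open>M\<close>, the function \<open>\<plusminus> w\<^sub>i - M h\<close> has a maximum, so its Laplacian is \<open>\<le> 0\<close>; but the strict
  inequality for \<open>h\<close> makes it positive if \<open>M > 0\<close>. Taking the maximum over the components as well
  makes the coupling harmless, whatever its signs.
\<close>

lemma elliptic_system_comparison:
  fixes w :: "'m::finite \<Rightarrow> real^'n \<Rightarrow> real"
  assumes D: "open D" "bounded D"
    and w: "\<And>i. C_k_on 2 D (w i)" "\<And>i. continuous_on (closure D) (w i)"
    and h: "C_k_on 2 D h" "continuous_on (closure D) h" "\<And>x. x \<in> closure D \<Longrightarrow> 0 < h x"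
    and \<Lambda>: "0 \<le> \<Lambda>"
    and super: "\<And>x. x \<in> D \<Longrightarrow> laplacian h x < - (\<Lambda> * real CARD('m) * h x)"
    and eq: "\<And>i x. x \<in> D \<Longrightarrow> \<bar>laplacian (w i) x\<bar> \<le> \<Lambda> * (\<Sum>j\<in>UNIV. \<bar>w j x\<bar>)"
    and bd: "\<And>i x. x \<in> frontier D \<Longrightarrow> \<bar>w i x\<bar> \<le> m * h x" and m: "0 \<le> m"
    and x: "x \<in> closure D"
  shows "\<bar>w i x\<bar> \<le> m * h x"
proof -
  have comp: "compact (closure D)" using D(2) by (simp add: compact_closure)
  have hne: "\<And>x. x \<in> closure D \<Longrightarrow> h x \<noteq> 0" using h(3) by force
  have "\<exists>y\<in>closure D. \<forall>z\<in>closure D. \<bar>w j z\<bar> / h z \<le> \<bar>w j y\<bar> / h y" for j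
    using x hne by (intro continuous_attains_sup comp continuous_intros w(2) h(2)) auto
  then obtain y where y: "\<And>j. y j \<in> closure D"
    "\<And>j z. z \<in> closure D \<Longrightarrow> \<bar>w j z\<bar> / h z \<le> \<bar>w j (y j)\<bar> / h (y j)" by metis
  define f where "f j = \<bar>w j (y j)\<bar> / h (y j)" for j
  have "Max (range f) \<in> range f" by (intro Max_in) auto
  then obtain i0 where "Max (range f) = f i0" by (rule rangeE)
  then have i0: "\<bar>w j (y j)\<bar> / h (y j) \<le> \<bar>w i0 (y i0)\<bar> / h (y i0)" for j
    using Max_ge[of "range f" "f j"] by (simp add: f_def)
  define x0 where "x0 = y i0"
  define M where "M = \<bar>w i0 x0\<bar> / h x0"
  have wM: "\<bar>w j z\<bar> \<le> M * h z" if z: "z \<in> closure D" for j z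
  proof -
    have "\<bar>w j z\<bar> / h z \<le> M" using y(2)[OF z, of j] i0[of j] by (simp add: M_def x0_def)
    then show ?thesis using h(3)[OF z] by (simp add: pos_divide_le_eq)
  qed
  have "M \<le> m"
  proof (rule ccontr)
    assume "\<not> M \<le> m"
    then have M: "m < M" "0 < M" using m by auto
    have x0c: "x0 \<in> closure D" using y(1) by (simp add: x0_def)
    have hx0: "0 < h x0" using h(3)[OF x0c] .
    have wx0: "\<bar>w i0 x0\<bar> = M * h x0" using hx0 by (simp add: M_def)
    have "x0 \<notin> frontier D"
      using bd[of x0 i0] M(1) hx0 wx0 mult_strict_right_mono[OF M(1) hx0] by auto
    then have x0: "x0 \<in> D" using x0c D(1) by (simp add: frontier_def interior_open)
    define \<sigma> where "\<sigma> = sgn (w i0 x0)"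
    have \<sigma>: "\<bar>\<sigma>\<bar> \<le> 1" "\<sigma> * w i0 x0 = \<bar>w i0 x0\<bar>" by (auto simp: \<sigma>_def sgn_if)
    have \<sigma>le: "\<sigma> * t \<le> \<bar>t\<bar>" "- \<bar>t\<bar> \<le> \<sigma> * t" for t
      using \<sigma>(1) mult_right_mono[OF \<sigma>(1), of "\<bar>t\<bar>"] abs_mult[of \<sigma> t] by (auto simp: abs_le_iff)
    have "laplacian (\<lambda>x. \<sigma> * w i0 x + (- M) * h x) x0 \<le> 0"
    proof (rule laplacian_nonpos_at_max[OF D(1) x0])
      show "C_k_on 2 D (\<lambda>x. \<sigma> * w i0 x + (- M) * h x)" by (rule linear_combination(1)[OF D(1) x0 w(1) h(1)])
      fix z assume "z \<in> D"
      then have "z \<in> closure D" using closure_subset by auto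
      then show "\<sigma> * w i0 z + (- M) * h z \<le> \<sigma> * w i0 x0 + (- M) * h x0"
        using wM[of z i0] \<sigma>le(1)[of "w i0 z"] \<sigma>(2) wx0 by simp
    qed
    also have "laplacian (\<lambda>x. \<sigma> * w i0 x + (- M) * h x) x0 =
        \<sigma> * laplacian (w i0) x0 + (- M) * laplacian h x0"
      by (rule linear_combination(3)[OF D(1) x0 w(1) h(1)])
    finally have "\<sigma> * laplacian (w i0) x0 - M * laplacian h x0 \<le> 0" by simp
    moreover have "- (\<Lambda> * (real CARD('m) * (M * h x0))) \<le> \<sigma> * laplacian (w i0) x0"
    proof -
      have "(\<Sum>j\<in>UNIV. \<bar>w j x0\<bar>) \<le> (\<Sum>j\<in>(UNIV::'m set). M * h x0)"
        by (intro sum_mono wM x0c)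
      then have "\<Lambda> * (\<Sum>j\<in>UNIV. \<bar>w j x0\<bar>) \<le> \<Lambda> * (real CARD('m) * (M * h x0))"
        using \<Lambda> by (intro mult_left_mono) simp_all
      then show ?thesis using eq[OF x0, of i0] \<sigma>le(2)[of "laplacian (w i0) x0"] by linarith
    qed
    moreover have "M * laplacian h x0 < - (\<Lambda> * (real CARD('m) * (M * h x0)))"
      using mult_strict_left_mono[OF super[OF x0] M(2)] by (simp add: mult_ac)
    ultimately show False by linarith
  qed
  then have "M * h x \<le> m * h x" using h(3)[OF x] by (intro mult_right_mono) auto
  then show ?thesis using wM[OF x, of i] by linarith
qed

text \<open>
  Near the sphere \<open>x \<bullet> x = c\<close> this function is close to 1, while its Laplacian is below a negative
  multiple of \<open>B\<^sup>2\<close>. It serves on both sides of the sphere, hence for outer and inner boundaries.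
\<close>

lemma shell_barrier:
  fixes c B :: real
  defines "h \<equiv> \<lambda>x :: real^'n. 2 - (1 + B * (x \<bullet> x - c))\<^sup>2"
  shows "C_k_on 2 S h"
    and "laplacian h x = - 8 * B\<^sup>2 * (x \<bullet> x) - 4 * real CARD('n) * B * (1 + B * (x \<bullet> x - c))"
proof -
  have d: "(h has_derivative (\<lambda>v. - 4 * B * (1 + B * (x \<bullet> x - c)) * (x \<bullet> v))) (at x)" for x
    unfolding h_def by (auto intro!: derivative_eq_intros simp: inner_commute algebra_simps)
  have p: "partial_deriv k h = (\<lambda>x. - 4 * B * (1 + B * (x \<bullet> x - c)) * x $ k)" for k
    by (rule ext) (simp add: partial_deriv_eqI[OF d] inner_axis)
  have d2: "((\<lambda>x. - 4 * B * (1 + B * (x \<bullet> x - c)) * x $ k) has_derivative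
      (\<lambda>v. - 4 * B * (1 + B * (x \<bullet> x - c)) * v $ k + - 8 * B\<^sup>2 * (x \<bullet> v) * x $ k)) (at x)" for x :: "real^'n" and k
    by (rule has_derivative_eq_rhs, rule has_derivative_mult, (rule derivative_intros)+,
        rule bounded_linear.has_derivative[OF bounded_linear_vec_nth has_derivative_ident])
      (simp add: inner_commute algebra_simps power2_eq_square)
  have pp: "partial_deriv l (\<lambda>x::real^'n. - 4 * B * (1 + B * (x \<bullet> x - c)) * x $ k) = (\<lambda>x.
      - 4 * B * (1 + B * (x \<bullet> x - c)) * axis l 1 $ k + - 8 * B\<^sup>2 * x $ l * x $ k)" for k l
    by (rule ext) (subst partial_deriv_eqI[OF d2], simp add: inner_axis)
  show "C_k_on 2 S h"
    unfolding C_k_on_2_iff p pp using d d2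
    by (auto simp: differentiable_def intro!: continuous_intros)
  have "laplacian h x = (\<Sum>k\<in>(UNIV::'n set). - 4 * B * (1 + B * (x \<bullet> x - c)) - 8 * B\<^sup>2 * (x $ k * x $ k))"
    unfolding laplacian_def p pp by (simp add: mult.assoc)
  also have "\<dots> = - 4 * real CARD('n) * B * (1 + B * (x \<bullet> x - c)) - 8 * B\<^sup>2 * (x \<bullet> x)"
    by (simp add: sum_subtractf sum_distrib_left inner_vec_def mult.assoc)
  finally show "laplacian h x = - 8 * B\<^sup>2 * (x \<bullet> x) - 4 * real CARD('n) * B * (1 + B * (x \<bullet> x - c))" by simp
qed

text \<open>
  In a sufficiently thin shell around a sphere, a linear elliptic system with bounded coefficients
  satisfies the maximum principle up to a constant factor. The thickness \<open>\<delta>0\<close> depends on \<open>c\<close>, the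
  bound \<open>\<Lambda>\<close> and the number of components only, not on the solution \<open>w\<close>.
\<close>

lemma thin_shell_estimate:
  fixes c \<Lambda> :: real
  assumes c: "0 < c" and \<Lambda>: "0 \<le> \<Lambda>"
  obtains \<delta>0 where "0 < \<delta>0"
    "\<And>\<delta> \<Omega> (w :: 'm::finite \<Rightarrow> real^'n \<Rightarrow> real) m i x.
      0 < \<delta> \<Longrightarrow> \<delta> \<le> \<delta>0 \<Longrightarrow> open \<Omega> \<Longrightarrow> bounded \<Omega> \<Longrightarrow>
      (\<And>i. C_k_on 2 \<Omega> (w i)) \<Longrightarrow> (\<And>i. continuous_on (closure \<Omega>) (w i)) \<Longrightarrow>
      (\<And>i x. x \<in> \<Omega> \<Longrightarrow> \<bar>laplacian (w i) x\<bar> \<le> \<Lambda> * (\<Sum>j\<in>UNIV. \<bar>w j x\<bar>)) \<Longrightarrow>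
      (\<And>i x. x \<in> frontier \<Omega> \<Longrightarrow> w i x = 0) \<Longrightarrow>
      (\<And>i x. x \<in> \<Omega> \<Longrightarrow> \<bar>x \<bullet> x - c\<bar> = \<delta> \<Longrightarrow> \<bar>w i x\<bar> \<le> m) \<Longrightarrow> 0 \<le> m \<Longrightarrow>
      x \<in> \<Omega> \<Longrightarrow> \<bar>x \<bullet> x - c\<bar> < \<delta> \<Longrightarrow> \<bar>w i x\<bar> \<le> 4 * m"
proof -
  define L where "L = \<Lambda> * real CARD('m)"
  have L: "0 \<le> L" using \<Lambda> by (simp add: L_def)
  \<comment> \<open>Chosen such that \<open>4 * B\<^sup>2 * c > 2 * L\<close>, whereas the barrier is smaller than 2.\<close>
  define B where "B = L / c + 1"
  have B: "1 \<le> B" "L + c = B * c" using L c by (auto simp: B_def field_simps)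
  \<comment> \<open>In the shell, \<open>x \<bullet> x \<ge> c / 2\<close> and the quantity that is squared in the barrier lies in \<open>[3/4, 5/4]\<close>.\<close>
  define \<delta>0 where "\<delta>0 = min (c / 2) (1 / (4 * B))"
  have \<delta>0: "0 < \<delta>0" using c B(1) by (simp add: \<delta>0_def)
  define h where "h = (\<lambda>x :: real^'n. 2 - (1 + B * (x \<bullet> x - c))\<^sup>2)"
  have Bc: "2 * L < 4 * B\<^sup>2 * c"
  proof -
    have "L + c \<le> B * (B * c)" using B c mult_right_mono[of 1 B "B * c"] by simp
    then show ?thesis using L c by (simp add: power2_eq_square mult.assoc)
  qed
  show thesis
  proof (rule that[OF \<delta>0])
    fix \<delta> \<Omega> and w :: "'m \<Rightarrow> real^'n \<Rightarrow> real" and m i x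
    assume \<delta>: "0 < \<delta>" "\<delta> \<le> \<delta>0" and \<Omega>: "open \<Omega>" "bounded \<Omega>"
      and w: "\<And>i. C_k_on 2 \<Omega> (w i)" "\<And>i. continuous_on (closure \<Omega>) (w i)"
      and eq: "\<And>i x. x \<in> \<Omega> \<Longrightarrow> \<bar>laplacian (w i) x\<bar> \<le> \<Lambda> * (\<Sum>j\<in>UNIV. \<bar>w j x\<bar>)"
      and bd: "\<And>i x. x \<in> frontier \<Omega> \<Longrightarrow> w i x = 0"
        "\<And>i x. x \<in> \<Omega> \<Longrightarrow> \<bar>x \<bullet> x - c\<bar> = \<delta> \<Longrightarrow> \<bar>w i x\<bar> \<le> m"
      and m: "0 \<le> m" and x: "x \<in> \<Omega>" "\<bar>x \<bullet> x - c\<bar> < \<delta>"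
    define D where "D = \<Omega> \<inter> {x. \<bar>x \<bullet> x - c\<bar> < \<delta>}"
    have D: "open D" "bounded D" "D \<subseteq> \<Omega>"
      unfolding D_def using \<Omega> by (auto intro!: open_Int open_Collect_less continuous_intros intro: bounded_subset)
    have clD: "closure D \<subseteq> closure \<Omega> \<inter> {x. \<bar>x \<bullet> x - c\<bar> \<le> \<delta>}"
    proof (rule closure_minimal)
      show "D \<subseteq> closure \<Omega> \<inter> {x. \<bar>x \<bullet> x - c\<bar> \<le> \<delta>}" unfolding D_def using closure_subset by force
      show "closed (closure \<Omega> \<inter> {x. \<bar>x \<bullet> x - c\<bar> \<le> \<delta>})"
        by (intro closed_Int closed_closure closed_Collect_le continuous_intros)
    qed
    have hb: "7 / 16 \<le> h y" "h y \<le> 23 / 16" "3 / 4 \<le> 1 + B * (y \<bullet> y - c)"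
      if "\<bar>y \<bullet> y - c\<bar> \<le> \<delta>" for y
    proof -
      have "\<bar>B * (y \<bullet> y - c)\<bar> \<le> B * (1 / (4 * B))"
        unfolding abs_mult using that \<delta>(2) B(1) by (intro mult_mono) (auto simp: \<delta>0_def)
      also have "\<dots> = 1 / 4" using B(1) by simp
      finally have s: "3 / 4 \<le> 1 + B * (y \<bullet> y - c)" "1 + B * (y \<bullet> y - c) \<le> 5 / 4" by linarith+
      then show "3 / 4 \<le> 1 + B * (y \<bullet> y - c)" by simp
      have "(3 / 4)\<^sup>2 \<le> (1 + B * (y \<bullet> y - c))\<^sup>2" "(1 + B * (y \<bullet> y - c))\<^sup>2 \<le> (5 / 4)\<^sup>2"
        using s by (intro power_mono; simp)+
      then show "7 / 16 \<le> h y" "h y \<le> 23 / 16" by (simp_all add: h_def power2_eq_square)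
    qed
    have "\<bar>w i x\<bar> \<le> 16 / 7 * m * h x"
    proof (rule elliptic_system_comparison[OF D(1,2) _ _ _ _ _ \<Lambda>])
      show "C_k_on 2 D (w j)" for j
        using w(1) D(3) by (rule C_k_on_subset)
      show "continuous_on (closure D) (w j)" for j
        using w(2) clD by (auto intro: continuous_on_subset)
      show "C_k_on 2 D h" unfolding h_def by (rule shell_barrier)
      show "continuous_on (closure D) h" unfolding h_def by (intro continuous_intros)
      show "0 < h y" if "y \<in> closure D" for y using hb(1)[of y] clD that by force
      show "laplacian h y < - (\<Lambda> * real CARD('m) * h y)" if "y \<in> D" for y
      proof -
        have y: "\<bar>y \<bullet> y - c\<bar> \<le> \<delta>" using that by (simp add: D_def)
        then have "c / 2 \<le> y \<bullet> y" using \<delta>(2) by (simp add: \<delta>0_def abs_le_iff)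
        then have "8 * B\<^sup>2 * (c / 2) \<le> 8 * B\<^sup>2 * (y \<bullet> y)" by (intro mult_left_mono) auto
        moreover have "0 \<le> 4 * real CARD('n) * B * (1 + B * (y \<bullet> y - c))"
          using hb(3)[OF y] B(1) by (intro mult_nonneg_nonneg) auto
        ultimately have "laplacian h y \<le> - 4 * B\<^sup>2 * c" unfolding h_def shell_barrier by linarith
        moreover have "L * h y \<le> L * 2" using hb(2)[OF y] L by (intro mult_left_mono) auto
        ultimately show ?thesis using Bc unfolding L_def by linarith
      qed
      show "\<bar>laplacian (w j) y\<bar> \<le> \<Lambda> * (\<Sum>j\<in>UNIV. \<bar>w j y\<bar>)" if "y \<in> D" for j y
        using eq that D(3) by blast
      show "\<bar>w j y\<bar> \<le> 16 / 7 * m * h y" if "y \<in> frontier D" for j y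
      proof -
        have yc: "y \<in> closure D" "y \<notin> D" using that D(1) by (auto simp: frontier_def interior_open)
        then have y: "y \<in> closure \<Omega>" "\<bar>y \<bullet> y - c\<bar> \<le> \<delta>" using clD by auto
        have "\<bar>w j y\<bar> \<le> m"
        proof (cases "y \<in> \<Omega>")
          case True
          then have "\<bar>y \<bullet> y - c\<bar> = \<delta>" using yc y by (auto simp: D_def)
          then show ?thesis using bd(2)[OF True] by blast
        next
          case False
          then have "y \<in> frontier \<Omega>" using y(1) \<Omega>(1) by (simp add: frontier_def interior_open)
          then show ?thesis using bd(1) m by simp
        qed
        also have "m \<le> 16 / 7 * m * h y"
          using mult_left_mono[OF hb(1)[OF y(2)] m] by simp
        finally show ?thesis .
      qed
      show "0 \<le> 16 / 7 * m" using m by simp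
      show "x \<in> closure D" using x closure_subset[of D] by (auto simp: D_def)
    qed
    also have "\<dots> \<le> 16 / 7 * m * (23 / 16)"
      using hb(2)[of x] x(2) m by (intro mult_left_mono) auto
    also have "\<dots> \<le> 4 * m" using m by simp
    finally show "\<bar>w i x\<bar> \<le> 4 * m" .
  qed
qed

section \<open>Plane rotations\<close>

locale rotation_plane =
  fixes p q :: "real^'n"
  assumes orthonormal: "p \<bullet> p = 1" "q \<bullet> q = 1" "p \<bullet> q = 0"
begin

definition rot :: "real \<Rightarrow> real^'n \<Rightarrow> real^'n" where
  "rot t z = z + ((cos t - 1) * (z \<bullet> p) - sin t * (z \<bullet> q)) *\<^sub>R p +
    ((cos t - 1) * (z \<bullet> q) + sin t * (z \<bullet> p)) *\<^sub>R q"

text \<open>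
  The infinitesimal generator of the rotations \<open>rot\<close>.
\<close>

definition rot_gen :: "real^'n \<Rightarrow> real^'n" where
  "rot_gen z = (z \<bullet> p) *\<^sub>R q - (z \<bullet> q) *\<^sub>R p"

lemma rot_0 [simp]: "rot 0 z = z" and rot_2pi [simp]: "rot (2 * pi) z = z"
  by (simp_all add: rot_def)

lemma rot_inner_pq:
  "rot t z \<bullet> p = cos t * (z \<bullet> p) - sin t * (z \<bullet> q)"
  "rot t z \<bullet> q = cos t * (z \<bullet> q) + sin t * (z \<bullet> p)"
  using orthonormal by (simp_all add: rot_def inner_add_left inner_commute[of q p] algebra_simps)

lemma rot_inner_self: "rot t z \<bullet> rot t z = z \<bullet> z"
proof -
  define \<alpha> where "\<alpha> = (cos t - 1) * (z \<bullet> p) - sin t * (z \<bullet> q)"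
  define \<beta> where "\<beta> = (cos t - 1) * (z \<bullet> q) + sin t * (z \<bullet> p)"
  have "rot t z \<bullet> rot t z = z \<bullet> z + (2 * \<alpha> * (z \<bullet> p) + 2 * \<beta> * (z \<bullet> q) + \<alpha>\<^sup>2 + \<beta>\<^sup>2)"
    using orthonormal unfolding rot_def \<alpha>_def[symmetric] \<beta>_def[symmetric]
    by (simp add: inner_add_left inner_add_right inner_commute[of q p] inner_commute[of p z]
        inner_commute[of q z] power2_eq_square algebra_simps)
  also have "2 * \<alpha> * (z \<bullet> p) + 2 * \<beta> * (z \<bullet> q) + \<alpha>\<^sup>2 + \<beta>\<^sup>2 =
      ((z \<bullet> p)\<^sup>2 + (z \<bullet> q)\<^sup>2) * ((cos t)\<^sup>2 + (sin t)\<^sup>2 - 1)"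
  proof -
    have "2 * ((C - 1) * a - S * b) * a + 2 * ((C - 1) * b + S * a) * b + ((C - 1) * a - S * b)\<^sup>2 +
        ((C - 1) * b + S * a)\<^sup>2 = (a\<^sup>2 + b\<^sup>2) * (C\<^sup>2 + S\<^sup>2 - 1)" for C S a b :: real
      by (simp add: power2_eq_square algebra_simps)
    then show ?thesis unfolding \<alpha>_def \<beta>_def .
  qed
  finally show ?thesis by simp
qed

lemma norm_rot [simp]: "norm (rot t z) = norm z"
  by (simp add: norm_eq_sqrt_inner rot_inner_self)

lemma linear_rot: "linear (rot t)"
  by (rule linearI) (simp_all add: rot_def inner_add_left algebra_simps)

lemma orthogonal_rot: "orthogonal_transformation (rot t)"
  by (simp add: orthogonal_transformation linear_rot)

lemma rot_has_vector_derivative: "((\<lambda>t. rot t z) has_vector_derivative rot_gen (rot t z)) (at t)"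
  unfolding rot_gen_def rot_inner_pq unfolding rot_def
  by (auto intro!: derivative_eq_intros simp: algebra_simps)

lemma continuous_on_rot [continuous_intros]: "continuous_on S (\<lambda>t. rot t z)"
  unfolding rot_def by (intro continuous_intros)

lemma continuous_on_rot_gen [continuous_intros]: "continuous_on S rot_gen"
  unfolding rot_gen_def[abs_def] by (intro continuous_intros)

lemma DERIV_along_rot:
  assumes "f differentiable (at (rot t x))"
  shows "((\<lambda>t. f (rot t x)) has_real_derivative gradient f (rot t x) \<bullet> rot_gen (rot t x)) (at t)"
proof -
  have "((\<lambda>t. f (rot t x)) has_derivative (\<lambda>s. gradient f (rot t x) \<bullet> (s *\<^sub>R rot_gen (rot t x)))) (at t)"
    using has_derivative_compose[OF rot_has_vector_derivative[unfolded has_vector_derivative_def]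
        has_derivative_gradient[OF assms]] .
  then show ?thesis unfolding has_field_derivative_def
    by (rule has_derivative_eq_rhs) (simp add: fun_eq_iff mult.commute)
qed

end

text \<open>
  The vectors \<open>x\<close> and \<open>y\<close> span the plane of rotation. If they are parallel, any second direction
  orthogonal to \<open>x\<close> will do, and there is one in dimension at least 2.
\<close>

lemma obtain_rotation:
  fixes x y :: "real^'n"
  assumes "CARD('n) \<ge> 2" "norm x = norm y" "x \<noteq> 0"
  obtains p q t where "rotation_plane p q" "0 \<le> t" "t \<le> 2 * pi" "rotation_plane.rot p q t x = y"
proof -
  define r where "r = norm x"
  have r: "0 < r" "norm y = r" using assms by (auto simp: r_def)
  define p where "p = x /\<^sub>R r"
  have pp: "p \<bullet> p = 1" using r(1) by (simp add: p_def r_def dot_square_norm power2_eq_square)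
  have x: "x = r *\<^sub>R p" using r(1) by (simp add: p_def)
  define y' where "y' = y - (y \<bullet> p) *\<^sub>R p"
  have "\<exists>q \<beta>. q \<bullet> q = 1 \<and> p \<bullet> q = 0 \<and> y = (y \<bullet> p) *\<^sub>R p + (r * \<beta>) *\<^sub>R q"
  proof (cases "y' = 0")
    case True
    have "2 \<le> DIM(real^'n)" using assms(1) by simp
    then obtain z where z: "z \<noteq> 0" "orthogonal p z" using orthogonal_to_vector_exists by blast
    then have "sgn z \<bullet> sgn z = 1" "p \<bullet> sgn z = 0"
      by (auto simp: dot_square_norm norm_sgn sgn_div_norm orthogonal_def)
    then show ?thesis using True by (intro exI[of _ "sgn z"] exI[of _ 0]) (simp add: y'_def)
  next
    case False
    have "p \<bullet> y' = 0" using pp by (simp add: y'_def inner_diff_right inner_commute)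
    then have "sgn y' \<bullet> sgn y' = 1" "p \<bullet> sgn y' = 0"
      using False by (auto simp: dot_square_norm norm_sgn sgn_div_norm)
    moreover have "y = (y \<bullet> p) *\<^sub>R p + (r * (norm y' / r)) *\<^sub>R sgn y'"
      using False r(1) by (simp add: y'_def sgn_div_norm)
    ultimately show ?thesis by blast
  qed
  then obtain q \<beta> where q: "q \<bullet> q = 1" "p \<bullet> q = 0" and y: "y = (y \<bullet> p) *\<^sub>R p + (r * \<beta>) *\<^sub>R q" by blast
  define \<alpha> where "\<alpha> = (y \<bullet> p) / r"
  have y\<alpha>: "y = (r * \<alpha>) *\<^sub>R p + (r * \<beta>) *\<^sub>R q" using y r(1) by (simp add: \<alpha>_def)
  have "r\<^sup>2 = y \<bullet> y" using r(2) by (simp add: dot_square_norm)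
  also have "\<dots> = (r * \<alpha>)\<^sup>2 + (r * \<beta>)\<^sup>2"
    unfolding y\<alpha> using pp q by (simp add: inner_add_left inner_add_right inner_commute[of q p] power2_eq_square)
  finally have "\<alpha>\<^sup>2 + \<beta>\<^sup>2 = 1" using r(1) by (simp add: power_mult_distrib distrib_left[symmetric])
  then obtain t where t: "0 \<le> t" "t < 2 * pi" "\<alpha> = cos t" "\<beta> = sin t"
    using sincos_total_2pi by metis
  interpret rotation_plane p q by unfold_locales (use pp q in auto)
  have "rot t x = y"
    unfolding rot_def y\<alpha> t(3,4) using pp q by (simp add: x inner_commute algebra_simps)
  then show thesis using that[of p q t] t rotation_plane_axioms by auto
qed

section \<open>The nonlinearity and the domain\<close>

lemma C1_holder_on_imp_continuous_derivative:
  fixes f' :: "'a::euclidean_space \<Rightarrow> 'a \<Rightarrow>\<^sub>L 'b::real_normed_vector"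
  assumes "0 < \<alpha>" "closed S"
    and h: "\<And>K. compact K \<Longrightarrow> K \<subseteq> S \<Longrightarrow> \<exists>C. \<forall>p\<in>K. \<forall>q\<in>K. dist (f' p) (f' q) \<le> C * dist p q powr \<alpha>"
  shows "continuous_on S f'"
  unfolding continuous_on
proof
  fix p assume p: "p \<in> S"
  have "compact (cball p 1 \<inter> S)" using assms(2) by (simp add: compact_Int_closed)
  then obtain C where C: "\<And>q. q \<in> cball p 1 \<inter> S \<Longrightarrow> dist (f' q) (f' p) \<le> C * dist q p powr \<alpha>"
    using h[of "cball p 1 \<inter> S"] p by (metis IntI Int_lower2 centre_in_cball zero_le_one)
  have "((\<lambda>q. dist q p powr \<alpha>) \<longlongrightarrow> dist p p powr \<alpha>) (at p within S)"
    using assms(1) by (intro tendsto_powr' tendsto_intros) auto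
  from tendsto_mult_left[OF this, of C]
  have lim: "((\<lambda>q. C * dist q p powr \<alpha>) \<longlongrightarrow> 0) (at p within S)" by simp
  have "\<forall>\<^sub>F q in at p within S. norm (dist (f' q) (f' p)) \<le> C * dist q p powr \<alpha>"
    unfolding eventually_at using C by (intro exI[of _ 1]) (auto simp: dist_commute)
  from Lim_null_comparison[OF this lim] show "(f' \<longlongrightarrow> f' p) (at p within S)"
    by (rule tendsto_dist_iff[THEN iffD2])
qed

lemma du_properties:
  fixes F :: "real \<times> (real^'m) \<Rightarrow> real^'m"
  assumes "0 < \<alpha>" "C1_holder_on \<alpha> ({0..} \<times> UNIV) F"
  shows "0 \<le> r \<Longrightarrow> ((\<lambda>v. F (r, v) $ i) has_derivative (\<lambda>h. \<Sum>j\<in>UNIV. du F i j r u * h $ j)) (at u)"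
    and "continuous_on ({0..} \<times> UNIV) (\<lambda>z. du F i j (fst z) (snd z))"
proof -
  let ?S = "{0..} \<times> UNIV :: (real \<times> (real^'m)) set"
  obtain f' :: "real \<times> (real^'m) \<Rightarrow> (real \<times> (real^'m)) \<Rightarrow>\<^sub>L (real^'m)" where
    f': "\<And>z. z \<in> ?S \<Longrightarrow> (F has_derivative blinfun_apply (f' z)) (at z within ?S)"
    and H: "\<And>K. compact K \<Longrightarrow> K \<subseteq> ?S \<Longrightarrow> \<exists>C. \<forall>p\<in>K. \<forall>q\<in>K. dist (f' p) (f' q) \<le> C * dist p q powr \<alpha>"
    using assms(2) unfolding C1_holder_on_def by metis
  have d: "((\<lambda>v. F (r, v) $ i) has_derivative (\<lambda>h. f' (r, u) (0, h) $ i)) (at u)" if "0 \<le> r" for r u i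
  proof -
    have "((\<lambda>v. (r, v)) has_derivative (\<lambda>h. (0, h))) (at u)" by (auto intro!: derivative_eq_intros)
    moreover have "(F has_derivative blinfun_apply (f' (r, u))) (at (r, u) within range (\<lambda>v. (r, v)))"
      by (rule has_derivative_subset[OF f']) (use that in auto)
    ultimately have "((\<lambda>v. F (r, v)) has_derivative (\<lambda>h. f' (r, u) (0, h))) (at u)"
      using has_derivative_in_compose[of "\<lambda>v. (r, v)" "\<lambda>h. (0, h)" u UNIV F] by simp
    then show ?thesis by (rule bounded_linear.has_derivative[OF bounded_linear_vec_nth])
  qed
  have du: "du F i j r u = f' (r, u) (0, axis j 1) $ i" if "0 \<le> r" for i j r u
    unfolding du_def by (rule partial_deriv_eqI[OF d[OF that]])
  show "((\<lambda>v. F (r, v) $ i) has_derivative (\<lambda>h. \<Sum>j\<in>UNIV. du F i j r u * h $ j)) (at u)" if "0 \<le> r"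
  proof -
    have "(\<lambda>v. F (r, v) $ i) differentiable (at u)" using d[OF that] differentiable_def by blast
    from has_derivative_gradient[OF this] show ?thesis by (simp add: inner_vec_def du_def)
  qed
  have "continuous_on ?S f'"
    by (rule C1_holder_on_imp_continuous_derivative[OF assms(1) _ H]) (auto intro: closed_Times)
  then have "continuous_on ?S (\<lambda>z. f' z (0, axis j 1) $ i)" by (intro continuous_intros)
  then show "continuous_on ?S (\<lambda>z. du F i j (fst z) (snd z))"
    by (rule continuous_on_eq) (auto simp: du)
qed

lemma lipschitz_of_du_bound:
  fixes F :: "real \<times> (real^'m) \<Rightarrow> real^'m"
  assumes "0 < \<alpha>" "C1_holder_on \<alpha> ({0..} \<times> UNIV) F" "0 \<le> r"
    and A: "\<And>j u. u \<in> cball 0 M \<Longrightarrow> \<bar>du F i j r u\<bar> \<le> A"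
    and ab: "a \<in> cball 0 M" "b \<in> cball 0 M"
  shows "\<bar>F (r, a) $ i - F (r, b) $ i\<bar> \<le> A * (\<Sum>j\<in>UNIV. \<bar>a $ j - b $ j\<bar>)"
proof -
  define \<phi> where "\<phi> t = b + t *\<^sub>R (a - b)" for t :: real
  have d: "((\<lambda>t. F (r, \<phi> t) $ i) has_real_derivative (\<Sum>j\<in>UNIV. du F i j r (\<phi> t) * (a $ j - b $ j))) (at t)" for t
  proof -
    have "(\<phi> has_derivative (\<lambda>s. s *\<^sub>R (a - b))) (at t)"
      unfolding \<phi>_def[abs_def] by (auto intro!: derivative_eq_intros)
    from has_derivative_compose[OF this du_properties(1)[OF assms(1-3)], of i]
    show ?thesis unfolding has_field_derivative_def
      by (rule has_derivative_eq_rhs) (simp add: fun_eq_iff sum_distrib_left sum_distrib_right mult_ac)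
  qed
  obtain z where z: "0 < z" "z < 1"
    "F (r, \<phi> 1) $ i - F (r, \<phi> 0) $ i = (1 - 0) * (\<Sum>j\<in>UNIV. du F i j r (\<phi> z) * (a $ j - b $ j))"
    using MVT2[OF zero_less_one, of "\<lambda>t. F (r, \<phi> t) $ i", OF d] by blast
  have "\<phi> z = (1 - z) *\<^sub>R b + z *\<^sub>R a" by (simp add: \<phi>_def algebra_simps)
  then have "\<phi> z \<in> cball 0 M"
    using convexD_alt[OF convex_cball ab(2,1), of z] z by simp
  have "\<bar>F (r, a) $ i - F (r, b) $ i\<bar> = \<bar>\<Sum>j\<in>UNIV. du F i j r (\<phi> z) * (a $ j - b $ j)\<bar>"
    using z(3) by (simp add: \<phi>_def)
  also have "\<dots> \<le> (\<Sum>j\<in>UNIV. A * \<bar>a $ j - b $ j\<bar>)"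
    using A[OF \<open>\<phi> z \<in> cball 0 M\<close>]
    by (intro order_trans[OF sum_abs] sum_mono) (simp add: abs_mult mult_right_mono)
  finally show ?thesis by (simp add: sum_distrib_left)
qed

text \<open>
  Balls and annuli in a common form. The value \<open>lo = -1\<close> stands for a ball: there is no inner boundary
  then, which is recognized by \<open>lo < 0\<close>.
\<close>

lemma ball_or_annulus_shell:
  fixes \<Omega> :: "(real^'n) set"
  assumes "ball_or_annulus \<Omega>"
  obtains lo hi where "lo \<noteq> 0" "lo < hi" "0 < hi" "\<Omega> = {x. lo < x \<bullet> x \<and> x \<bullet> x < hi}"
  using assms unfolding ball_or_annulus_def
proof (elim disjE exE conjE)
  fix R :: real assume R: "R > 0" "\<Omega> = ball 0 R"
  moreover have "-1 < R\<^sup>2" using zero_le_power2[of R] by linarith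
  ultimately show thesis
    by (intro that[of "-1" "R\<^sup>2"]) (auto simp: norm_lt_square intro: less_le_trans[OF _ inner_ge_zero])
next
  fix a b :: real assume "0 < a" "a < b" "\<Omega> = {x. a < norm x \<and> norm x < b}"
  then show thesis
    by (intro that[of "a\<^sup>2" "b\<^sup>2"]) (auto simp: norm_lt_square norm_gt_square power_strict_mono)
qed

section \<open>Radial symmetry\<close>

locale stable_solution =
  fixes \<Omega> :: "(real^'n) set"
    and F :: "real \<times> (real^'m) \<Rightarrow> real^'m"
    and U :: "real^'n \<Rightarrow> real^'m"
    and \<alpha> lo hi :: real
  assumes \<alpha>: "0 < \<alpha>" and F: "C1_holder_on \<alpha> ({0..} \<times> UNIV) F"
    and lohi: "lo \<noteq> 0" "lo < hi" "0 < hi" and \<Omega>: "\<Omega> = {x. lo < x \<bullet> x \<and> x \<bullet> x < hi}"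
    and sol: "classical_solution F \<Omega> U"
    and stab: "linearized_stable F \<Omega> U"
    and coop: "cooperative F \<Omega>"
begin

lemma open_\<Omega>: "open \<Omega>"
  unfolding \<Omega> Collect_conj_eq by (intro open_Int open_Collect_less continuous_intros)

lemma norm_\<Omega>: "x \<in> \<Omega> \<Longrightarrow> norm x \<le> sqrt hi"
  unfolding \<Omega> by (simp add: norm_eq_sqrt_inner)

lemma bounded_\<Omega>: "bounded \<Omega>"
  using norm_\<Omega> by (auto simp: bounded_iff)

lemma frontier_\<Omega>: "x \<in> frontier \<Omega> \<longleftrightarrow> x \<in> closure \<Omega> \<and> x \<notin> \<Omega>"
  using open_\<Omega> by (simp add: frontier_def interior_open)

abbreviation u :: "'m \<Rightarrow> real^'n \<Rightarrow> real" where "u i x \<equiv> U x $ i"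

abbreviation a :: "'m \<Rightarrow> 'm \<Rightarrow> real^'n \<Rightarrow> real" where "a i j x \<equiv> du F i j (norm x) (U x)"

lemma U_cont: "continuous_on (closure \<Omega>) U"
  and U_0: "x \<in> frontier \<Omega> \<Longrightarrow> U x = 0"
  and u2: "C_k_on 2 \<Omega> (u i)"
  and u_eq: "x \<in> \<Omega> \<Longrightarrow> laplacian (u i) x = - F (norm x, U x) $ i"
proof -
  have c2: "C_k_on 2 \<Omega> U" and eq: "\<And>x i. x \<in> \<Omega> \<Longrightarrow> - laplacian (u i) x = F (norm x, U x) $ i"
    and "continuous_on (closure \<Omega>) U" and "\<forall>x\<in>frontier \<Omega>. U x = 0"
    using sol unfolding classical_solution_def by auto
  then show "continuous_on (closure \<Omega>) U" "x \<in> frontier \<Omega> \<Longrightarrow> U x = 0" by auto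
  show "C_k_on 2 \<Omega> (u i)" by (rule C_k_on_component[OF open_\<Omega> c2])
  show "x \<in> \<Omega> \<Longrightarrow> laplacian (u i) x = - F (norm x, U x) $ i"
    using eq[of x i] by linarith
qed

lemma U_cont_\<Omega>: "continuous_on \<Omega> U"
  using U_cont closure_subset continuous_on_subset by blast

text \<open>
  Although \<open>F\<close> need not have bounded derivatives globally, only arguments \<open>(|x|, v)\<close> with \<open>v\<close> in a ball
  containing the range of \<open>U\<close> occur.
\<close>

lemma bounds:
  obtains A M where "0 \<le> A" "\<And>x. x \<in> \<Omega> \<Longrightarrow> U x \<in> cball 0 M"
    "\<And>i j r v. 0 \<le> r \<Longrightarrow> r \<le> sqrt hi \<Longrightarrow> v \<in> cball 0 M \<Longrightarrow> \<bar>du F i j r v\<bar> \<le> A"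
proof -
  have "compact (closure \<Omega>)" using bounded_\<Omega> by (simp add: compact_closure)
  then have "bounded (U ` closure \<Omega>)"
    using U_cont by (intro compact_imp_bounded compact_continuous_image)
  then obtain M where M: "\<And>x. x \<in> closure \<Omega> \<Longrightarrow> norm (U x) \<le> M" by (auto simp: bounded_iff)
  define K where "K = {0..sqrt hi} \<times> cball (0::real^'m) M"
  define g where "g z = (\<Sum>i\<in>UNIV. \<Sum>j\<in>UNIV. \<bar>du F i j (fst z) (snd z)\<bar>)" for z
  have "compact K" unfolding K_def by (intro compact_Times) auto
  moreover have "continuous_on K g"
    unfolding g_def K_def
    by (intro continuous_intros continuous_on_subset[OF du_properties(2)[OF \<alpha> F]]) auto
  ultimately have "bounded (g ` K)" by (intro compact_imp_bounded compact_continuous_image)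
  then obtain A where A: "\<And>z. z \<in> K \<Longrightarrow> \<bar>g z\<bar> \<le> A" by (auto simp: bounded_iff)
  have "\<bar>du F i j r v\<bar> \<le> max 0 A" if "0 \<le> r" "r \<le> sqrt hi" "v \<in> cball 0 M" for i j r v
  proof -
    have "\<bar>du F i j r v\<bar> \<le> (\<Sum>j\<in>UNIV. \<bar>du F i j r v\<bar>)"
      by (rule member_le_sum) auto
    also have "\<dots> \<le> g (r, v)"
      unfolding g_def fst_conv snd_conv
      by (rule member_le_sum[of i UNIV "\<lambda>i. \<Sum>j\<in>UNIV. \<bar>du F i j r v\<bar>"]) (auto intro: sum_nonneg)
    also have "\<dots> \<le> A" using A[of "(r, v)"] that by (auto simp: K_def)
    finally show ?thesis by simp
  qed
  then show thesis
    using M closure_subset[of \<Omega>] by (intro that[of "max 0 A" M]) auto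
qed

lemma a_cont: "continuous_on \<Omega> (a i j)"
proof -
  have "continuous_on \<Omega> (\<lambda>x. (norm x, U x))" by (intro continuous_intros U_cont_\<Omega>)
  from continuous_on_compose2[OF du_properties(2)[OF \<alpha> F] this, of i j] show ?thesis by force
qed

lemma stable_coupling: "stable_coupling \<Omega> a"
proof
  show "open \<Omega>" "bounded \<Omega>" by (rule open_\<Omega> bounded_\<Omega>)+
  show "continuous_on \<Omega> (a i j)" for i j by (rule a_cont)
  obtain A M where AM: "0 \<le> A" "\<And>x. x \<in> \<Omega> \<Longrightarrow> U x \<in> cball 0 M"
    "\<And>i j r v. 0 \<le> r \<Longrightarrow> r \<le> sqrt hi \<Longrightarrow> v \<in> cball 0 M \<Longrightarrow> \<bar>du F i j r v\<bar> \<le> A"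
    using bounds by blast
  then show "\<exists>A. \<forall>i j. \<forall>x\<in>\<Omega>. \<bar>a i j x\<bar> \<le> A" using norm_\<Omega> by (intro exI[of _ A]) auto
  show "0 \<le> a i j x" if "x \<in> \<Omega>" "i \<noteq> j" for i j x
    using coop that unfolding cooperative_def by blast
  fix \<Psi> :: "real^'n \<Rightarrow> real^'m" assume \<Psi>: "C1c \<Omega> \<Psi>"
  then have \<Psi>1: "C_k_on 1 \<Omega> (\<lambda>x. \<Psi> x $ i)" for i
    unfolding C1c_def using C_k_on_component[OF open_\<Omega>] by blast
  have \<Psi>c: "continuous_on \<Omega> (\<lambda>x. \<Psi> x $ i)" for i
    using \<Psi>1[of i] by (auto intro: continuous_on_if_differentiable)
  have "continuous_on \<Omega> (gradient (\<lambda>x. \<Psi> x $ i))" for i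
    by (rule continuous_on_gradient[OF \<Psi>1])
  then have "continuous_on \<Omega> (\<lambda>x. (\<Sum>j\<in>UNIV. (norm (gradient (\<lambda>y. \<Psi> y $ j) x))\<^sup>2) -
        (\<Sum>i\<in>UNIV. \<Sum>j\<in>UNIV. a i j x * \<Psi> x $ i * \<Psi> x $ j))"
    by (intro continuous_intros a_cont \<Psi>c)
  moreover have "0 \<le> Q_form F U \<Omega> \<Psi>" using stab \<Psi> unfolding linearized_stable_def by blast
  ultimately show "0 \<le> (LINT x:\<Omega>|lborel. (\<Sum>j\<in>UNIV. (norm (gradient (\<lambda>y. \<Psi> y $ j) x))\<^sup>2) -
        (\<Sum>i\<in>UNIV. \<Sum>j\<in>UNIV. a i j x * \<Psi> x $ i * \<Psi> x $ j))"
    unfolding Q_form_def by (subst set_integral_lebesgue_eq_lborel[OF open_\<Omega>, symmetric])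
qed

end

locale rotated_solution = stable_solution \<Omega> F U \<alpha> lo hi + rotation_plane p q
  for \<Omega> :: "(real^'n) set" and F :: "real \<times> (real^'m) \<Rightarrow> real^'m" and U \<alpha> lo hi and p q :: "real^'n"
begin

lemma rot_in_\<Omega> [simp]: "rot t x \<in> \<Omega> \<longleftrightarrow> x \<in> \<Omega>"
  unfolding \<Omega> by (simp add: rot_inner_self)

lemma rot_in_closure: "x \<in> closure \<Omega> \<Longrightarrow> rot t x \<in> closure \<Omega>"
proof -
  assume "x \<in> closure \<Omega>"
  moreover have "rot t ` closure \<Omega> \<subseteq> closure \<Omega>"
  proof (rule image_closure_subset)
    show "continuous_on (closure \<Omega>) (rot t)" by (simp add: linear_rot linear_continuous_on linear_linear)
    show "rot t ` \<Omega> \<subseteq> closure \<Omega>" using closure_subset[of \<Omega>] by auto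
  qed simp
  ultimately show ?thesis by blast
qed

text \<open>
  The angular derivative of \<open>u\<^sub>i\<close> and the difference quotients approximating it.
\<close>

definition V :: "'m \<Rightarrow> real^'n \<Rightarrow> real" where
  "V i x = gradient (u i) x \<bullet> rot_gen x"

definition w :: "real \<Rightarrow> 'm \<Rightarrow> real^'n \<Rightarrow> real" where
  "w \<theta> i x = (u i (rot \<theta> x) - u i x) / \<theta>"

lemma V_cont: "continuous_on \<Omega> (V i)"
  unfolding V_def[abs_def]
  by (intro continuous_intros continuous_on_gradient C_k_on_2_imp_1 u2)

lemma u_rot_deriv: "x \<in> \<Omega> \<Longrightarrow> ((\<lambda>t. u i (rot t x)) has_real_derivative V i (rot t x)) (at t)"
  unfolding V_def using u2[of i] by (intro DERIV_along_rot) (auto simp: C_k_on_2_iff)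

lemma w_eq: "w \<theta> i = (\<lambda>x. inverse \<theta> * u i (rot \<theta> x) + (- inverse \<theta>) * u i x)"
  by (simp add: w_def fun_eq_iff divide_inverse algebra_simps)

lemma w2: "C_k_on 2 \<Omega> (w \<theta> i)"
  and w_laplacian: "x \<in> \<Omega> \<Longrightarrow>
    laplacian (w \<theta> i) x = - ((F (norm x, U (rot \<theta> x)) $ i - F (norm x, U x) $ i) / \<theta>)"
  and w_cont: "continuous_on (closure \<Omega>) (w \<theta> i)"
  and w_0: "x \<in> frontier \<Omega> \<Longrightarrow> w \<theta> i x = 0"
proof -
  have sub: "rot \<theta> ` \<Omega> \<subseteq> \<Omega>" by auto
  have ur2: "C_k_on 2 \<Omega> (\<lambda>x. u i (rot \<theta> x))"
    by (rule C_k_on_compose_linear[OF open_\<Omega> linear_rot sub u2])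
  show "C_k_on 2 \<Omega> (w \<theta> i)"
  proof (cases "\<Omega> = {}")
    case False
    then show ?thesis unfolding w_eq using linear_combination(1)[OF open_\<Omega> _ ur2 u2] by blast
  qed (simp add: C_k_on_2_iff)
  show "laplacian (w \<theta> i) x = - ((F (norm x, U (rot \<theta> x)) $ i - F (norm x, U x) $ i) / \<theta>)" if x: "x \<in> \<Omega>"
    unfolding w_eq linear_combination(3)[OF open_\<Omega> x ur2 u2]
      laplacian_compose_orthogonal[OF open_\<Omega> orthogonal_rot sub u2 x]
    using u_eq[of "rot \<theta> x" i] u_eq[of x i] x by (simp add: divide_inverse algebra_simps)
  have "continuous_on (closure \<Omega>) (\<lambda>x. U (rot \<theta> x))"
    using rot_in_closure linear_continuous_on[OF linear_rot[THEN linear_linear[THEN iffD2]]]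
    by (intro continuous_on_compose2[OF U_cont]) auto
  then show "continuous_on (closure \<Omega>) (w \<theta> i)"
    unfolding w_eq by (intro continuous_intros U_cont)
  show "w \<theta> i x = 0" if "x \<in> frontier \<Omega>"
  proof -
    have "rot \<theta> x \<in> frontier \<Omega>" using that rot_in_closure by (auto simp: frontier_\<Omega>)
    then show ?thesis using that U_0 by (simp add: w_def)
  qed
qed

text \<open>
  The difference quotients satisfy a linear system with bounded coefficients, exactly and for every
  \<open>\<theta>\<close>: this is the Lipschitz bound for \<open>F\<close>.
\<close>

lemma w_laplacian_bound:
  assumes AM: "\<And>x. x \<in> \<Omega> \<Longrightarrow> U x \<in> cball 0 M"
    "\<And>i j r v. 0 \<le> r \<Longrightarrow> r \<le> sqrt hi \<Longrightarrow> v \<in> cball 0 M \<Longrightarrow> \<bar>du F i j r v\<bar> \<le> A"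
    and x: "x \<in> \<Omega>" and \<theta>: "0 < \<theta>"
  shows "\<bar>laplacian (w \<theta> i) x\<bar> \<le> A * (\<Sum>j\<in>UNIV. \<bar>w \<theta> j x\<bar>)"
proof -
  have "\<bar>F (norm x, U (rot \<theta> x)) $ i - F (norm x, U x) $ i\<bar> \<le> A * (\<Sum>j\<in>UNIV. \<bar>u j (rot \<theta> x) - u j x\<bar>)"
    using x AM(1)[of "rot \<theta> x"] AM(1)[of x]
    by (intro lipschitz_of_du_bound[OF \<alpha> F norm_ge_zero] AM(2) norm_\<Omega>) simp_all
  then have "\<bar>F (norm x, U (rot \<theta> x)) $ i - F (norm x, U x) $ i\<bar> / \<theta> \<le>
      A * (\<Sum>j\<in>UNIV. \<bar>u j (rot \<theta> x) - u j x\<bar>) / \<theta>"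
    using \<theta> by (intro divide_right_mono) auto
  also have "\<dots> = A * (\<Sum>j\<in>UNIV. \<bar>w \<theta> j x\<bar>)"
    using \<theta> by (simp add: w_def abs_divide flip: sum_divide_distrib)
  finally show ?thesis using \<theta> by (simp add: w_laplacian[OF x] abs_divide)
qed

text \<open>
  On a compact subset of \<open>\<Omega>\<close> the mean value theorem bounds \<open>w\<^sub>\<theta>\<close> by the maximum of the angular
  derivatives \<open>V\<close>. This bound is carried to the boundary spheres by the thin shell estimate, whose
  thickness is independent of \<open>\<theta>\<close>.
\<close>

lemma w_bounded: "\<exists>K. \<forall>\<theta>>0. \<forall>i. \<forall>x\<in>\<Omega>. \<bar>w \<theta> i x\<bar> \<le> K"
proof -
  obtain A M where AM: "0 \<le> A" "\<And>x. x \<in> \<Omega> \<Longrightarrow> U x \<in> cball 0 M"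
    "\<And>i j r v. 0 \<le> r \<Longrightarrow> r \<le> sqrt hi \<Longrightarrow> v \<in> cball 0 M \<Longrightarrow> \<bar>du F i j r v\<bar> \<le> A"
    using bounds by blast
  \<comment> \<open>The thin shell estimate at the sphere \<open>x \<bullet> x = c\<close>, for all quotients at once.\<close>
  define good where "good c \<delta>0 \<longleftrightarrow> (\<forall>\<delta> \<theta> m i x. 0 < \<delta> \<longrightarrow> \<delta> \<le> \<delta>0 \<longrightarrow> 0 < \<theta> \<longrightarrow> 0 \<le> m \<longrightarrow>
      (\<forall>j. \<forall>x\<in>\<Omega>. \<bar>x \<bullet> x - c\<bar> = \<delta> \<longrightarrow> \<bar>w \<theta> j x\<bar> \<le> m) \<longrightarrow>
      x \<in> \<Omega> \<longrightarrow> \<bar>x \<bullet> x - c\<bar> < \<delta> \<longrightarrow> \<bar>w \<theta> i x\<bar> \<le> 4 * m)" for c \<delta>0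
  have good: "\<exists>\<delta>0>0. good c \<delta>0" if c: "0 < c" for c
  proof -
    obtain \<delta>0 where \<delta>0: "0 < \<delta>0"
      "\<And>\<delta> \<Omega>' (v :: 'm \<Rightarrow> real^'n \<Rightarrow> real) m i x.
      0 < \<delta> \<Longrightarrow> \<delta> \<le> \<delta>0 \<Longrightarrow> open \<Omega>' \<Longrightarrow> bounded \<Omega>' \<Longrightarrow>
      (\<And>i. C_k_on 2 \<Omega>' (v i)) \<Longrightarrow> (\<And>i. continuous_on (closure \<Omega>') (v i)) \<Longrightarrow>
      (\<And>i x. x \<in> \<Omega>' \<Longrightarrow> \<bar>laplacian (v i) x\<bar> \<le> A * (\<Sum>j\<in>UNIV. \<bar>v j x\<bar>)) \<Longrightarrow>
      (\<And>i x. x \<in> frontier \<Omega>' \<Longrightarrow> v i x = 0) \<Longrightarrow>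
      (\<And>i x. x \<in> \<Omega>' \<Longrightarrow> \<bar>x \<bullet> x - c\<bar> = \<delta> \<Longrightarrow> \<bar>v i x\<bar> \<le> m) \<Longrightarrow> 0 \<le> m \<Longrightarrow>
      x \<in> \<Omega>' \<Longrightarrow> \<bar>x \<bullet> x - c\<bar> < \<delta> \<Longrightarrow> \<bar>v i x\<bar> \<le> 4 * m"
      by (rule thin_shell_estimate[OF c AM(1)]) blast
    have "good c \<delta>0"
      unfolding good_def
    proof (intro allI impI)
      fix \<delta> \<theta> m i x
      assume a: "0 < \<delta>" "\<delta> \<le> \<delta>0" "0 < \<theta>" "0 \<le> m"
        "\<forall>j. \<forall>x\<in>\<Omega>. \<bar>x \<bullet> x - c\<bar> = \<delta> \<longrightarrow> \<bar>w \<theta> j x\<bar> \<le> m" "x \<in> \<Omega>" "\<bar>x \<bullet> x - c\<bar> < \<delta>"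
      show "\<bar>w \<theta> i x\<bar> \<le> 4 * m"
        using a by (intro \<delta>0(2)[of \<delta> \<Omega> "w \<theta>", OF a(1,2) open_\<Omega> bounded_\<Omega> w2 w_cont
              w_laplacian_bound[OF AM(2,3) _ a(3)] w_0]) auto
    qed
    then show ?thesis using \<delta>0(1) by blast
  qed
  obtain \<delta>1 where \<delta>1: "0 < \<delta>1" "good hi \<delta>1" using good[OF lohi(3)] by blast
  obtain \<delta>2 where \<delta>2: "0 < \<delta>2" "0 < lo \<Longrightarrow> good lo \<delta>2" using good[of lo] by (metis zero_less_one)
  \<comment> \<open>The bound \<open>\<bar>lo\<bar>\<close> makes the inner shell empty when \<open>\<Omega>\<close> is a ball.\<close>
  define \<delta> where "\<delta> = min (min \<delta>1 \<delta>2) (min \<bar>lo\<bar> ((hi - lo) / 2))"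
  have "\<delta> \<le> (hi - lo) / 2"
    unfolding \<delta>_def by (rule order_trans[OF min.cobounded2 min.cobounded2])
  then have "\<delta> * 2 \<le> hi - lo" by (simp only: le_divide_eq_numeral1)
  then have "lo + \<delta> \<le> hi - \<delta>" by linarith
  moreover have "0 < \<delta>" "\<delta> \<le> \<delta>1" "\<delta> \<le> \<delta>2" "\<delta> \<le> \<bar>lo\<bar>"
    using \<delta>1(1) \<delta>2(1) lohi by (auto simp: \<delta>_def)
  ultimately have \<delta>: "0 < \<delta>" "\<delta> \<le> \<delta>1" "\<delta> \<le> \<delta>2" "\<delta> \<le> \<bar>lo\<bar>" "lo + \<delta> \<le> hi - \<delta>" by auto
  define K where "K = {x::real^'n. lo + \<delta> \<le> x \<bullet> x \<and> x \<bullet> x \<le> hi - \<delta>}"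
  have K\<Omega>: "K \<subseteq> \<Omega>" using \<delta>(1) by (auto simp: K_def \<Omega>)
  have "closed K" unfolding K_def Collect_conj_eq by (intro closed_Int closed_Collect_le continuous_intros)
  then have K: "compact K" using K\<Omega> bounded_\<Omega> bounded_subset compact_eq_bounded_closed by blast
  have "bounded ((\<lambda>x. \<Sum>i\<in>UNIV. \<bar>V i x\<bar>) ` K)"
    by (intro compact_imp_bounded compact_continuous_image K continuous_intros
        continuous_on_subset[OF V_cont K\<Omega>])
  then obtain C0 where "\<And>x. x \<in> K \<Longrightarrow> \<bar>\<Sum>i\<in>UNIV. \<bar>V i x\<bar>\<bar> \<le> C0" by (auto simp: bounded_iff)
  moreover have "\<bar>V i x\<bar> \<le> \<bar>\<Sum>i\<in>UNIV. \<bar>V i x\<bar>\<bar>" for i x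
    using member_le_sum[of i UNIV "\<lambda>i. \<bar>V i x\<bar>"] by simp
  ultimately have C0: "\<bar>V i x\<bar> \<le> C0" if "x \<in> K" for i x using that order_trans by blast
  define C where "C = max 0 C0"
  have inner: "\<bar>w \<theta> i x\<bar> \<le> C" if \<theta>: "0 < \<theta>" and xK: "x \<in> K" for \<theta> i x
  proof -
    obtain z where "u i (rot \<theta> x) - u i (rot 0 x) = (\<theta> - 0) * V i (rot z x)"
      using MVT2[OF \<theta>, of "\<lambda>t. u i (rot t x)" "\<lambda>t. V i (rot t x)"]
        u_rot_deriv[OF subsetD[OF K\<Omega> xK], of i] by blast
    then have "w \<theta> i x = V i (rot z x)" using \<theta> by (simp add: w_def)
    moreover have "rot z x \<in> K" using xK by (simp add: K_def rot_inner_self)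
    ultimately show ?thesis using C0[of "rot z x" i] by (simp add: C_def)
  qed
  have "\<bar>w \<theta> i x\<bar> \<le> 4 * C" if \<theta>: "0 < \<theta>" and x: "x \<in> \<Omega>" for \<theta> i x
  proof -
    have C: "0 \<le> C" by (simp add: C_def)
    consider "x \<in> K" | "\<bar>x \<bullet> x - hi\<bar> < \<delta>" | "\<bar>x \<bullet> x - lo\<bar> < \<delta>"
      using x \<delta>(1) by (force simp: K_def \<Omega> abs_if)
    then show ?thesis
    proof cases
      case 1
      then show ?thesis using inner[OF \<theta> 1, of i] C by linarith
    next
      case 2
      have "y \<in> K" if "y \<in> \<Omega>" "\<bar>y \<bullet> y - hi\<bar> = \<delta>" for y
        using that \<delta> by (auto simp: K_def \<Omega> abs_if split: if_splits)
      then show ?thesis using \<delta>1(2) \<delta>(1,2) \<theta> C x 2 inner[OF \<theta>] unfolding good_def by blast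
    next
      case 3
      have lo: "0 < lo" using 3 \<delta>(4) lohi(1) inner_ge_zero[of x] by linarith
      have "y \<in> K" if "y \<in> \<Omega>" "\<bar>y \<bullet> y - lo\<bar> = \<delta>" for y
        using that \<delta> by (auto simp: K_def \<Omega> abs_if split: if_splits)
      then show ?thesis using \<delta>2(2)[OF lo] \<delta>(1,3) \<theta> C x 3 inner[OF \<theta>] unfolding good_def by blast
    qed
  qed
  then show ?thesis by blast
qed

text \<open>
  As \<open>\<theta> \<rightarrow> 0\<close> the quotients and their Laplacians converge pointwise, because both are difference
  quotients of differentiable functions of the angle, and they are uniformly bounded.
\<close>

lemma V_weak_supersolution:
  assumes \<psi>: "C_k_on 2 \<Omega> \<psi>" "compact K" "K \<subseteq> \<Omega>" "\<And>x. x \<in> \<Omega> - K \<Longrightarrow> \<psi> x = 0"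
      "\<And>x. x \<in> \<Omega> \<Longrightarrow> 0 \<le> \<psi> x"
  shows "(LINT x:\<Omega>|lborel. max 0 (V i x) * (laplacian \<psi> x + a i i x * \<psi> x)) \<le> 0"
proof -
  interpret stable_coupling \<Omega> a by (rule stable_coupling)
  obtain A M where AM: "0 \<le> A" "\<And>x. x \<in> \<Omega> \<Longrightarrow> U x \<in> cball 0 M"
    "\<And>i j r v. 0 \<le> r \<Longrightarrow> r \<le> sqrt hi \<Longrightarrow> v \<in> cball 0 M \<Longrightarrow> \<bar>du F i j r v\<bar> \<le> A"
    using bounds by blast
  obtain B where B: "\<And>\<theta> i x. 0 < \<theta> \<Longrightarrow> x \<in> \<Omega> \<Longrightarrow> \<bar>w \<theta> i x\<bar> \<le> B" using w_bounded by blast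
  define \<theta> where "\<theta> n = inverse (real (Suc n))" for n
  have \<theta>: "0 < \<theta> n" for n by (simp add: \<theta>_def)
  have "\<theta> \<longlonglongrightarrow> 0" unfolding \<theta>_def by (rule LIMSEQ_inverse_real_of_nat)
  then have \<theta>0: "filterlim \<theta> (at 0) sequentially"
    using \<theta> by (auto simp: filterlim_at intro!: always_eventually) (metis less_irrefl)
  define B' where "B' = max B (A * (\<Sum>j\<in>(UNIV::'m set). B))"
  show ?thesis
  proof (rule limit_is_weak_supersolution[where v = "\<lambda>n. w (\<theta> n)" and B = B'])
    show "C_k_on 2 \<Omega> (w (\<theta> n) j)" "continuous_on (closure \<Omega>) (w (\<theta> n) j)" for n j
      by (rule w2 w_cont)+
    show "w (\<theta> n) j x = 0" if "x \<in> frontier \<Omega>" for n j x using w_0[OF that] .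
    fix x assume x: "x \<in> \<Omega>"
    show "\<bar>w (\<theta> n) j x\<bar> \<le> B'" for n j using B[OF \<theta> x, of n j] by (simp add: B'_def)
    show "\<bar>laplacian (w (\<theta> n) j) x\<bar> \<le> B'" for n j
    proof -
      have "\<bar>laplacian (w (\<theta> n) j) x\<bar> \<le> A * (\<Sum>k\<in>UNIV. \<bar>w (\<theta> n) k x\<bar>)"
        by (rule w_laplacian_bound[OF AM(2,3) x \<theta>])
      also have "\<dots> \<le> A * (\<Sum>j\<in>(UNIV::'m set). B)"
        using AM(1) B[OF \<theta> x] by (intro mult_left_mono sum_mono) auto
      finally show ?thesis by (simp add: B'_def)
    qed
    show "(\<lambda>n. w (\<theta> n) j x) \<longlonglongrightarrow> V j x" for j
    proof -
      have "((\<lambda>h. (u j (rot h x) - u j x) / h) \<longlongrightarrow> V j x) (at 0)"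
        using u_rot_deriv[OF x, of j 0] by (simp add: DERIV_def)
      from filterlim_compose[OF this \<theta>0] show ?thesis by (simp add: w_def)
    qed
    show "(\<lambda>n. laplacian (w (\<theta> n) j) x) \<longlonglongrightarrow> - (\<Sum>k\<in>UNIV. a j k x * V k x)" for j
    proof -
      have "((\<lambda>t. U (rot t x)) has_derivative (\<lambda>s. \<chi> k. s * V k x)) (at 0)"
      proof -
        have "((\<lambda>t. u k (rot t x)) has_derivative (\<lambda>s. s * V k x)) (at 0)" for k
          using u_rot_deriv[OF x, of k 0] unfolding has_field_derivative_def
          by (rule has_derivative_eq_rhs) (simp add: fun_eq_iff mult.commute)
        then have "((\<lambda>t. U (rot t x) \<bullet> b) has_derivative (\<lambda>s. (\<chi> k. s * V k x) \<bullet> b)) (at 0)"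
          if "b \<in> Basis" for b
          using that by (auto simp: Basis_vec_def inner_axis)
        then show ?thesis by (subst has_derivative_componentwise_within) blast
      qed
      moreover have "((\<lambda>v. F (norm x, v) $ j) has_derivative (\<lambda>h. \<Sum>k\<in>UNIV. a j k x * h $ k))
          (at (U (rot 0 x)))"
        using du_properties(1)[OF \<alpha> F norm_ge_zero, of x j "U x"] by simp
      ultimately have "((\<lambda>t. F (norm x, U (rot t x)) $ j) has_derivative
          (\<lambda>s. \<Sum>k\<in>UNIV. a j k x * (\<chi> k. s * V k x) $ k)) (at 0)"
        by (rule has_derivative_compose)
      then have "((\<lambda>t. F (norm x, U (rot t x)) $ j) has_derivative
          (\<lambda>s. \<Sum>k\<in>UNIV. a j k x * (s * V k x))) (at 0)" by simp
      then have "((\<lambda>t. F (norm x, U (rot t x)) $ j) has_real_derivative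
          (\<Sum>k\<in>UNIV. a j k x * V k x)) (at 0)"
        unfolding has_field_derivative_def
        by (rule has_derivative_eq_rhs) (simp add: fun_eq_iff sum_distrib_left mult_ac)
      then have "((\<lambda>h. (F (norm x, U (rot h x)) $ j - F (norm x, U x) $ j) / h) \<longlongrightarrow>
          (\<Sum>k\<in>UNIV. a j k x * V k x)) (at 0)"
        by (simp add: DERIV_def)
      from tendsto_minus[OF filterlim_compose[OF this \<theta>0]] show ?thesis
        by (simp add: w_laplacian[OF x])
    qed
  qed (use \<psi> V_cont in auto)
qed

text \<open>
  The set \<open>Z\<close> of angles with \<open>V\<^sub>i \<le> 0\<close> is closed by continuity, open by the strong minimum principle
  and nonempty by Rolle's theorem. Hence \<open>u\<^sub>i\<close> is nonincreasing along the orbit, and it returns to its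
  initial value.
\<close>

lemma U_rot:
  assumes x: "x \<in> \<Omega>" and t: "0 \<le> t" "t \<le> 2 * pi"
  shows "U (rot t x) = U x"
proof -
  have "u i (rot t x) = u i x" for i
  proof -
    define Z where "Z = {t. V i (rot t x) \<le> 0}"
    have Vc: "continuous_on UNIV (\<lambda>t. V i (rot t x))"
      using x by (intro continuous_on_compose2[OF V_cont] continuous_intros) auto
    have "closed Z"
      unfolding Z_def by (intro closed_Collect_le Vc continuous_intros)
    moreover have "open Z"
      unfolding open_dist
    proof
      fix s assume s: "s \<in> Z"
      obtain A M where AM: "0 \<le> A" "\<And>x. x \<in> \<Omega> \<Longrightarrow> U x \<in> cball 0 M"
        "\<And>i j r v. 0 \<le> r \<Longrightarrow> r \<le> sqrt hi \<Longrightarrow> v \<in> cball 0 M \<Longrightarrow> \<bar>du F i j r v\<bar> \<le> A"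
        using bounds by blast
      have "\<exists>r>0. \<forall>y\<in>ball (rot s x) r. y \<in> \<Omega> \<and> max 0 (V i y) = 0"
      proof (rule weak_supersolution_vanishes_near_zero[OF open_\<Omega>, where c = "a i i" and C = A])
        show "continuous_on \<Omega> (\<lambda>y. max 0 (V i y))" by (intro continuous_intros V_cont)
        show "\<bar>a i i y\<bar> \<le> A" if "y \<in> \<Omega>" for y using AM(2,3) norm_\<Omega> that by simp
        show "max 0 (V i (rot s x)) = 0" using s by (simp add: Z_def)
      qed (use x a_cont V_weak_supersolution in auto)
      then obtain r where r: "0 < r" "\<And>y. y \<in> ball (rot s x) r \<Longrightarrow> max 0 (V i y) = 0" by blast
      have rV: "V i y \<le> 0" if "dist (rot s x) y < r" for y
        using r(2)[of y] that max.cobounded2[of "V i y" 0] by simp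
      have "continuous_on UNIV (\<lambda>t. rot t x)" by (rule continuous_on_rot)
      then obtain e where "0 < e" "\<And>t. dist t s < e \<Longrightarrow> dist (rot t x) (rot s x) < r"
        using r(1) unfolding continuous_on_iff by blast
      then show "\<exists>e>0. \<forall>t. dist t s < e \<longrightarrow> t \<in> Z"
        using rV by (auto simp: Z_def dist_commute)
    qed
    moreover have "Z \<noteq> {}"
    proof -
      obtain z where "u i (rot (2 * pi) x) - u i (rot 0 x) = (2 * pi - 0) * V i (rot z x)"
        using MVT2[of 0 "2 * pi" "\<lambda>t. u i (rot t x)"] u_rot_deriv[OF x] pi_gt_zero by force
      then have "V i (rot z x) = 0" by simp
      then have "z \<in> Z" by (simp add: Z_def)
      then show ?thesis by blast
    qed
    ultimately have "Z = UNIV" using clopen[of Z] by blast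
    then have V0: "V i (rot s x) \<le> 0" for s by (auto simp: Z_def)
    have mono: "u i (rot s' x) \<le> u i (rot s x)" if "s \<le> s'" for s s'
      using DERIV_nonpos_imp_nonincreasing[OF that, of "\<lambda>t. u i (rot t x)"] u_rot_deriv[OF x] V0 by blast
    from mono[OF t(1)] mono[OF t(2)] show ?thesis by simp
  qed
  then show ?thesis by (simp add: vec_eq_iff)
qed

end

theorem theorem1p2:
  fixes \<Omega> :: "(real^'n) set"
    and F :: "real \<times> (real^'m) \<Rightarrow> real^'m"
    and U :: "real^'n \<Rightarrow> real^'m"
    and \<alpha> :: real
  assumes "CARD('m) \<ge> 2" and "CARD('n) \<ge> 2"
    and "0 < \<alpha>" and "\<alpha> < 1"
    and "ball_or_annulus \<Omega>"
    and "C1_holder_on \<alpha> ({0..} \<times> UNIV) F"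
    and "classical_solution F \<Omega> U"
    and "linearized_stable F \<Omega> U"
    and "fully_coupled F \<Omega> U"
  shows "radial_on (closure \<Omega>) U"
proof -
  obtain lo hi where shell: "lo \<noteq> 0" "lo < hi" "0 < hi" "\<Omega> = {x. lo < x \<bullet> x \<and> x \<bullet> x < hi}"
    by (rule ball_or_annulus_shell[OF assms(5)])
  interpret stable_solution \<Omega> F U \<alpha> lo hi
  proof
    show "cooperative F \<Omega>" using assms(9) by (simp add: fully_coupled_def)
  qed (fact assms(3,6-8) shell)+
  \<comment> \<open>Membership in \<open>\<Omega>\<close> depends on the norm only, so two points of equal norm are both inside or both on the boundary, where \<open>U\<close> vanishes.\<close>
  have eq: "U x = U y" if x: "x \<in> closure \<Omega>" and y: "y \<in> closure \<Omega>" and xy: "norm x = norm y" for x y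
  proof (cases "x \<in> \<Omega>")
    case True
    show ?thesis
    proof (cases "x = 0")
      case False
      obtain p q t where r: "rotation_plane p q" "0 \<le> t" "t \<le> 2 * pi" "rotation_plane.rot p q t x = y"
        using obtain_rotation[OF assms(2) xy False] by blast
      interpret rotation_plane p q by (rule r)
      interpret rotated_solution \<Omega> F U \<alpha> lo hi p q ..
      show ?thesis using U_rot[OF True r(2,3)] r(4) by simp
    qed (use xy in simp)
  next
    case False
    have "x \<bullet> x = y \<bullet> y" using xy by (simp add: norm_eq)
    then have "y \<notin> \<Omega>" using False by (simp add: shell(4))
    then show ?thesis using False x y U_0 by (simp add: frontier_\<Omega>)
  qed
  define g where "g r = U (SOME x. x \<in> closure \<Omega> \<and> norm x = r)" for r
  have "U x = g (norm x)" if "x \<in> closure \<Omega>" for x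
  proof -
    have "(SOME y. y \<in> closure \<Omega> \<and> norm y = norm x) \<in> closure \<Omega> \<and>
        norm (SOME y. y \<in> closure \<Omega> \<and> norm y = norm x) = norm x"
      by (rule someI[of _ x]) (use that in simp)
    then show ?thesis unfolding g_def using eq[OF that] by metis
  qed
  then show ?thesis unfolding radial_on_def by blast
qed

end
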